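(* Let $(\mathcal{R},\partial,\mathrm{Q})$ be a commutative quasi-integro-differential ring, and let $\mathrm{IDR}_{\mathrm{Q}}(\mathcal{R})$ (with its $\partial$ and $\int$) and $\iota:\mathcal{R}\to\mathrm{IDR}_{\mathrm{Q}}(\mathcal{R})$ be as defined in the context. Let $(\mathcal{S},\partial,\int)$ be a commutative integro-differential ring and let $\varphi:\mathcal{R}\to\mathcal{S}$ be a differential ring homomorphism such that $\varphi(\mathrm{Q}\partial f)=\int\partial\varphi(f)$ for all $f\in\mathcal{R}$. Then there exists a unique integro-differential ring homomorphism $\eta:\mathrm{IDR}_{\mathrm{Q}}(\mathcal{R})\to\mathcal{S}$ such that $\eta(\iota(f))=\varphi(f)$ for all $f\in\mathcal{R}$.
   Context: Rings and algebras have a unit, homomorphisms preserve it. A differential ring is a ring with an additive map $\partial$ satisfying the Leibniz rule; its ring of constants is $\ker\partial$. An integro-differential ring $(\mathcal{S},\partial,\int)$ is a differential ring with a $\ker(\partial)$-linear map $\int:\mathcal{S}\to\mathcal{S}$ such that $\partial\int=\mathrm{id}$. Differential (integro-differential) ring homomorphisms are ring homomorphisms commuting with $\partial$ (with $\partial$ and $\int$). A commutative quasi-integro-differential ring $(\mathcal{R},\partial,\mathrm{Q})$ is a commutative differential ring with constants $\mathcal{C}=\ker\partial$ and a $\mathcal{C}$-linear $\mathrm{Q}:\mathcal{R}\to\mathcal{R}$ with $\partial\mathrm{Q}\partial=\partial$ and $\mathrm{Q}\partial\mathrm{Q}=\mathrm{Q}$. All tensor and symmetric products are over $\mathcal{C}$.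 Put $\mathcal{R}_{\mathrm{J}}=\mathrm{Q}\mathcal{R}$ and $\mathcal{R}_{\mathrm{T}}=\ker\mathrm{Q}$, so $\mathcal{R}=\mathcal{C}\oplus\mathcal{R}_{\mathrm{J}}=(\partial\mathcal{R})\oplus\mathcal{R}_{\mathrm{T}}$. Tensors: $\mathcal{T}=\bigoplus_{n\ge0}\mathcal{R}_{\mathrm{T}}^{\otimes n}$ with empty tensor $1_{\mathcal{T}}$; $\widetilde{\mathcal{T}}=\bigoplus_{n\ge1}\mathcal{R}_{\mathrm{T}}^{\otimes n}$. The shuffle product $\sqcup\!\sqcup$ on $\mathcal{T}$ is the $\mathcal{C}$-bilinear product with $t\sqcup\!\sqcup s=t\otimes s$ if $t$ or $s$ has length $0$ and $t\sqcup\!\sqcup s=t_1\otimes((t_2\otimes\dots\otimes t_n)\sqcup\!\sqcup s)+s_1\otimes(t\sqcup\!\sqcup(s_2\otimes\dots\otimes s_m))$ for pure tensors of lengths $n,m\ge1$. For a pure tensor $f=f_1\otimes\dots\otimes f_n$, $f_i^j:=f_i\otimes\dots\otimes f_j$, and $f_i^j=1_{\mathcal{T}}$ if $i=j+1$. Constants: $\widetilde{M}_1=\mathcal{R}_{\mathrm{J}}\otimes\widetilde{\mathcal{T}}$, $M_2=\widetilde{\mathcal{T}}^{\odot2}$ (symmetric square). $\varepsilon(\widetilde{M}_1),\varepsilon(M_2)$ are isomorphic copies with isomorphisms $\varepsilon$. $\widetilde{\mathcal{C}}_1=\mathrm{Sym}(\varepsilon(\widetilde{M}_1))$ and $\mathcal{C}_2=\mathrm{Sym}(\varepsilon(M_2))/J_2$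 (unital symmetric $\mathcal{C}$-algebras), where $J_2$ is the ideal generated by all $$\varepsilon((f\sqcup\!\sqcup g)\odot h)-\varepsilon(f\odot(g\sqcup\!\sqcup h))+\sum_{j=0}^{m-1}\Big(\sum_{i=\max(0,1-j)}^{n-1}\varepsilon(f_{i+1}^n\odot g_{j+1}^m)\cdot\varepsilon((f_1^i\sqcup\!\sqcup g_1^j)\odot h)-\sum_{k=\max(0,1-j)}^{l-1}\varepsilon(f\odot(g_1^j\sqcup\!\sqcup h_1^k))\cdot\varepsilon(g_{j+1}^m\odot h_{k+1}^l)\Big)$$ for $n,m,l\ge1$ and pure tensors $f\in\mathcal{R}_{\mathrm{T}}^{\otimes n}$, $g\in\mathcal{R}_{\mathrm{T}}^{\otimes m}$, $h\in\mathcal{R}_{\mathrm{T}}^{\otimes l}$. Elements $\varepsilon(\cdot)$ of $\mathcal{C}_2$ denote classes. Product on $\mathcal{C}_2\otimes\mathcal{T}$: the $\mathcal{C}$-bilinear map with, for $c,d\in\mathcal{C}_2$ and pure tensors $f,g$ of lengths $n,m\ge0$, $$(c\otimes f)\cdot(d\otimes g)=(c\cdot d)\otimes(f\sqcup\!\sqcup g)+\sum_{i=0}^{n-1}\sum_{j=0}^{m-1}\big(c\cdot d\cdot\varepsilon(f_{i+1}^n\odot g_{j+1}^m)\big)\otimes(f_1^i\sqcup\!\sqcup g_1^j);$$ this makes $\mathcal{C}_2\otimes\mathcal{T}$ a commutative $\mathcal{C}$-algebra with unit $1\otimes1_{\mathcal{T}}$. $\mathrm{IDR}_{\mathrm{Q}}(\mathcal{R}):=\mathcal{R}\otimes\widetilde{\mathcal{C}}_1\otimes\mathcal{C}_2\otimes\mathcal{T}$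 is the tensor product of the commutative $\mathcal{C}$-algebras $\mathcal{R}$, $\widetilde{\mathcal{C}}_1$ and $\mathcal{C}_2\otimes\mathcal{T}$; $\iota(f)=f\otimes1\otimes1\otimes1_{\mathcal{T}}$ for $f\in\mathcal{R}$. For $f_0\in\mathcal{R}$, $c=c_1\otimes c_2\in\widetilde{\mathcal{C}}_1\otimes\mathcal{C}_2$ and a pure tensor $f\in\mathcal{R}_{\mathrm{T}}^{\otimes n}$, the $\mathcal{C}$-linear maps $\partial,\int$ are given as follows. $\partial(f_0\otimes c\otimes f)=(\partial f_0)\otimes c\otimes f$ if $n=0$ and $(\partial f_0)\otimes c\otimes f+(f_0f_1)\otimes c\otimes f_2^n$ if $n>0$. For $n=0$: $\int(f_0\otimes c\otimes f)=(\mathrm{Q}f_0)\otimes c\otimes f+1\otimes c\otimes((f_0-\partial\mathrm{Q}f_0)\otimes f)$. For $n>0$, recursively: $\int(f_0\otimes c\otimes f)=(\mathrm{Q}f_0)\otimes c\otimes f-1\otimes(c_1\cdot\varepsilon((\mathrm{Q}f_0)\otimes f))\otimes c_2\otimes1_{\mathcal{T}}-\int(((\mathrm{Q}f_0)f_1)\otimes c\otimes f_2^n)+1\otimes c\otimes((f_0-\partial\mathrm{Q}f_0)\otimes f)$. With these, $\mathrm{IDR}_{\mathrm{Q}}(\mathcal{R})$ is a commutative integro-differential ring. *)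

theory Defs
  imports "HOL-Algebra.Module" "HOL-Algebra.QuotRing" "HOL-Library.Multiset"
begin

section \<open>Differential, integro-differential and quasi-integro-differential rings\<close>

definition constants :: "('a, 'm) ring_scheme \<Rightarrow> ('a \<Rightarrow> 'a) \<Rightarrow> 'a set" where
  "constants R der = {x \<in> carrier R. der x = \<zero>\<^bsub>R\<^esub>}"

locale diff_cring = cring R for R :: "('a, 'm) ring_scheme" (structure) +
  fixes der :: "'a \<Rightarrow> 'a"
  assumes der_closed: "x \<in> carrier R \<Longrightarrow> der x \<in> carrier R"
    and der_add: "\<lbrakk>x \<in> carrier R; y \<in> carrier R\<rbrakk> \<Longrightarrow> der (x \<oplus> y) = der x \<oplus> der y"
    and der_mult: "\<lbrakk>x \<in> carrier R; y \<in> carrier R\<rbrakk> \<Longrightarrow>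
      der (x \<otimes> y) = der x \<otimes> y \<oplus> x \<otimes> der y"

locale integro_diff_cring = diff_cring R der
    for R :: "('a, 'm) ring_scheme" (structure) and der :: "'a \<Rightarrow> 'a" +
  fixes itg :: "'a \<Rightarrow> 'a"
  assumes itg_closed: "x \<in> carrier R \<Longrightarrow> itg x \<in> carrier R"
    and itg_add: "\<lbrakk>x \<in> carrier R; y \<in> carrier R\<rbrakk> \<Longrightarrow> itg (x \<oplus> y) = itg x \<oplus> itg y"
    and itg_const: "\<lbrakk>c \<in> constants R der; x \<in> carrier R\<rbrakk> \<Longrightarrow> itg (c \<otimes> x) = c \<otimes> itg x"
    and der_itg: "x \<in> carrier R \<Longrightarrow> der (itg x) = x"

locale quasi_integro_diff_cring = diff_cring R der
    for R :: "('a, 'm) ring_scheme" (structure) and der :: "'a \<Rightarrow> 'a" +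
  fixes Q :: "'a \<Rightarrow> 'a"
  assumes Q_closed: "x \<in> carrier R \<Longrightarrow> Q x \<in> carrier R"
    and Q_add: "\<lbrakk>x \<in> carrier R; y \<in> carrier R\<rbrakk> \<Longrightarrow> Q (x \<oplus> y) = Q x \<oplus> Q y"
    and Q_const: "\<lbrakk>c \<in> constants R der; x \<in> carrier R\<rbrakk> \<Longrightarrow> Q (c \<otimes> x) = c \<otimes> Q x"
    and der_Q_der: "x \<in> carrier R \<Longrightarrow> der (Q (der x)) = der x"
    and Q_der_Q: "x \<in> carrier R \<Longrightarrow> Q (der (Q x)) = Q x"

definition diff_ring_hom ::
    "('a, 'm) ring_scheme \<Rightarrow> ('a \<Rightarrow> 'a) \<Rightarrow> ('b, 'n) ring_scheme \<Rightarrow> ('b \<Rightarrow> 'b) \<Rightarrow> ('a \<Rightarrow> 'b) set" where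
  "diff_ring_hom R derR S derS =
    {h \<in> ring_hom R S. \<forall>x\<in>carrier R. h (derR x) = derS (h x)}"

definition integro_diff_ring_hom ::
    "('a, 'm) ring_scheme \<Rightarrow> ('a \<Rightarrow> 'a) \<Rightarrow> ('a \<Rightarrow> 'a) \<Rightarrow>
     ('b, 'n) ring_scheme \<Rightarrow> ('b \<Rightarrow> 'b) \<Rightarrow> ('b \<Rightarrow> 'b) \<Rightarrow> ('a \<Rightarrow> 'b) set" where
  "integro_diff_ring_hom R derR itgR S derS itgS =
    {h \<in> diff_ring_hom R derR S derS. \<forall>x\<in>carrier R. h (itgR x) = itgS (h x)}"


section \<open>Modules and algebras by generators and relations\<close>

text \<open>
  Modules and algebras over a commutative ring \<open>C\<close> are records of type \<^type>\<open>module\<close>; for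
  a mere module the fields \<open>mult\<close> and \<open>one\<close> carry no information.
\<close>

definition linear_maps ::
    "('c, 'k) ring_scheme \<Rightarrow> ('c, 'x, 'l) module_scheme \<Rightarrow> ('c, 'y, 'm) module_scheme \<Rightarrow>
     ('x \<Rightarrow> 'y) set" where
  "linear_maps C M N = {h \<in> carrier M \<rightarrow> carrier N.
     (\<forall>x\<in>carrier M. \<forall>y\<in>carrier M. h (x \<oplus>\<^bsub>M\<^esub> y) = h x \<oplus>\<^bsub>N\<^esub> h y) \<and>
     (\<forall>c\<in>carrier C. \<forall>x\<in>carrier M. h (c \<odot>\<^bsub>M\<^esub> x) = c \<odot>\<^bsub>N\<^esub> h x)}"

definition bilinear_maps ::
    "('c, 'k) ring_scheme \<Rightarrow> ('c, 'x, 'l) module_scheme \<Rightarrow> ('c, 'y, 'm) module_scheme \<Rightarrow>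
     ('c, 'z, 'n) module_scheme \<Rightarrow> ('x \<Rightarrow> 'y \<Rightarrow> 'z) set" where
  "bilinear_maps C M N P = {B.
     (\<forall>x\<in>carrier M. B x \<in> linear_maps C N P) \<and>
     (\<forall>y\<in>carrier N. (\<lambda>x. B x y) \<in> linear_maps C M P)}"

definition free_module :: "('c, 'k) ring_scheme \<Rightarrow> 'x set \<Rightarrow> ('c, 'x \<Rightarrow> 'c) module" where
  "free_module C G =
    \<lparr>carrier = {u. range u \<subseteq> carrier C \<and> {x. u x \<noteq> \<zero>\<^bsub>C\<^esub>} \<subseteq> G \<and> finite {x. u x \<noteq> \<zero>\<^bsub>C\<^esub>}},
     monoid.mult = (\<lambda>_ _. undefined), one = undefined,
     zero = (\<lambda>_. \<zero>\<^bsub>C\<^esub>), add = (\<lambda>u v x. u x \<oplus>\<^bsub>C\<^esub> v x),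
     smult = (\<lambda>c u x. c \<otimes>\<^bsub>C\<^esub> u x)\<rparr>"

definition basis_vec :: "('c, 'k) ring_scheme \<Rightarrow> 'x \<Rightarrow> ('x \<Rightarrow> 'c)" where
  "basis_vec C x = (\<lambda>y. if y = x then \<one>\<^bsub>C\<^esub> else \<zero>\<^bsub>C\<^esub>)"

definition span :: "('c, 'k) ring_scheme \<Rightarrow> ('c, 'x, 'l) module_scheme \<Rightarrow> 'x set \<Rightarrow> 'x set" where
  "span C M A = \<Inter>{N. submodule N C M \<and> A \<subseteq> N}"

text \<open>
  The quotient of a module by a submodule, or of an algebra by an ideal: on the ring part this
  is \<^const>\<open>FactRing\<close>.
\<close>

definition quot_module :: "('c, 'x, 'l) module_scheme \<Rightarrow> 'x set \<Rightarrow> ('c, 'x set) module" where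
  "quot_module M N =
    \<lparr>carrier = a_rcosets\<^bsub>M\<^esub> N, monoid.mult = rcoset_mult M N, one = N +>\<^bsub>M\<^esub> \<one>\<^bsub>M\<^esub>,
     zero = N, add = set_add M, smult = (\<lambda>c A. \<Union>a\<in>A. N +>\<^bsub>M\<^esub> (c \<odot>\<^bsub>M\<^esub> a))\<rparr>"

definition presented_module ::
    "('c, 'k) ring_scheme \<Rightarrow> 'x set \<Rightarrow> ('x \<Rightarrow> 'c) set \<Rightarrow> ('c, ('x \<Rightarrow> 'c) set) module" where
  "presented_module C G A = quot_module (free_module C G) (span C (free_module C G) A)"

definition presented_gen ::
    "('c, 'k) ring_scheme \<Rightarrow> 'x set \<Rightarrow> ('x \<Rightarrow> 'c) set \<Rightarrow> 'x \<Rightarrow> ('x \<Rightarrow> 'c) set" where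
  "presented_gen C G A x = span C (free_module C G) A +>\<^bsub>free_module C G\<^esub> basis_vec C x"

text \<open>
  Throughout, a product or a linear map that is prescribed on generators is selected by
  \<open>SOME\<close>.  The generators span the module, so that all admissible choices agree on the carrier.
\<close>

subsection \<open>Tensor products\<close>

definition tensor_rels ::
    "('c, 'k) ring_scheme \<Rightarrow> ('c, 'x, 'l) module_scheme \<Rightarrow> ('c, 'y, 'm) module_scheme \<Rightarrow>
     ('x \<times> 'y \<Rightarrow> 'c) set" where
  "tensor_rels C M N = (let F = free_module C (carrier M \<times> carrier N); e = basis_vec C in
     {e (x \<oplus>\<^bsub>M\<^esub> x', y) \<ominus>\<^bsub>F\<^esub> (e (x, y) \<oplus>\<^bsub>F\<^esub> e (x', y)) | x x' y.
        x \<in> carrier M \<and> x' \<in> carrier M \<and> y \<in> carrier N} \<union>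
     {e (x, y \<oplus>\<^bsub>N\<^esub> y') \<ominus>\<^bsub>F\<^esub> (e (x, y) \<oplus>\<^bsub>F\<^esub> e (x, y')) | x y y'.
        x \<in> carrier M \<and> y \<in> carrier N \<and> y' \<in> carrier N} \<union>
     {e (c \<odot>\<^bsub>M\<^esub> x, y) \<ominus>\<^bsub>F\<^esub> c \<odot>\<^bsub>F\<^esub> e (x, y) | c x y.
        c \<in> carrier C \<and> x \<in> carrier M \<and> y \<in> carrier N} \<union>
     {e (x, c \<odot>\<^bsub>N\<^esub> y) \<ominus>\<^bsub>F\<^esub> c \<odot>\<^bsub>F\<^esub> e (x, y) | c x y.
        c \<in> carrier C \<and> x \<in> carrier M \<and> y \<in> carrier N})"

definition tensor_module ::
    "('c, 'k) ring_scheme \<Rightarrow> ('c, 'x, 'l) module_scheme \<Rightarrow> ('c, 'y, 'm) module_scheme \<Rightarrow>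
     ('c, ('x \<times> 'y \<Rightarrow> 'c) set) module" where
  "tensor_module C M N = presented_module C (carrier M \<times> carrier N) (tensor_rels C M N)"

definition tensor ::
    "('c, 'k) ring_scheme \<Rightarrow> ('c, 'x, 'l) module_scheme \<Rightarrow> ('c, 'y, 'm) module_scheme \<Rightarrow>
     'x \<Rightarrow> 'y \<Rightarrow> ('x \<times> 'y \<Rightarrow> 'c) set" where
  "tensor C M N x y = presented_gen C (carrier M \<times> carrier N) (tensor_rels C M N) (x, y)"

definition tensor_algebra_product ::
    "('c, 'k) ring_scheme \<Rightarrow> ('c, 'x, 'l) module_scheme \<Rightarrow> ('c, 'y, 'm) module_scheme \<Rightarrow>
     ('c, ('x \<times> 'y \<Rightarrow> 'c) set) module" where
  "tensor_algebra_product C A B = (let T = tensor_module C A B; t = tensor C A B in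
     T\<lparr>monoid.mult := SOME b. b \<in> bilinear_maps C T T T \<and>
         (\<forall>x\<in>carrier A. \<forall>x'\<in>carrier A. \<forall>y\<in>carrier B. \<forall>y'\<in>carrier B.
            b (t x y) (t x' y') = t (x \<otimes>\<^bsub>A\<^esub> x') (y \<otimes>\<^bsub>B\<^esub> y')),
       one := t \<one>\<^bsub>A\<^esub> \<one>\<^bsub>B\<^esub>\<rparr>)"


subsection \<open>The direct sum of all tensor powers\<close>

text \<open>
  The list \<open>[x\<^sub>1, \<dots>, x\<^sub>n]\<close> stands for \<open>x\<^sub>1 \<otimes> \<dots> \<otimes> x\<^sub>n\<close>.  As each relation only involves lists
  of one length, the module is the direct sum over \<open>n\<close> of the modules presented by the lists of
  length \<open>n\<close>, that is, of the \<open>n\<close>-th tensor powers; the power for \<open>n = 0\<close> is \<open>C\<close>.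
\<close>

definition words_rels ::
    "('c, 'k) ring_scheme \<Rightarrow> ('c, 'x, 'l) module_scheme \<Rightarrow> ('x list \<Rightarrow> 'c) set" where
  "words_rels C M = (let F = free_module C (lists (carrier M)); e = basis_vec C in
     {e (xs @ (x \<oplus>\<^bsub>M\<^esub> y) # ys) \<ominus>\<^bsub>F\<^esub> (e (xs @ x # ys) \<oplus>\<^bsub>F\<^esub> e (xs @ y # ys)) | xs x y ys.
        xs \<in> lists (carrier M) \<and> x \<in> carrier M \<and> y \<in> carrier M \<and> ys \<in> lists (carrier M)} \<union>
     {e (xs @ (c \<odot>\<^bsub>M\<^esub> x) # ys) \<ominus>\<^bsub>F\<^esub> c \<odot>\<^bsub>F\<^esub> e (xs @ x # ys) | c xs x ys.
        c \<in> carrier C \<and> xs \<in> lists (carrier M) \<and> x \<in> carrier M \<and> ys \<in> lists (carrier M)})"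

definition word ::
    "('c, 'k) ring_scheme \<Rightarrow> ('c, 'x, 'l) module_scheme \<Rightarrow> 'x list \<Rightarrow> ('x list \<Rightarrow> 'c) set" where
  "word C M xs = presented_gen C (lists (carrier M)) (words_rels C M) xs"

definition words_module ::
    "('c, 'k) ring_scheme \<Rightarrow> ('c, 'x, 'l) module_scheme \<Rightarrow> ('c, ('x list \<Rightarrow> 'c) set) module" where
  "words_module C M = presented_module C (lists (carrier M)) (words_rels C M)"

text \<open>The product of \<open>words_algebra\<close> is the tensor (concatenation) product.\<close>

definition words_algebra ::
    "('c, 'k) ring_scheme \<Rightarrow> ('c, 'x, 'l) module_scheme \<Rightarrow> ('c, ('x list \<Rightarrow> 'c) set) module" where
  "words_algebra C M = (let T = words_module C M in
     T\<lparr>monoid.mult := SOME b. b \<in> bilinear_maps C T T T \<and>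
         (\<forall>xs\<in>lists (carrier M). \<forall>ys\<in>lists (carrier M).
            b (word C M xs) (word C M ys) = word C M (xs @ ys)),
       one := word C M []\<rparr>)"

definition shuffle_algebra ::
    "('c, 'k) ring_scheme \<Rightarrow> ('c, 'x, 'l) module_scheme \<Rightarrow> ('c, ('x list \<Rightarrow> 'c) set) module" where
  "shuffle_algebra C M = (let T = words_algebra C M; w = word C M in
     T\<lparr>monoid.mult := SOME b. b \<in> bilinear_maps C T T T \<and>
         (\<forall>xs\<in>lists (carrier M).
            b (w []) (w xs) = w [] \<otimes>\<^bsub>T\<^esub> w xs \<and> b (w xs) (w []) = w xs \<otimes>\<^bsub>T\<^esub> w []) \<and>
         (\<forall>x\<in>carrier M. \<forall>xs\<in>lists (carrier M). \<forall>y\<in>carrier M. \<forall>ys\<in>lists (carrier M).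
            b (w (x # xs)) (w (y # ys)) =
              w [x] \<otimes>\<^bsub>T\<^esub> b (w xs) (w (y # ys)) \<oplus>\<^bsub>T\<^esub> w [y] \<otimes>\<^bsub>T\<^esub> b (w (x # xs)) (w ys))\<rparr>)"


subsection \<open>Symmetric square and symmetric algebra\<close>

definition sym_square_rels ::
    "('c, 'k) ring_scheme \<Rightarrow> ('c, 'x, 'l) module_scheme \<Rightarrow> ('x \<times> 'x \<Rightarrow> 'c) set set" where
  "sym_square_rels C M =
     {tensor C M M x y \<ominus>\<^bsub>tensor_module C M M\<^esub> tensor C M M y x | x y.
        x \<in> carrier M \<and> y \<in> carrier M}"

definition sym_square ::
    "('c, 'k) ring_scheme \<Rightarrow> ('c, 'x, 'l) module_scheme \<Rightarrow>
     ('c, ('x \<times> 'x \<Rightarrow> 'c) set set) module" where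
  "sym_square C M = (let T = tensor_module C M M in
     quot_module T (span C T (sym_square_rels C M)))"

definition sym_prod ::
    "('c, 'k) ring_scheme \<Rightarrow> ('c, 'x, 'l) module_scheme \<Rightarrow> 'x \<Rightarrow> 'x \<Rightarrow>
     ('x \<times> 'x \<Rightarrow> 'c) set set" where
  "sym_prod C M x y = (let T = tensor_module C M M in
     span C T (sym_square_rels C M) +>\<^bsub>T\<^esub> tensor C M M x y)"

text \<open>
  The multiset \<open>{#x\<^sub>1, \<dots>, x\<^sub>n#}\<close> stands for the monomial \<open>x\<^sub>1 \<cdots> x\<^sub>n\<close>, so the free module is the
  polynomial ring with one variable for each element of \<open>M\<close>, and the relations span the ideal
  which makes the map from \<open>M\<close> to the variables linear.
\<close>

definition monomials :: "('c, 'x, 'l) module_scheme \<Rightarrow> 'x multiset set" where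
  "monomials M = {A. set_mset A \<subseteq> carrier M}"

definition sym_rels ::
    "('c, 'k) ring_scheme \<Rightarrow> ('c, 'x, 'l) module_scheme \<Rightarrow> ('x multiset \<Rightarrow> 'c) set" where
  "sym_rels C M = (let F = free_module C (monomials M); e = basis_vec C in
     {e (add_mset (x \<oplus>\<^bsub>M\<^esub> y) A) \<ominus>\<^bsub>F\<^esub> (e (add_mset x A) \<oplus>\<^bsub>F\<^esub> e (add_mset y A)) | x y A.
        x \<in> carrier M \<and> y \<in> carrier M \<and> A \<in> monomials M} \<union>
     {e (add_mset (c \<odot>\<^bsub>M\<^esub> x) A) \<ominus>\<^bsub>F\<^esub> c \<odot>\<^bsub>F\<^esub> e (add_mset x A) | c x A.
        c \<in> carrier C \<and> x \<in> carrier M \<and> A \<in> monomials M})"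

definition sym_monomial ::
    "('c, 'k) ring_scheme \<Rightarrow> ('c, 'x, 'l) module_scheme \<Rightarrow> 'x multiset \<Rightarrow>
     ('x multiset \<Rightarrow> 'c) set" where
  "sym_monomial C M A = presented_gen C (monomials M) (sym_rels C M) A"

definition sym_algebra ::
    "('c, 'k) ring_scheme \<Rightarrow> ('c, 'x, 'l) module_scheme \<Rightarrow>
     ('c, ('x multiset \<Rightarrow> 'c) set) module" where
  "sym_algebra C M = (let P = presented_module C (monomials M) (sym_rels C M) in
     P\<lparr>monoid.mult := SOME b. b \<in> bilinear_maps C P P P \<and>
         (\<forall>A\<in>monomials M. \<forall>B\<in>monomials M.
            b (sym_monomial C M A) (sym_monomial C M B) = sym_monomial C M (A + B)),
       one := sym_monomial C M {#}\<rparr>)"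

text \<open>
  The canonical map \<open>M \<rightarrow> Sym(M)\<close>; it plays the role of \<open>\<epsilon>\<close>, which only renames the elements
  of \<open>M\<close> on their way into the symmetric algebra.
\<close>

definition sym_gen ::
    "('c, 'k) ring_scheme \<Rightarrow> ('c, 'x, 'l) module_scheme \<Rightarrow> 'x \<Rightarrow> ('x multiset \<Rightarrow> 'c) set" where
  "sym_gen C M x = sym_monomial C M {#x#}"


section \<open>The free integro-differential ring\<close>

context quasi_integro_diff_cring
begin

definition C :: "('a, 'm) ring_scheme" where
  "C = R\<lparr>carrier := constants R der\<rparr>"

definition R_alg :: "('a, 'a) module" where
  "R_alg = \<lparr>carrier = carrier R, monoid.mult = monoid.mult R, one = \<one>,
     zero = \<zero>, add = add R, smult = monoid.mult R\<rparr>"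

definition RJ :: "('a, 'a) module" where
  "RJ = R_alg\<lparr>carrier := Q ` carrier R\<rparr>"

definition RT :: "('a, 'a) module" where
  "RT = R_alg\<lparr>carrier := {x \<in> carrier R. Q x = \<zero>}\<rparr>"

abbreviation RT_lists :: "'a list set" where
  "RT_lists \<equiv> lists (carrier RT)"

definition T :: "('a, ('a list \<Rightarrow> 'a) set) module" where
  "T = shuffle_algebra C RT"

abbreviation w :: "'a list \<Rightarrow> ('a list \<Rightarrow> 'a) set" where
  "w \<equiv> word C RT"

definition T_pos :: "('a, ('a list \<Rightarrow> 'a) set) module" where
  "T_pos = T\<lparr>carrier := span C T (w ` (RT_lists - {[]}))\<rparr>"

definition M1 :: "('a, ('a \<times> ('a list \<Rightarrow> 'a) set \<Rightarrow> 'a) set) module" where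
  "M1 = tensor_module C RJ T_pos"

definition M2 ::
    "('a, (('a list \<Rightarrow> 'a) set \<times> ('a list \<Rightarrow> 'a) set \<Rightarrow> 'a) set set) module" where
  "M2 = sym_square C T_pos"

definition C1 :: "('a, (('a \<times> ('a list \<Rightarrow> 'a) set \<Rightarrow> 'a) set multiset \<Rightarrow> 'a) set) module" where
  "C1 = sym_algebra C M1"

definition eps1 ::
    "'a \<Rightarrow> ('a list \<Rightarrow> 'a) set \<Rightarrow>
     (('a \<times> ('a list \<Rightarrow> 'a) set \<Rightarrow> 'a) set multiset \<Rightarrow> 'a) set" where
  "eps1 x t = sym_gen C M1 (tensor C RJ T_pos x t)"

definition Sym2 ::
    "('a, ((('a list \<Rightarrow> 'a) set \<times> ('a list \<Rightarrow> 'a) set \<Rightarrow> 'a) set set multiset \<Rightarrow> 'a) set) module"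
  where "Sym2 = sym_algebra C M2"

definition eps_sym2 ::
    "('a list \<Rightarrow> 'a) set \<Rightarrow> ('a list \<Rightarrow> 'a) set \<Rightarrow>
     ((('a list \<Rightarrow> 'a) set \<times> ('a list \<Rightarrow> 'a) set \<Rightarrow> 'a) set set multiset \<Rightarrow> 'a) set" where
  "eps_sym2 s t = sym_gen C M2 (sym_prod C T_pos s t)"

text \<open>
  \<open>take i f\<close> is \<open>f\<^sub>1 \<otimes> \<dots> \<otimes> f\<^sub>i\<close> and \<open>drop i f\<close> is \<open>f\<^sub>i\<^sub>+\<^sub>1 \<otimes> \<dots> \<otimes> f\<^sub>n\<close>.  The lower bound \<open>1 - j\<close> is
  truncated subtraction, i.e. \<open>max 0 (1 - j)\<close>.
\<close>

definition J2_gen ::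
    "'a list \<Rightarrow> 'a list \<Rightarrow> 'a list \<Rightarrow>
     ((('a list \<Rightarrow> 'a) set \<times> ('a list \<Rightarrow> 'a) set \<Rightarrow> 'a) set set multiset \<Rightarrow> 'a) set" where
  "J2_gen f g h =
     (eps_sym2 (w f \<otimes>\<^bsub>T\<^esub> w g) (w h) \<ominus>\<^bsub>Sym2\<^esub> eps_sym2 (w f) (w g \<otimes>\<^bsub>T\<^esub> w h)) \<oplus>\<^bsub>Sym2\<^esub>
     (\<Oplus>\<^bsub>Sym2\<^esub>j\<in>{0..<length g}.
        (\<Oplus>\<^bsub>Sym2\<^esub>i\<in>{1 - j..<length f}.
           eps_sym2 (w (drop i f)) (w (drop j g)) \<otimes>\<^bsub>Sym2\<^esub>
           eps_sym2 (w (take i f) \<otimes>\<^bsub>T\<^esub> w (take j g)) (w h)) \<ominus>\<^bsub>Sym2\<^esub>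
        (\<Oplus>\<^bsub>Sym2\<^esub>k\<in>{1 - j..<length h}.
           eps_sym2 (w f) (w (take j g) \<otimes>\<^bsub>T\<^esub> w (take k h)) \<otimes>\<^bsub>Sym2\<^esub>
           eps_sym2 (w (drop j g)) (w (drop k h))))"

definition J2 ::
    "((('a list \<Rightarrow> 'a) set \<times> ('a list \<Rightarrow> 'a) set \<Rightarrow> 'a) set set multiset \<Rightarrow> 'a) set set" where
  "J2 = genideal Sym2 {J2_gen f g h | f g h.
     f \<in> RT_lists - {[]} \<and> g \<in> RT_lists - {[]} \<and> h \<in> RT_lists - {[]}}"

definition C2 ::
    "('a, ((('a list \<Rightarrow> 'a) set \<times> ('a list \<Rightarrow> 'a) set \<Rightarrow> 'a) set set multiset \<Rightarrow> 'a) set set) module"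
  where "C2 = quot_module Sym2 J2"

definition eps2 ::
    "('a list \<Rightarrow> 'a) set \<Rightarrow> ('a list \<Rightarrow> 'a) set \<Rightarrow>
     ((('a list \<Rightarrow> 'a) set \<times> ('a list \<Rightarrow> 'a) set \<Rightarrow> 'a) set set multiset \<Rightarrow> 'a) set set" where
  "eps2 s t = J2 +>\<^bsub>Sym2\<^esub> eps_sym2 s t"

definition C2T where
  "C2T = (let P = tensor_module C C2 T; t = tensor C C2 T in
     P\<lparr>monoid.mult := SOME b. b \<in> bilinear_maps C P P P \<and>
         (\<forall>c\<in>carrier C2. \<forall>d\<in>carrier C2. \<forall>f\<in>RT_lists. \<forall>g\<in>RT_lists.
            b (t c (w f)) (t d (w g)) =
              t (c \<otimes>\<^bsub>C2\<^esub> d) (w f \<otimes>\<^bsub>T\<^esub> w g) \<oplus>\<^bsub>P\<^esub>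
              (\<Oplus>\<^bsub>P\<^esub>i\<in>{0..<length f}. \<Oplus>\<^bsub>P\<^esub>j\<in>{0..<length g}.
                 t (c \<otimes>\<^bsub>C2\<^esub> d \<otimes>\<^bsub>C2\<^esub> eps2 (w (drop i f)) (w (drop j g)))
                   (w (take i f) \<otimes>\<^bsub>T\<^esub> w (take j g)))),
       one := t \<one>\<^bsub>C2\<^esub> (w [])\<rparr>)"

definition IDR where
  "IDR = tensor_algebra_product C R_alg (tensor_algebra_product C C1 C2T)"

definition pure where
  "pure x c1 c2 f =
     tensor C R_alg (tensor_algebra_product C C1 C2T) x
       (tensor C C1 C2T c1 (tensor C C2 T c2 (w f)))"

definition iota where
  "iota x = pure x \<one>\<^bsub>C1\<^esub> \<one>\<^bsub>C2\<^esub> []"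

definition IDR_der where
  "IDR_der = (SOME D. D \<in> linear_maps C IDR IDR \<and>
     (\<forall>x\<in>carrier R. \<forall>c1\<in>carrier C1. \<forall>c2\<in>carrier C2.
        D (pure x c1 c2 []) = pure (der x) c1 c2 [] \<and>
        (\<forall>y\<in>carrier RT. \<forall>f\<in>RT_lists.
           D (pure x c1 c2 (y # f)) = pure (der x) c1 c2 (y # f) \<oplus>\<^bsub>IDR\<^esub> pure (x \<otimes> y) c1 c2 f)))"

definition IDR_itg where
  "IDR_itg = (SOME I. I \<in> linear_maps C IDR IDR \<and>
     (\<forall>x\<in>carrier R. \<forall>c1\<in>carrier C1. \<forall>c2\<in>carrier C2.
        I (pure x c1 c2 []) =
          pure (Q x) c1 c2 [] \<oplus>\<^bsub>IDR\<^esub> pure \<one> c1 c2 [x \<ominus> der (Q x)] \<and>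
        (\<forall>y\<in>carrier RT. \<forall>f\<in>RT_lists.
           I (pure x c1 c2 (y # f)) =
             pure (Q x) c1 c2 (y # f)
             \<ominus>\<^bsub>IDR\<^esub> pure \<one> (c1 \<otimes>\<^bsub>C1\<^esub> eps1 (Q x) (w (y # f))) c2 []
             \<ominus>\<^bsub>IDR\<^esub> I (pure (Q x \<otimes> y) c1 c2 f)
             \<oplus>\<^bsub>IDR\<^esub> pure \<one> c1 c2 ((x \<ominus> der (Q x)) # y # f))))"

end

end

theory Submission
  imports Defs
begin

text \<open>
  A map out of the free integro-differential ring is determined by what the integral forces.
  In an integro-differential ring write \<open>ev s = s - \<integral>\<partial>s\<close>, the projection onto the constants along
  the image of the integral, and \<open>J f = \<integral>\<phi>(f\<^sub>1)\<integral>\<phi>(f\<^sub>2)\<dots>\<close> for the nested integral of a word \<open>f\<close>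
  with letters in \<open>ker Q\<close>.  The formula for the integral in the free ring shows that a word must
  be sent to \<open>J f\<close>, integration by parts shows that \<open>\<epsilon>(q \<otimes> f)\<close> must be sent to
  \<open>ev (\<phi>(q) \<cdot> J f)\<close>, and the product of two words shows that \<open>\<epsilon>(f \<odot> g)\<close> must be sent to
  \<open>ev (J f \<cdot> J g)\<close>.  Together with \<open>\<iota>\<close> these elements generate the ring; this is uniqueness
  (\<open>IDR_hom_unique\<close>).

  Conversely, these values define a homomorphism because nested integrals satisfy the product
  formula of the free ring (\<open>nested_itg_product\<close>):
  \<open>J f \<cdot> J g = J (f \<squnion> g) + \<Sum>\<^sub>i\<^sub>j ev (J f\<^sub>i\<^sub>+\<^sub>1\<dots>f\<^sub>n \<cdot> J g\<^sub>j\<^sub>+\<^sub>1\<dots>g\<^sub>m) \<cdot> J (f\<^sub>1\<dots>f\<^sub>i \<squnion> g\<^sub>1\<dots>g\<^sub>j)\<close>,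
  where \<open>\<squnion>\<close> is the shuffle product.
  It follows by induction from \<open>s = ev s + \<integral>\<partial>s\<close> and the Leibniz rule.  Evaluating
  \<open>(J f \<cdot> J g) \<cdot> J h = J f \<cdot> (J g \<cdot> J h)\<close> by means of it gives exactly the relations that define
  \<open>C\<^sub>2\<close> (\<open>Sym2_hom_J2_gen\<close>).  The assumption on \<open>\<phi>\<close> enters only when the integral is compared on
  both sides (\<open>itgS_phi\<close>): there \<open>\<phi>(Q x)\<close> has to be the integral of its derivative.

  The rest is multilinear algebra.  Every product and every linear map of the construction is
  prescribed on generators of a module that is given by generators and relations, so each of them
  has to be shown to exist.  The two principles for this are \<open>presented_module_lift\<close> for linear
  maps and \<open>bilinear_extension\<close> for products, and equalities are checked on spanning sets.
\<close>

section \<open>Linear maps, spans and quotients\<close>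

lemma module_abelian_group: "module C M \<Longrightarrow> abelian_group M"
  by (simp add: module_def)

lemma linear_mapsI:
  assumes "\<And>x. x \<in> carrier M \<Longrightarrow> h x \<in> carrier N"
    and "\<And>x y. x \<in> carrier M \<Longrightarrow> y \<in> carrier M \<Longrightarrow> h (x \<oplus>\<^bsub>M\<^esub> y) = h x \<oplus>\<^bsub>N\<^esub> h y"
    and "\<And>c x. c \<in> carrier C \<Longrightarrow> x \<in> carrier M \<Longrightarrow> h (c \<odot>\<^bsub>M\<^esub> x) = c \<odot>\<^bsub>N\<^esub> h x"
  shows "h \<in> linear_maps C M N"
  using assms unfolding linear_maps_def by auto

lemma linear_maps_closed: "h \<in> linear_maps C M N \<Longrightarrow> x \<in> carrier M \<Longrightarrow> h x \<in> carrier N"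
  unfolding linear_maps_def by auto

lemma linear_maps_add:
  "h \<in> linear_maps C M N \<Longrightarrow> x \<in> carrier M \<Longrightarrow> y \<in> carrier M \<Longrightarrow> h (x \<oplus>\<^bsub>M\<^esub> y) = h x \<oplus>\<^bsub>N\<^esub> h y"
  unfolding linear_maps_def by auto

lemma linear_maps_smult:
  "h \<in> linear_maps C M N \<Longrightarrow> c \<in> carrier C \<Longrightarrow> x \<in> carrier M \<Longrightarrow> h (c \<odot>\<^bsub>M\<^esub> x) = c \<odot>\<^bsub>N\<^esub> h x"
  unfolding linear_maps_def by auto

lemma linear_maps_hom:
  assumes "h \<in> linear_maps C M N" "module C M" "module C N"
  shows "abelian_group_hom M N h"
proof -
  interpret M: module C M by fact
  interpret N: module C N by fact
  show ?thesis
    by (intro abelian_group_homI group_hom.intro group_hom_axioms.intro M.a_group N.a_group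
          M.abelian_group_axioms N.abelian_group_axioms)
       (auto simp: hom_def linear_maps_closed[OF assms(1)] linear_maps_add[OF assms(1)])
qed

lemma linear_maps_zero:
  "h \<in> linear_maps C M N \<Longrightarrow> module C M \<Longrightarrow> module C N \<Longrightarrow> h \<zero>\<^bsub>M\<^esub> = \<zero>\<^bsub>N\<^esub>"
  by (rule abelian_group_hom.hom_zero[OF linear_maps_hom])

lemma linear_maps_uminus:
  "h \<in> linear_maps C M N \<Longrightarrow> module C M \<Longrightarrow> module C N \<Longrightarrow> x \<in> carrier M \<Longrightarrow>
    h (\<ominus>\<^bsub>M\<^esub> x) = \<ominus>\<^bsub>N\<^esub> h x"
  by (rule abelian_group_hom.hom_a_inv[OF linear_maps_hom])

lemma linear_maps_minus:
  assumes "h \<in> linear_maps C M N" "module C M" "module C N" "x \<in> carrier M" "y \<in> carrier M"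
  shows "h (x \<ominus>\<^bsub>M\<^esub> y) = h x \<ominus>\<^bsub>N\<^esub> h y"
  using assms by (simp add: a_minus_def linear_maps_add linear_maps_uminus
      abelian_group.a_inv_closed module_abelian_group)

lemma linear_maps_finsum:
  assumes "h \<in> linear_maps C M N" "module C M" "module C N" "f \<in> I \<rightarrow> carrier M"
  shows "h (\<Oplus>\<^bsub>M\<^esub>i\<in>I. f i) = (\<Oplus>\<^bsub>N\<^esub>i\<in>I. h (f i))"
proof -
  interpret M: module C M by fact
  interpret N: module C N by fact
  show ?thesis
    using assms(4)
  proof (induction I rule: infinite_finite_induct)
    case (infinite I)
    then show ?case
      by (simp add: finsum_def finprod_def linear_maps_zero[OF assms(1-3)])
  next
    case empty
    then show ?case by (simp add: linear_maps_zero[OF assms(1-3)])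
  next
    case (insert i I)
    then have "(\<lambda>i. h (f i)) \<in> insert i I \<rightarrow> carrier N"
      by (auto intro: linear_maps_closed[OF assms(1)])
    with insert show ?case
      by (simp add: linear_maps_add[OF assms(1)] Pi_iff)
  qed
qed

lemma linear_maps_comp:
  "g \<in> linear_maps C N P \<Longrightarrow> h \<in> linear_maps C M N \<Longrightarrow> (\<lambda>x. g (h x)) \<in> linear_maps C M P"
  unfolding linear_maps_def by (auto simp: Pi_iff)

lemma linear_maps_cong:
  assumes "h \<in> linear_maps C M N" "module C M" "\<And>x. x \<in> carrier M \<Longrightarrow> h' x = h x"
  shows "h' \<in> linear_maps C M N"
proof -
  interpret M: module C M by fact
  show ?thesis using assms(1,3) unfolding linear_maps_def by (auto simp: Pi_iff)
qed

lemma linear_maps_id: "(\<lambda>x. x) \<in> linear_maps C M M"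
  unfolding linear_maps_def by auto

lemma linear_maps_const_zero: "module C N \<Longrightarrow> (\<lambda>x. \<zero>\<^bsub>N\<^esub>) \<in> linear_maps C M N"
  by (rule linear_mapsI)
     (auto simp: module.smult_r_null abelian_groupE abelian_monoid.zero_closed module_def abelian_group_def
        abelian_monoid.r_zero)

lemma linear_maps_sum:
  assumes "h \<in> linear_maps C M N" "k \<in> linear_maps C M N" "module C N"
  shows "(\<lambda>x. h x \<oplus>\<^bsub>N\<^esub> k x) \<in> linear_maps C M N"
proof -
  interpret N: module C N by fact
  show ?thesis
    using assms(1,2)
    by (intro linear_mapsI)
       (auto simp: linear_maps_closed linear_maps_add linear_maps_smult N.smult_r_distr N.M.a_ac)
qed

lemma linear_maps_scale:
  assumes "h \<in> linear_maps C M N" "c \<in> carrier C" "module C N"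
  shows "(\<lambda>x. c \<odot>\<^bsub>N\<^esub> h x) \<in> linear_maps C M N"
proof -
  interpret N: module C N by fact
  show ?thesis
    using assms(1,2)
    by (intro linear_mapsI)
       (auto simp: linear_maps_closed linear_maps_add linear_maps_smult N.smult_r_distr
          N.smult_assoc1[symmetric] N.R.m_comm)
qed

lemma linear_maps_neg:
  assumes "h \<in> linear_maps C M N" "module C N"
  shows "(\<lambda>x. \<ominus>\<^bsub>N\<^esub> h x) \<in> linear_maps C M N"
proof -
  interpret N: module C N by fact
  show ?thesis
    using assms(1)
    by (intro linear_mapsI)
       (auto simp: linear_maps_closed linear_maps_add linear_maps_smult N.smult_r_minus N.M.minus_add)
qed

lemma linear_maps_diff:
  assumes "h \<in> linear_maps C M N" "k \<in> linear_maps C M N" "module C N"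
  shows "(\<lambda>x. h x \<ominus>\<^bsub>N\<^esub> k x) \<in> linear_maps C M N"
  unfolding a_minus_def using assms by (intro linear_maps_sum linear_maps_neg)

lemma linear_maps_finsum_map:
  assumes "\<And>i. i \<in> I \<Longrightarrow> h i \<in> linear_maps C M N" "module C M" "module C N"
  shows "(\<lambda>x. \<Oplus>\<^bsub>N\<^esub>i\<in>I. h i x) \<in> linear_maps C M N"
proof -
  interpret N: module C N by fact
  show ?thesis
    using assms(1)
  proof (induction I rule: infinite_finite_induct)
    case (infinite I)
    then show ?case
      by (simp add: finsum_def finprod_def linear_maps_const_zero assms(3))
  next
    case empty
    then show ?case by (simp add: linear_maps_const_zero assms(3))
  next
    case (insert i I)
    have "(\<Oplus>\<^bsub>N\<^esub>i\<in>insert i I. h i x) = h i x \<oplus>\<^bsub>N\<^esub> (\<Oplus>\<^bsub>N\<^esub>i\<in>I. h i x)"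
      if "x \<in> carrier M" for x
      using insert that by (intro N.finsum_insert) (auto intro: linear_maps_closed)
    moreover have "(\<lambda>x. h i x \<oplus>\<^bsub>N\<^esub> (\<Oplus>\<^bsub>N\<^esub>i\<in>I. h i x)) \<in> linear_maps C M N"
      using insert by (intro linear_maps_sum assms(3)) auto
    ultimately show ?case
      by (rule linear_maps_cong[OF _ assms(2), rotated]) auto
  qed
qed

lemma bilinear_maps_left: "B \<in> bilinear_maps C M N P \<Longrightarrow> y \<in> carrier N \<Longrightarrow> (\<lambda>x. B x y) \<in> linear_maps C M P"
  unfolding bilinear_maps_def by auto

lemma bilinear_maps_right: "B \<in> bilinear_maps C M N P \<Longrightarrow> x \<in> carrier M \<Longrightarrow> B x \<in> linear_maps C N P"
  unfolding bilinear_maps_def by auto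

lemma bilinear_maps_closed:
  "B \<in> bilinear_maps C M N P \<Longrightarrow> x \<in> carrier M \<Longrightarrow> y \<in> carrier N \<Longrightarrow> B x y \<in> carrier P"
  by (rule linear_maps_closed[OF bilinear_maps_right])

lemma bilinear_mapsI:
  assumes "\<And>x. x \<in> carrier M \<Longrightarrow> B x \<in> linear_maps C N P"
    and "\<And>y. y \<in> carrier N \<Longrightarrow> (\<lambda>x. B x y) \<in> linear_maps C M P"
  shows "B \<in> bilinear_maps C M N P"
  using assms unfolding bilinear_maps_def by auto

text \<open>
  Negatives need no separate condition, being the multiples by \<open>-1\<close>.
\<close>

lemma module_submoduleI:
  assumes "module C M" "H \<subseteq> carrier M" "\<zero>\<^bsub>M\<^esub> \<in> H"
    "\<And>a b. a \<in> H \<Longrightarrow> b \<in> H \<Longrightarrow> a \<oplus>\<^bsub>M\<^esub> b \<in> H"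
    "\<And>c x. c \<in> carrier C \<Longrightarrow> x \<in> H \<Longrightarrow> c \<odot>\<^bsub>M\<^esub> x \<in> H"
  shows "submodule H C M"
proof -
  interpret M: module C M by fact
  show ?thesis
  proof (rule M.submoduleI)
    fix a assume "a \<in> H"
    with assms have "(\<ominus>\<^bsub>C\<^esub> \<one>\<^bsub>C\<^esub>) \<odot>\<^bsub>M\<^esub> a \<in> H" "a \<in> carrier M" by auto
    then show "\<ominus>\<^bsub>M\<^esub> a \<in> H" by (simp add: M.smult_l_minus)
  qed (use assms in auto)
qed

lemma submoduleD:
  assumes "submodule H C M" "module C M"
  shows "H \<subseteq> carrier M" "\<zero>\<^bsub>M\<^esub> \<in> H"
    "\<And>a b. a \<in> H \<Longrightarrow> b \<in> H \<Longrightarrow> a \<oplus>\<^bsub>M\<^esub> b \<in> H"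
    "\<And>c x. c \<in> carrier C \<Longrightarrow> x \<in> H \<Longrightarrow> c \<odot>\<^bsub>M\<^esub> x \<in> H"
    "\<And>a b. a \<in> H \<Longrightarrow> b \<in> H \<Longrightarrow> a \<ominus>\<^bsub>M\<^esub> b \<in> H"
proof -
  interpret M: module C M by fact
  note E = M.submoduleE[OF assms(1)]
  show "H \<subseteq> carrier M" "\<And>a b. a \<in> H \<Longrightarrow> b \<in> H \<Longrightarrow> a \<oplus>\<^bsub>M\<^esub> b \<in> H"
    "\<And>c x. c \<in> carrier C \<Longrightarrow> x \<in> H \<Longrightarrow> c \<odot>\<^bsub>M\<^esub> x \<in> H"
    "\<And>a b. a \<in> H \<Longrightarrow> b \<in> H \<Longrightarrow> a \<ominus>\<^bsub>M\<^esub> b \<in> H"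
    using E by (auto simp: a_minus_def)
  show "\<zero>\<^bsub>M\<^esub> \<in> H"
    using subgroup.one_closed[OF submodule.axioms(1)[OF assms(1)]] by simp
qed

lemma submodule_finsum:
  assumes "submodule H C M" "module C M" "\<And>i. i \<in> I \<Longrightarrow> f i \<in> H"
  shows "(\<Oplus>\<^bsub>M\<^esub>i\<in>I. f i) \<in> H"
proof -
  interpret M: module C M by fact
  note D = submoduleD[OF assms(1,2)]
  show ?thesis using assms(3)
  proof (induction I rule: infinite_finite_induct)
    case (infinite I)
    then show ?case by (simp add: finsum_def finprod_def D(2))
  next
    case empty
    then show ?case by (simp add: D(2))
  next
    case (insert i I)
    then have "(\<Oplus>\<^bsub>M\<^esub>i\<in>insert i I. f i) = f i \<oplus>\<^bsub>M\<^esub> (\<Oplus>\<^bsub>M\<^esub>i\<in>I. f i)"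
      using D(1) by (intro M.finsum_insert) auto
    with insert show ?case by (auto intro: D(3))
  qed
qed

lemma submodule_vimage:
  assumes "h \<in> linear_maps C M N" "module C M" "module C N" "submodule H C N"
  shows "submodule {x \<in> carrier M. h x \<in> H} C M"
proof -
  interpret M: module C M by fact
  note D = submoduleD[OF assms(4,3)]
  show ?thesis
    using assms(1,2) by (intro module_submoduleI)
      (auto simp: linear_maps_add linear_maps_smult linear_maps_zero[OF assms(1-3)] D)
qed

lemma submodule_equalizer:
  assumes "h \<in> linear_maps C M N" "k \<in> linear_maps C M N" "module C M" "module C N"
  shows "submodule {x \<in> carrier M. h x = k x} C M"
proof -
  interpret M: module C M by fact
  show ?thesis
    using assms by (intro module_submoduleI)
      (auto simp: linear_maps_add linear_maps_smult linear_maps_zero)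
qed

subsection \<open>Spanning sets\<close>

lemma span_superset: "A \<subseteq> span C M A"
  unfolding span_def by auto

lemma span_least: "submodule N C M \<Longrightarrow> A \<subseteq> N \<Longrightarrow> span C M A \<subseteq> N"
  unfolding span_def by auto

lemma span_submodule:
  assumes "module C M" "A \<subseteq> carrier M"
  shows "submodule (span C M A) C M"
proof -
  interpret M: module C M by fact
  have sub: "span C M A \<subseteq> carrier M"
    by (rule span_least[OF M.carrier_is_submodule assms(2)])
  show ?thesis
    by (rule module_submoduleI[OF assms(1) sub])
       (auto simp: span_def intro: submoduleD[OF _ assms(1)])
qed

definition spans :: "('c, 'k) ring_scheme \<Rightarrow> ('c, 'x, 'l) module_scheme \<Rightarrow> 'x set \<Rightarrow> bool" where
  "spans C M A \<longleftrightarrow> A \<subseteq> carrier M \<and> carrier M \<subseteq> span C M A"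

lemma spans_subset: "spans C M A \<Longrightarrow> a \<in> A \<Longrightarrow> a \<in> carrier M"
  by (auto simp: spans_def)

lemma spans_carrier: "spans C M (carrier M)"
  unfolding spans_def by (simp add: span_superset)

lemma spans_submodule:
  assumes "spans C M A" "submodule N C M" "A \<subseteq> N" "x \<in> carrier M"
  shows "x \<in> N"
  using assms span_least[OF assms(2,3)] by (auto simp: spans_def)

text \<open>
  The preimage of \<open>H\<close> is a submodule that contains the spanning set.  Most closure arguments
  below are instances of this.
\<close>

lemma linear_maps_into_submodule:
  assumes "spans C M A" "h \<in> linear_maps C M N" "module C M" "module C N" "submodule H C N"
    "\<And>a. a \<in> A \<Longrightarrow> h a \<in> H" "x \<in> carrier M"
  shows "h x \<in> H"
proof -
  have "A \<subseteq> {x \<in> carrier M. h x \<in> H}"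
    using assms(6) spans_subset[OF assms(1)] by blast
  from spans_submodule[OF assms(1) submodule_vimage[OF assms(2-5)] this assms(7)]
  show ?thesis by simp
qed

lemma linear_maps_eq_on_spans:
  assumes "spans C M A" "module C M" "module C N" "h \<in> linear_maps C M N" "k \<in> linear_maps C M N"
    "\<And>a. a \<in> A \<Longrightarrow> h a = k a" "x \<in> carrier M"
  shows "h x = k x"
  using spans_submodule[OF assms(1) submodule_equalizer[OF assms(4,5,2,3)] _ assms(7)]
    assms(1,6) by (auto simp: spans_def)

lemma bilinear_maps_eq_on_spans:
  assumes "spans C M A" "spans C N B" "module C M" "module C N" "module C P"
    "h \<in> bilinear_maps C M N P" "k \<in> bilinear_maps C M N P"
    "\<And>a b. a \<in> A \<Longrightarrow> b \<in> B \<Longrightarrow> h a b = k a b" "x \<in> carrier M" "y \<in> carrier N"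
  shows "h x y = k x y"
proof -
  have "h a y = k a y" if "a \<in> A" for a
    by (rule linear_maps_eq_on_spans[OF assms(2,4,5) bilinear_maps_right[OF assms(6)]
          bilinear_maps_right[OF assms(7)]])
       (use assms(1,8,10) that in \<open>auto simp: spans_def\<close>)
  then show ?thesis
    by (rule linear_maps_eq_on_spans[OF assms(1,3,5) bilinear_maps_left[OF assms(6,10)]
          bilinear_maps_left[OF assms(7,10)] _ assms(9)])
qed

text \<open>
  For \<open>p\<close> in \<open>M\<close> the map \<open>y \<mapsto> H y p\<close> on the generators of \<open>N\<close> extends linearly: the \<open>p\<close> for
  which it does form a submodule, because linear combinations of extensions are extensions, and
  it contains the generators of \<open>M\<close>.  As extensions are unique, they depend linearly on \<open>p\<close>.
\<close>

lemma bilinear_extension: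
  assumes M: "module C M" "spans C M (g ` G)" and N: "module C N" "spans C N (g' ` G')"
    and P: "module C P"
    and right: "\<And>x. x \<in> G \<Longrightarrow> \<exists>k\<in>linear_maps C N P. \<forall>y\<in>G'. k (g' y) = v x y"
    and left: "\<And>y. y \<in> G' \<Longrightarrow> \<exists>h\<in>linear_maps C M P. \<forall>x\<in>G. h (g x) = v x y"
  shows "\<exists>B\<in>bilinear_maps C M N P. \<forall>x\<in>G. \<forall>y\<in>G'. B (g x) (g' y) = v x y"
proof -
  interpret M: module C M by fact
  interpret P: module C P by fact
  from left obtain H where H: "\<And>y. y \<in> G' \<Longrightarrow> H y \<in> linear_maps C M P"
      "\<And>x y. x \<in> G \<Longrightarrow> y \<in> G' \<Longrightarrow> H y (g x) = v x y"
    by metis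
  define good where "good p k \<longleftrightarrow> k \<in> linear_maps C N P \<and> (\<forall>y\<in>G'. k (g' y) = H y p)" for p k
  have "submodule {p \<in> carrier M. \<exists>k. good p k} C M"
  proof (rule module_submoduleI[OF M(1)])
    show "\<zero>\<^bsub>M\<^esub> \<in> {p \<in> carrier M. \<exists>k. good p k}"
      using linear_maps_const_zero[OF P, of N] H(1)
      by (auto simp: good_def linear_maps_zero[OF _ M(1) P] intro!: exI[of _ "\<lambda>_. \<zero>\<^bsub>P\<^esub>"])
    show "a \<oplus>\<^bsub>M\<^esub> b \<in> {p \<in> carrier M. \<exists>k. good p k}"
      if ab: "a \<in> {p \<in> carrier M. \<exists>k. good p k}" "b \<in> {p \<in> carrier M. \<exists>k. good p k}" for a b
    proof -
      from ab obtain k l where "good a k" "good b l" by auto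
      then have "good (a \<oplus>\<^bsub>M\<^esub> b) (\<lambda>x. k x \<oplus>\<^bsub>P\<^esub> l x)"
        using ab H(1) linear_maps_sum[OF _ _ P] by (auto simp: good_def linear_maps_add[OF H(1)])
      with ab show ?thesis by auto
    qed
    show "c \<odot>\<^bsub>M\<^esub> a \<in> {p \<in> carrier M. \<exists>k. good p k}"
      if a: "c \<in> carrier C" "a \<in> {p \<in> carrier M. \<exists>k. good p k}" for c a
    proof -
      from a obtain k where "good a k" by auto
      then have "good (c \<odot>\<^bsub>M\<^esub> a) (\<lambda>x. c \<odot>\<^bsub>P\<^esub> k x)"
        using a H(1) linear_maps_scale[OF _ _ P] by (auto simp: good_def linear_maps_smult[OF H(1)])
      with a show ?thesis by auto
    qed
  qed auto
  moreover have "g ` G \<subseteq> {p \<in> carrier M. \<exists>k. good p k}"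
  proof safe
    fix x assume x: "x \<in> G"
    then show "g x \<in> carrier M" using M(2) by (auto simp: spans_def)
    from right[OF x] show "\<exists>k. good (g x) k" using x by (auto simp: good_def H(2))
  qed
  ultimately have "\<exists>k. good p k" if "p \<in> carrier M" for p
    using spans_submodule[OF M(2)] that by blast
  then obtain B where B: "\<And>p. p \<in> carrier M \<Longrightarrow> good p (B p)" by metis
  have BN: "B p \<in> linear_maps C N P" if "p \<in> carrier M" for p
    using B[OF that] by (simp add: good_def)
  have BH: "B p (g' y) = H y p" if "p \<in> carrier M" "y \<in> G'" for p y
    using B[OF that(1)] that by (simp add: good_def)
  have "B \<in> bilinear_maps C M N P"
  proof (rule bilinear_mapsI[OF BN])
    fix q assume q: "q \<in> carrier N"
    show "(\<lambda>p. B p q) \<in> linear_maps C M P"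
    proof (rule linear_mapsI)
      fix a b assume ab: "a \<in> carrier M" "b \<in> carrier M"
      show "B (a \<oplus>\<^bsub>M\<^esub> b) q = B a q \<oplus>\<^bsub>P\<^esub> B b q"
        by (rule linear_maps_eq_on_spans[OF N(2,1) P BN linear_maps_sum[OF BN BN P] _ q])
           (use ab in \<open>auto simp: BH linear_maps_add[OF H(1)]\<close>)
    next
      fix c a assume a: "c \<in> carrier C" "a \<in> carrier M"
      show "B (c \<odot>\<^bsub>M\<^esub> a) q = c \<odot>\<^bsub>P\<^esub> B a q"
        by (rule linear_maps_eq_on_spans[OF N(2,1) P BN linear_maps_scale[OF BN _ P] _ q])
           (use a in \<open>auto simp: BH linear_maps_smult[OF H(1)]\<close>)
    qed (use BN q in \<open>auto intro: linear_maps_closed\<close>)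
  qed
  moreover have "\<forall>x\<in>G. \<forall>y\<in>G'. B (g x) (g' y) = v x y"
    using M(2) by (auto simp: BH H(2) spans_def)
  ultimately show ?thesis by blast
qed

subsection \<open>Dependence on the module structure only\<close>

text \<open>
  The product of each algebra below is chosen on top of an already existing module; these facts
  identify the notions for the module with those for the algebra.
\<close>

lemma module_cong:
  assumes "carrier M' = carrier M" "add M' = add M" "zero M' = zero M" "smult M' = smult M"
  shows "module C M' = module C M"
  unfolding module_def module_axioms_def abelian_group_def abelian_group_axioms_def
    abelian_monoid_def by (simp add: assms comm_group_def group_def group_axioms_def
    monoid_def comm_monoid_def comm_monoid_axioms_def Units_def)

lemma cring_record_cong:
  assumes "cring M"
    and eq: "carrier M' = carrier M" "add M' = add M" "zero M' = zero M"
      "monoid.mult M' = monoid.mult M" "one M' = one M"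
  shows "cring M'"
proof -
  interpret M: cring M by fact
  show ?thesis
  proof (rule cringI)
    show "abelian_group M'"
    proof (rule abelian_groupI)
      fix x assume "x \<in> carrier M'"
      then show "\<exists>y\<in>carrier M'. y \<oplus>\<^bsub>M'\<^esub> x = \<zero>\<^bsub>M'\<^esub>"
        by (intro bexI[of _ "\<ominus>\<^bsub>M\<^esub> x"]) (auto simp: eq M.l_neg)
    qed (auto simp: eq M.a_ac)
    show "comm_monoid M'"
      by (rule comm_monoidI) (auto simp: eq M.m_ac)
  qed (auto simp: eq M.l_distr)
qed

lemma linear_maps_record_cong:
  assumes "carrier M' = carrier M" "add M' = add M" "smult M' = smult M"
    "carrier N' = carrier N" "add N' = add N" "smult N' = smult N"
  shows "linear_maps C M' N' = linear_maps C M N"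
  unfolding linear_maps_def by (simp add: assms)

lemma bilinear_maps_record_cong:
  assumes "carrier M' = carrier M" "add M' = add M" "smult M' = smult M"
    "carrier N' = carrier N" "add N' = add N" "smult N' = smult N"
    "carrier P' = carrier P" "add P' = add P" "smult P' = smult P"
  shows "bilinear_maps C M' N' P' = bilinear_maps C M N P"
  unfolding bilinear_maps_def using assms by (simp cong: linear_maps_record_cong)

lemma spans_record_cong:
  assumes "carrier M' = carrier M" "add M' = add M" "zero M' = zero M" "smult M' = smult M"
  shows "spans C M' A = spans C M A" "span C M' A = span C M A"
proof -
  have inv: "m_inv (add_monoid M') x = m_inv (add_monoid M) x" for x
    by (simp add: m_inv_def assms)
  have "submodule N C M' = submodule N C M" for N
    unfolding submodule_def subgroup_def submodule_axioms_def inv by (simp add: assms)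
  then show "span C M' A = span C M A" by (simp add: span_def)
  then show "spans C M' A = spans C M A" by (simp add: spans_def assms)
qed

subsection \<open>Free modules\<close>

lemma free_module_simps:
  "carrier (free_module C G) =
    {u. range u \<subseteq> carrier C \<and> {x. u x \<noteq> \<zero>\<^bsub>C\<^esub>} \<subseteq> G \<and> finite {x. u x \<noteq> \<zero>\<^bsub>C\<^esub>}}"
  "zero (free_module C G) = (\<lambda>_. \<zero>\<^bsub>C\<^esub>)"
  "add (free_module C G) = (\<lambda>u v x. u x \<oplus>\<^bsub>C\<^esub> v x)"
  "smult (free_module C G) = (\<lambda>c u x. c \<otimes>\<^bsub>C\<^esub> u x)"
  by (simp_all add: free_module_def)

lemma free_module_module:
  assumes "cring C"
  shows "module C (free_module C G)"
proof -
  interpret C: cring C by fact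
  have closed: "u x \<in> carrier C" if "u \<in> carrier (free_module C G)" for u x
    using that by (auto simp: free_module_simps)
  have sup: "(\<lambda>x. f x) \<in> carrier (free_module C G)"
    if "\<And>x. f x \<in> carrier C" "{x. f x \<noteq> \<zero>\<^bsub>C\<^esub>} \<subseteq> {x. u x \<noteq> \<zero>\<^bsub>C\<^esub>} \<union> {x. v x \<noteq> \<zero>\<^bsub>C\<^esub>}"
      "u \<in> carrier (free_module C G)" "v \<in> carrier (free_module C G)" for f u v
  proof -
    have "finite {x. f x \<noteq> \<zero>\<^bsub>C\<^esub>}"
      by (rule finite_subset[OF that(2)]) (use that(3,4) in \<open>auto simp: free_module_simps\<close>)
    then show ?thesis using that by (auto simp: free_module_simps)
  qed
  have z: "\<zero>\<^bsub>free_module C G\<^esub> \<in> carrier (free_module C G)" by (auto simp: free_module_simps)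
  show ?thesis
  proof (rule moduleI[OF assms])
    show "abelian_group (free_module C G)"
    proof (rule abelian_groupI)
      fix u assume u: "u \<in> carrier (free_module C G)"
      have "(\<lambda>x. \<ominus>\<^bsub>C\<^esub> u x) \<in> carrier (free_module C G)"
        by (rule sup[of _ u u]) (use u in \<open>auto simp: closed\<close>)
      then show "\<exists>y\<in>carrier (free_module C G). y \<oplus>\<^bsub>free_module C G\<^esub> u = \<zero>\<^bsub>free_module C G\<^esub>"
        by (rule rev_bexI) (use closed[OF u] in \<open>simp add: free_module_simps(2-) C.l_neg\<close>)
    next
      fix u v assume "u \<in> carrier (free_module C G)" "v \<in> carrier (free_module C G)"
      then show "u \<oplus>\<^bsub>free_module C G\<^esub> v \<in> carrier (free_module C G)"
        unfolding free_module_simps(3) by - (rule sup[of _ u v], auto simp: closed)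
    qed (use z in \<open>simp_all add: closed free_module_simps(2-) C.a_ac\<close>)
    fix c u assume "c \<in> carrier C" "u \<in> carrier (free_module C G)"
    then show "c \<odot>\<^bsub>free_module C G\<^esub> u \<in> carrier (free_module C G)"
      unfolding free_module_simps(4) by - (rule sup[of _ u u], auto simp: closed)
  qed (auto simp: free_module_simps(2-) closed C.l_distr C.r_distr C.m_assoc)
qed

lemma basis_vec_closed: "cring C \<Longrightarrow> x \<in> G \<Longrightarrow> basis_vec C x \<in> carrier (free_module C G)"
proof -
  assume C: "cring C" and x: "x \<in> G"
  interpret C: cring C by fact
  have "{y. basis_vec C x y \<noteq> \<zero>\<^bsub>C\<^esub>} \<subseteq> {x}" by (auto simp: basis_vec_def)
  then show ?thesis using x finite_subset[of _ "{x}"]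
    by (auto simp: free_module_simps basis_vec_def split: if_splits)
qed

text \<open>
  Induction over the support: clearing one entry removes a multiple of a basis vector.
\<close>

lemma free_module_spans:
  assumes "cring C"
  shows "spans C (free_module C G) (basis_vec C ` G)"
  unfolding spans_def
proof safe
  interpret C: cring C by fact
  let ?F = "free_module C G" and ?S = "span C (free_module C G) (basis_vec C ` G)"
  show "basis_vec C x \<in> carrier ?F" if "x \<in> G" for x using basis_vec_closed[OF assms that] .
  then have sub: "submodule ?S C ?F" by (intro span_submodule free_module_module assms) auto
  note D = submoduleD[OF sub free_module_module[OF assms]]
  fix u assume u: "u \<in> carrier ?F"
  define A where "A = {x. u x \<noteq> \<zero>\<^bsub>C\<^esub>}"
  have "finite A" using u by (auto simp: free_module_simps A_def)
  then show "u \<in> ?S" using u A_def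
  proof (induction A arbitrary: u rule: finite_induct)
    case empty
    then have "u = \<zero>\<^bsub>?F\<^esub>" by (auto simp: free_module_simps)
    then show ?case using D(2) by simp
  next
    case (insert a A)
    from insert.prems insert.hyps have a: "a \<in> G" "u a \<in> carrier C" by (auto simp: free_module_simps)
    have uc: "u x \<in> carrier C" for x using insert.prems by (auto simp: free_module_simps)
    have A: "A = {x. (u(a := \<zero>\<^bsub>C\<^esub>)) x \<noteq> \<zero>\<^bsub>C\<^esub>}" using insert.prems insert.hyps by auto
    have "u(a := \<zero>\<^bsub>C\<^esub>) \<in> carrier ?F"
      using insert.prems insert.hyps(1) uc unfolding free_module_simps
      by (auto simp: A[unfolded fun_upd_def, symmetric] image_subset_iff)
    have "basis_vec C a \<in> ?S" using a by (intro subsetD[OF span_superset]) auto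
    from D(3)[OF insert.IH[OF \<open>u(a := \<zero>\<^bsub>C\<^esub>) \<in> carrier ?F\<close> A] D(4)[OF a(2) this]]
    have "u(a := \<zero>\<^bsub>C\<^esub>) \<oplus>\<^bsub>?F\<^esub> (u a \<odot>\<^bsub>?F\<^esub> basis_vec C a) \<in> ?S" .
    also have "u(a := \<zero>\<^bsub>C\<^esub>) \<oplus>\<^bsub>?F\<^esub> (u a \<odot>\<^bsub>?F\<^esub> basis_vec C a) = u"
      using uc by (auto simp: free_module_simps basis_vec_def)
    finally show ?case .
  qed
qed

text \<open>
  The extension is \<open>u \<mapsto> \<Sum>\<^sub>x u x \<odot> v x\<close>, summed over the support of \<open>u\<close>.  Padding the index set
  with zero terms makes the sums for different \<open>u\<close> comparable.
\<close>

lemma free_module_lift: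
  assumes N: "module C N" and v: "\<And>x. x \<in> G \<Longrightarrow> v x \<in> carrier N"
  shows "\<exists>h\<in>linear_maps C (free_module C G) N. \<forall>x\<in>G. h (basis_vec C x) = v x"
proof -
  interpret N: module C N by fact
  let ?F = "free_module C G"
  define h where "h u = (\<Oplus>\<^bsub>N\<^esub>x\<in>{x. u x \<noteq> \<zero>\<^bsub>C\<^esub>}. u x \<odot>\<^bsub>N\<^esub> v x)" for u
  have cl: "u x \<odot>\<^bsub>N\<^esub> v x \<in> carrier N" if "u \<in> carrier ?F" "x \<in> G" for u x
  proof (rule N.smult_closed[OF _ v[OF that(2)]])
    show "u x \<in> carrier C" using that(1) by (auto simp: free_module_simps)
  qed
  have h_eq: "h u = (\<Oplus>\<^bsub>N\<^esub>x\<in>A. u x \<odot>\<^bsub>N\<^esub> v x)"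
    if "u \<in> carrier ?F" "finite A" "A \<subseteq> G" "{x. u x \<noteq> \<zero>\<^bsub>C\<^esub>} \<subseteq> A" for u A
    unfolding h_def
    by (rule N.add.finprod_mono_neutral_cong_left[folded finsum_def, OF that(2,4)])
       (use that v cl in \<open>auto\<close>)
  have "h \<in> linear_maps C ?F N"
  proof (rule linear_mapsI)
    fix u assume u: "u \<in> carrier ?F"
    then show "h u \<in> carrier N"
      unfolding h_def using cl[OF u] by (intro N.finsum_closed) (auto simp: free_module_simps)
  next
    fix u u' assume u: "u \<in> carrier ?F" "u' \<in> carrier ?F"
    let ?A = "{x. u x \<noteq> \<zero>\<^bsub>C\<^esub>} \<union> {x. u' x \<noteq> \<zero>\<^bsub>C\<^esub>}"
    have A: "finite ?A" "?A \<subseteq> G" using u by (auto simp: free_module_simps)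
    have "u \<oplus>\<^bsub>?F\<^esub> u' \<in> carrier ?F"
      using u module_abelian_group[OF free_module_module] N.R.is_cring abelian_groupE(1) by metis
    then have "h (u \<oplus>\<^bsub>?F\<^esub> u') = (\<Oplus>\<^bsub>N\<^esub>x\<in>?A. (u \<oplus>\<^bsub>?F\<^esub> u') x \<odot>\<^bsub>N\<^esub> v x)"
      by (rule h_eq[OF _ A]) (auto simp: free_module_simps)
    also have "\<dots> = (\<Oplus>\<^bsub>N\<^esub>x\<in>?A. u x \<odot>\<^bsub>N\<^esub> v x \<oplus>\<^bsub>N\<^esub> u' x \<odot>\<^bsub>N\<^esub> v x)"
      using A u v cl by (intro N.finsum_cong')
        (auto simp: free_module_simps image_subset_iff N.smult_l_distr subset_iff)
    also have "\<dots> = (\<Oplus>\<^bsub>N\<^esub>x\<in>?A. u x \<odot>\<^bsub>N\<^esub> v x) \<oplus>\<^bsub>N\<^esub> (\<Oplus>\<^bsub>N\<^esub>x\<in>?A. u' x \<odot>\<^bsub>N\<^esub> v x)"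
      using A u cl by (intro N.finsum_addf) auto
    finally show "h (u \<oplus>\<^bsub>?F\<^esub> u') = h u \<oplus>\<^bsub>N\<^esub> h u'"
      using h_eq[OF u(1) A] h_eq[OF u(2) A] by auto
  next
    fix c u assume c: "c \<in> carrier C" and u: "u \<in> carrier ?F"
    let ?A = "{x. u x \<noteq> \<zero>\<^bsub>C\<^esub>}"
    have A: "finite ?A" "?A \<subseteq> G" using u by (auto simp: free_module_simps)
    have "c \<odot>\<^bsub>?F\<^esub> u \<in> carrier ?F"
      using u c module.smult_closed[OF free_module_module] N.R.is_cring by metis
    then have "h (c \<odot>\<^bsub>?F\<^esub> u) = (\<Oplus>\<^bsub>N\<^esub>x\<in>?A. (c \<odot>\<^bsub>?F\<^esub> u) x \<odot>\<^bsub>N\<^esub> v x)"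
      using c by (intro h_eq[OF _ A]) (auto simp: free_module_simps)
    also have "\<dots> = (\<Oplus>\<^bsub>N\<^esub>x\<in>?A. c \<odot>\<^bsub>N\<^esub> (u x \<odot>\<^bsub>N\<^esub> v x))"
      using A u c v cl by (intro N.finsum_cong')
        (auto simp: free_module_simps image_subset_iff N.smult_assoc1 subset_iff)
    also have "\<dots> = c \<odot>\<^bsub>N\<^esub> h u"
      unfolding h_def using A cl[OF u] c by (subst N.finsum_smult_ldistr) auto
    finally show "h (c \<odot>\<^bsub>?F\<^esub> u) = c \<odot>\<^bsub>N\<^esub> h u" .
  qed
  moreover have "h (basis_vec C x) = v x" if x: "x \<in> G" for x
  proof -
    have "h (basis_vec C x) = (\<Oplus>\<^bsub>N\<^esub>y\<in>{x}. basis_vec C x y \<odot>\<^bsub>N\<^esub> v y)"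
      by (rule h_eq[OF basis_vec_closed[OF N.R.is_cring x]]) (use x in \<open>auto simp: basis_vec_def\<close>)
    also have "\<dots> = v x" using v[OF x] by (simp add: basis_vec_def)
    finally show ?thesis .
  qed
  ultimately show ?thesis by blast
qed

subsection \<open>Quotient modules\<close>

lemma module_surj_image:
  assumes M: "module C M" and surj: "carrier N = p ` carrier M"
    and add: "\<And>x y. x \<in> carrier M \<Longrightarrow> y \<in> carrier M \<Longrightarrow> p (x \<oplus>\<^bsub>M\<^esub> y) = p x \<oplus>\<^bsub>N\<^esub> p y"
    and smult: "\<And>c x. c \<in> carrier C \<Longrightarrow> x \<in> carrier M \<Longrightarrow> p (c \<odot>\<^bsub>M\<^esub> x) = c \<odot>\<^bsub>N\<^esub> p x"
    and zero: "p \<zero>\<^bsub>M\<^esub> = \<zero>\<^bsub>N\<^esub>"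
  shows "module C N"
proof -
  interpret M: module C M by fact
  note [simp] = add[symmetric] smult[symmetric] zero[symmetric]
  show ?thesis
  proof (rule moduleI[OF M.R.is_cring])
    show "abelian_group N"
    proof (rule abelian_groupI)
      fix x assume "x \<in> carrier N"
      then obtain y where y: "y \<in> carrier M" "x = p y" by (auto simp: surj)
      then show "\<exists>y\<in>carrier N. y \<oplus>\<^bsub>N\<^esub> x = \<zero>\<^bsub>N\<^esub>"
        by (intro bexI[of _ "p (\<ominus>\<^bsub>M\<^esub> y)"]) (auto simp: surj M.l_neg)
    qed (auto simp: surj M.M.a_ac)
  qed (auto simp: surj M.smult_l_distr M.smult_r_distr M.smult_assoc1)
qed

lemma abelian_group_minus_eq_zeroD:
  assumes "abelian_group G" "x \<in> carrier G" "y \<in> carrier G" "x \<ominus>\<^bsub>G\<^esub> y = \<zero>\<^bsub>G\<^esub>"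
  shows "x = y"
proof -
  interpret abelian_group G by fact
  have "x = (x \<ominus>\<^bsub>G\<^esub> y) \<oplus>\<^bsub>G\<^esub> y" using assms(2,3) by (simp add: a_minus_def a_assoc l_neg)
  then show ?thesis using assms by simp
qed

lemma submodule_abelian_subgroup:
  assumes "module C M" "submodule N C M"
  shows "abelian_subgroup N M"
  using assms by (intro abelian_subgroupI3 additive_subgroupI module_abelian_group submodule.axioms(1))

lemma quot_module_simps:
  "carrier (quot_module M N) = a_rcosets\<^bsub>M\<^esub> N"
  "zero (quot_module M N) = N" "add (quot_module M N) = set_add M"
  "smult (quot_module M N) = (\<lambda>c A. \<Union>a\<in>A. N +>\<^bsub>M\<^esub> (c \<odot>\<^bsub>M\<^esub> a))"
  "monoid.mult (quot_module M N) = rcoset_mult M N" "one (quot_module M N) = N +>\<^bsub>M\<^esub> \<one>\<^bsub>M\<^esub>"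
  by (simp_all add: quot_module_def)

lemma quot_module_carrier: "carrier (quot_module M N) = (\<lambda>x. N +>\<^bsub>M\<^esub> x) ` carrier M"
  by (auto simp: quot_module_simps A_RCOSETS_def' )

lemma quot_proj_eq_iff:
  assumes "module C M" "submodule N C M" "x \<in> carrier M" "y \<in> carrier M"
  shows "N +>\<^bsub>M\<^esub> x = N +>\<^bsub>M\<^esub> y \<longleftrightarrow> x \<ominus>\<^bsub>M\<^esub> y \<in> N"
proof -
  interpret M: module C M by fact
  interpret N: abelian_subgroup N M by (rule submodule_abelian_subgroup[OF assms(1,2)])
  show ?thesis
    using assms(3,4) N.a_rcos_module[of y x] N.a_repr_independence'[of x y] N.a_rcos_self[of x]
    by (auto simp: a_minus_def)
qed

text \<open>
  The action on a coset is defined as a union over all representatives.  It is a single coset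
  because \<open>c\<close> times the difference of two representatives lies in \<open>N\<close>.
\<close>

lemma quot_proj_smult:
  assumes "module C M" "submodule N C M" "c \<in> carrier C" "x \<in> carrier M"
  shows "N +>\<^bsub>M\<^esub> (c \<odot>\<^bsub>M\<^esub> x) = c \<odot>\<^bsub>quot_module M N\<^esub> (N +>\<^bsub>M\<^esub> x)"
proof -
  interpret M: module C M by fact
  interpret N: abelian_subgroup N M by (rule submodule_abelian_subgroup[OF assms(1,2)])
  have eq: "N +>\<^bsub>M\<^esub> (c \<odot>\<^bsub>M\<^esub> a) = N +>\<^bsub>M\<^esub> (c \<odot>\<^bsub>M\<^esub> x)" if a: "a \<in> N +>\<^bsub>M\<^esub> x" for a
  proof -
    from a assms(4) have ac: "a \<in> carrier M" by (rule N.a_elemrcos_carrier[rotated])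
    have "N +>\<^bsub>M\<^esub> a = N +>\<^bsub>M\<^esub> x" using a assms(4) by (rule N.a_repr_independence'[symmetric])
    then have "a \<ominus>\<^bsub>M\<^esub> x \<in> N" using quot_proj_eq_iff[OF assms(1,2) ac assms(4)] by simp
    then have "c \<odot>\<^bsub>M\<^esub> (a \<ominus>\<^bsub>M\<^esub> x) \<in> N" by (rule submoduleD(4)[OF assms(2,1,3)])
    also have "c \<odot>\<^bsub>M\<^esub> (a \<ominus>\<^bsub>M\<^esub> x) = c \<odot>\<^bsub>M\<^esub> a \<ominus>\<^bsub>M\<^esub> c \<odot>\<^bsub>M\<^esub> x"
      using ac assms by (simp add: a_minus_def M.smult_r_distr M.smult_r_minus)
    finally show ?thesis using quot_proj_eq_iff[OF assms(1,2)] ac assms by simp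
  qed
  then have "(\<Union>a\<in>N +>\<^bsub>M\<^esub> x. N +>\<^bsub>M\<^esub> (c \<odot>\<^bsub>M\<^esub> a)) = (\<Union>a\<in>N +>\<^bsub>M\<^esub> x. N +>\<^bsub>M\<^esub> (c \<odot>\<^bsub>M\<^esub> x))"
    by (rule SUP_cong[OF refl])
  also have "\<dots> = N +>\<^bsub>M\<^esub> (c \<odot>\<^bsub>M\<^esub> x)" using N.a_rcos_self[OF assms(4)] by blast
  finally show ?thesis by (simp add: quot_module_simps)
qed

lemma
  assumes M: "module C M" and N: "submodule N C M"
  shows quot_module_module: "module C (quot_module M N)"
    and quot_proj_linear: "(\<lambda>x. N +>\<^bsub>M\<^esub> x) \<in> linear_maps C M (quot_module M N)"
proof -
  interpret M: module C M by fact
  interpret N: abelian_subgroup N M by (rule submodule_abelian_subgroup[OF M N])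
  have zero: "N +>\<^bsub>M\<^esub> \<zero>\<^bsub>M\<^esub> = N" using N.a_subset by simp
  show "module C (quot_module M N)"
    by (rule module_surj_image[OF M quot_module_carrier])
       (use zero in \<open>auto simp: quot_proj_smult[OF M N] quot_module_simps(2,3) N.a_rcos_sum\<close>)
  show "(\<lambda>x. N +>\<^bsub>M\<^esub> x) \<in> linear_maps C M (quot_module M N)"
    by (rule linear_mapsI)
       (auto simp: quot_proj_smult[OF M N] quot_module_carrier quot_module_simps(3) N.a_rcos_sum)
qed

lemma quot_module_lift:
  assumes M: "module C M" and N: "submodule N C M" and P: "module C P"
    and h: "h \<in> linear_maps C M P" and kill: "\<And>x. x \<in> N \<Longrightarrow> h x = \<zero>\<^bsub>P\<^esub>"
  shows "\<exists>k\<in>linear_maps C (quot_module M N) P. \<forall>x\<in>carrier M. k (N +>\<^bsub>M\<^esub> x) = h x"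
proof -
  interpret M: module C M by fact
  interpret P: module C P by fact
  define k where "k A = h (SOME x. x \<in> carrier M \<and> N +>\<^bsub>M\<^esub> x = A)" for A
  have k: "k (N +>\<^bsub>M\<^esub> x) = h x" if x: "x \<in> carrier M" for x
  proof -
    define y where "y = (SOME y. y \<in> carrier M \<and> N +>\<^bsub>M\<^esub> y = N +>\<^bsub>M\<^esub> x)"
    have y: "y \<in> carrier M" "N +>\<^bsub>M\<^esub> y = N +>\<^bsub>M\<^esub> x"
      using someI[of "\<lambda>y. y \<in> carrier M \<and> N +>\<^bsub>M\<^esub> y = N +>\<^bsub>M\<^esub> x" x] x by (auto simp: y_def)
    then have "h (y \<ominus>\<^bsub>M\<^esub> x) = \<zero>\<^bsub>P\<^esub>" using quot_proj_eq_iff[OF M N] x kill by auto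
    then have "h y \<ominus>\<^bsub>P\<^esub> h x = \<zero>\<^bsub>P\<^esub>" by (simp only: linear_maps_minus[OF h M P y(1) x])
    then have "h y = h x"
      by (rule abelian_group_minus_eq_zeroD[OF module_abelian_group[OF P]
            linear_maps_closed[OF h y(1)] linear_maps_closed[OF h x]])
    then show ?thesis by (simp add: k_def y_def)
  qed
  have pl: "(\<lambda>x. N +>\<^bsub>M\<^esub> x) \<in> linear_maps C M (quot_module M N)" by (rule quot_proj_linear[OF M N])
  have "k \<in> linear_maps C (quot_module M N) P"
  proof (rule linear_mapsI)
    fix A assume "A \<in> carrier (quot_module M N)"
    then show "k A \<in> carrier P" by (auto simp: quot_module_carrier k linear_maps_closed[OF h])
  next
    fix A B assume "A \<in> carrier (quot_module M N)" "B \<in> carrier (quot_module M N)"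
    then obtain x y where "x \<in> carrier M" "y \<in> carrier M" "A = N +>\<^bsub>M\<^esub> x" "B = N +>\<^bsub>M\<^esub> y"
      by (auto simp: quot_module_carrier)
    then show "k (A \<oplus>\<^bsub>quot_module M N\<^esub> B) = k A \<oplus>\<^bsub>P\<^esub> k B"
      by (simp add: linear_maps_add[OF pl, symmetric] k linear_maps_add[OF h])
  next
    fix c A assume "c \<in> carrier C" "A \<in> carrier (quot_module M N)"
    then obtain x where "c \<in> carrier C" "x \<in> carrier M" "A = N +>\<^bsub>M\<^esub> x"
      by (auto simp: quot_module_carrier)
    then show "k (c \<odot>\<^bsub>quot_module M N\<^esub> A) = c \<odot>\<^bsub>P\<^esub> k A"
      by (simp add: linear_maps_smult[OF pl, symmetric] k linear_maps_smult[OF h])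
  qed
  with k show ?thesis by blast
qed

lemma spans_image:
  assumes "spans C M A" "module C M" "module C N" "p \<in> linear_maps C M N"
    "carrier N = p ` carrier M"
  shows "spans C N (p ` A)"
  unfolding spans_def
proof safe
  show A: "p a \<in> carrier N" if "a \<in> A" for a
    using assms(1,5) that by (auto simp: spans_def)
  have sub: "submodule (span C N (p ` A)) C N" using A by (intro span_submodule assms(3)) auto
  fix y assume "y \<in> carrier N"
  then obtain x where x: "x \<in> carrier M" "y = p x" using assms(5) by auto
  have "p x \<in> span C N (p ` A)"
    by (rule linear_maps_into_submodule[OF assms(1,4,2,3) sub _ x(1)])
       (rule subsetD[OF span_superset], simp)
  then show "y \<in> span C N (p ` A)" using x by simp
qed

section \<open>Modules and algebras by generators and relations\<close>

lemma
  assumes C: "cring C" and A: "A \<subseteq> carrier (free_module C G)"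
  shows presented_module_module: "module C (presented_module C G A)"
    and presented_spans: "spans C (presented_module C G A) (presented_gen C G A ` G)"
    and presented_proj_linear: "(\<lambda>u. span C (free_module C G) A +>\<^bsub>free_module C G\<^esub> u) \<in>
      linear_maps C (free_module C G) (presented_module C G A)"
proof -
  note F = free_module_module[OF C, of G] and S = span_submodule[OF free_module_module[OF C] A]
  show M: "module C (presented_module C G A)"
    unfolding presented_module_def by (rule quot_module_module[OF F S])
  show l: "(\<lambda>u. span C (free_module C G) A +>\<^bsub>free_module C G\<^esub> u) \<in>
      linear_maps C (free_module C G) (presented_module C G A)"
    unfolding presented_module_def by (rule quot_proj_linear[OF F S])
  have "presented_gen C G A ` G =
      (\<lambda>u. span C (free_module C G) A +>\<^bsub>free_module C G\<^esub> u) ` basis_vec C ` G"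
    by (auto simp: presented_gen_def)
  then show "spans C (presented_module C G A) (presented_gen C G A ` G)"
    using spans_image[OF free_module_spans[OF C] F M l]
    by (simp add: presented_module_def quot_module_carrier)
qed

text \<open>
  The extension of \<open>v\<close> to the free module vanishes on \<open>A\<close>, hence on its span, and so factors
  through the quotient.
\<close>

lemma presented_module_lift:
  assumes C: "cring C" and A: "A \<subseteq> carrier (free_module C G)" and N: "module C N"
    and v: "\<And>x. x \<in> G \<Longrightarrow> v x \<in> carrier N"
    and kill: "\<And>h a. h \<in> linear_maps C (free_module C G) N \<Longrightarrow>
      (\<And>x. x \<in> G \<Longrightarrow> h (basis_vec C x) = v x) \<Longrightarrow> a \<in> A \<Longrightarrow> h a = \<zero>\<^bsub>N\<^esub>"
  shows "\<exists>k\<in>linear_maps C (presented_module C G A) N. \<forall>x\<in>G. k (presented_gen C G A x) = v x"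
proof -
  note F = free_module_module[OF C, of G] and S = span_submodule[OF free_module_module[OF C] A]
  have "\<exists>h\<in>linear_maps C (free_module C G) N. \<forall>x\<in>G. h (basis_vec C x) = v x"
    by (rule free_module_lift[OF N v])
  then obtain h where h: "h \<in> linear_maps C (free_module C G) N"
    "\<And>x. x \<in> G \<Longrightarrow> h (basis_vec C x) = v x" by blast
  interpret N: module C N by fact
  have "submodule {\<zero>\<^bsub>N\<^esub>} C N" by (rule module_submoduleI[OF N]) auto
  then have "submodule {x \<in> carrier (free_module C G). h x \<in> {\<zero>\<^bsub>N\<^esub>}} C (free_module C G)"
    by (rule submodule_vimage[OF h(1) F N])
  then have "span C (free_module C G) A \<subseteq> {x \<in> carrier (free_module C G). h x \<in> {\<zero>\<^bsub>N\<^esub>}}"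
    by (rule span_least) (use A kill[OF h] in blast)
  then have "h x = \<zero>\<^bsub>N\<^esub>" if "x \<in> span C (free_module C G) A" for x
    using that by blast
  from quot_module_lift[OF F S N h(1) this]
  obtain k where k: "k \<in> linear_maps C (presented_module C G A) N"
    "\<forall>u\<in>carrier (free_module C G). k (span C (free_module C G) A +>\<^bsub>free_module C G\<^esub> u) = h u"
    unfolding presented_module_def by blast
  have "k (presented_gen C G A x) = v x" if "x \<in> G" for x
    using k(2) h(2)[OF that] basis_vec_closed[OF C that] by (simp add: presented_gen_def)
  with k(1) show ?thesis by blast
qed

lemma presented_rel_add:
  assumes C: "cring C" and A: "A \<subseteq> carrier (free_module C G)" and "x \<in> G" "y \<in> G" "z \<in> G"
    and rel: "basis_vec C x \<ominus>\<^bsub>free_module C G\<^esub> (basis_vec C y \<oplus>\<^bsub>free_module C G\<^esub> basis_vec C z) \<in> A"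
  shows "presented_gen C G A x =
    presented_gen C G A y \<oplus>\<^bsub>presented_module C G A\<^esub> presented_gen C G A z"
proof -
  let ?F = "free_module C G"
  note F = free_module_module[OF C, of G] and S = span_submodule[OF free_module_module[OF C] A]
  interpret F: module C ?F by (rule F)
  have e: "basis_vec C x \<in> carrier ?F" "basis_vec C y \<in> carrier ?F" "basis_vec C z \<in> carrier ?F"
    using assms basis_vec_closed by metis+
  have "presented_gen C G A x = span C ?F A +>\<^bsub>?F\<^esub> (basis_vec C y \<oplus>\<^bsub>?F\<^esub> basis_vec C z)"
    unfolding presented_gen_def
    using quot_proj_eq_iff[OF F S e(1) F.M.a_closed[OF e(2,3)]] rel subsetD[OF span_superset] by metis
  also have "\<dots> = presented_gen C G A y \<oplus>\<^bsub>presented_module C G A\<^esub> presented_gen C G A z"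
    unfolding presented_gen_def by (rule linear_maps_add[OF presented_proj_linear[OF C A] e(2,3)])
  finally show ?thesis .
qed

lemma presented_rel_smult:
  assumes C: "cring C" and A: "A \<subseteq> carrier (free_module C G)" and "x \<in> G" "y \<in> G" "c \<in> carrier C"
    and rel: "basis_vec C x \<ominus>\<^bsub>free_module C G\<^esub> (c \<odot>\<^bsub>free_module C G\<^esub> basis_vec C y) \<in> A"
  shows "presented_gen C G A x = c \<odot>\<^bsub>presented_module C G A\<^esub> presented_gen C G A y"
proof -
  let ?F = "free_module C G"
  note F = free_module_module[OF C, of G] and S = span_submodule[OF free_module_module[OF C] A]
  interpret F: module C ?F by (rule F)
  have e: "basis_vec C x \<in> carrier ?F" "basis_vec C y \<in> carrier ?F"
    using assms basis_vec_closed by metis+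
  have "presented_gen C G A x = span C ?F A +>\<^bsub>?F\<^esub> (c \<odot>\<^bsub>?F\<^esub> basis_vec C y)"
    unfolding presented_gen_def
    using quot_proj_eq_iff[OF F S e(1) F.smult_closed[OF assms(5) e(2)]] rel subsetD[OF span_superset]
    by metis
  also have "\<dots> = c \<odot>\<^bsub>presented_module C G A\<^esub> presented_gen C G A y"
    unfolding presented_gen_def by (rule linear_maps_smult[OF presented_proj_linear[OF C A] assms(5) e(2)])
  finally show ?thesis .
qed

lemma free_lift_rel_add:
  assumes C: "cring C" and N: "module C N" and h: "h \<in> linear_maps C (free_module C G) N"
    and "x \<in> G" "y \<in> G" "z \<in> G"
    and "h (basis_vec C x) = h (basis_vec C y) \<oplus>\<^bsub>N\<^esub> h (basis_vec C z)"
  shows "h (basis_vec C x \<ominus>\<^bsub>free_module C G\<^esub>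
    (basis_vec C y \<oplus>\<^bsub>free_module C G\<^esub> basis_vec C z)) = \<zero>\<^bsub>N\<^esub>"
proof -
  interpret F: module C "free_module C G" by (rule free_module_module[OF C])
  interpret N: module C N by fact
  have e: "basis_vec C a \<in> carrier (free_module C G)" if "a \<in> G" for a
    by (rule basis_vec_closed[OF C that])
  show ?thesis
    using assms(4-) e linear_maps_closed[OF h] N.M.r_neg[of "h (basis_vec C x)"]
    by (simp add: linear_maps_minus[OF h F.module_axioms N] linear_maps_add[OF h] a_minus_def[of N])
qed

lemma free_lift_rel_smult:
  assumes C: "cring C" and N: "module C N" and h: "h \<in> linear_maps C (free_module C G) N"
    and "x \<in> G" "y \<in> G" "c \<in> carrier C"
    and "h (basis_vec C x) = c \<odot>\<^bsub>N\<^esub> h (basis_vec C y)"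
  shows "h (basis_vec C x \<ominus>\<^bsub>free_module C G\<^esub> (c \<odot>\<^bsub>free_module C G\<^esub> basis_vec C y)) = \<zero>\<^bsub>N\<^esub>"
proof -
  interpret F: module C "free_module C G" by (rule free_module_module[OF C])
  interpret N: module C N by fact
  have e: "basis_vec C a \<in> carrier (free_module C G)" if "a \<in> G" for a
    by (rule basis_vec_closed[OF C that])
  show ?thesis
    using assms(4-) e linear_maps_closed[OF h] N.M.r_neg[of "h (basis_vec C x)"]
    by (simp add: linear_maps_minus[OF h F.module_axioms N] linear_maps_smult[OF h] a_minus_def[of N])
qed

lemma free_rel_closed:
  assumes "cring C"
  shows "\<lbrakk>x \<in> G; y \<in> G; z \<in> G\<rbrakk> \<Longrightarrow> basis_vec C x \<ominus>\<^bsub>free_module C G\<^esub>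
      (basis_vec C y \<oplus>\<^bsub>free_module C G\<^esub> basis_vec C z) \<in> carrier (free_module C G)"
    and "\<lbrakk>x \<in> G; y \<in> G; c \<in> carrier C\<rbrakk> \<Longrightarrow> basis_vec C x \<ominus>\<^bsub>free_module C G\<^esub>
      (c \<odot>\<^bsub>free_module C G\<^esub> basis_vec C y) \<in> carrier (free_module C G)"
proof -
  interpret F: module C "free_module C G" by (rule free_module_module[OF assms])
  note e = basis_vec_closed[OF assms, of _ G]
  show "\<lbrakk>x \<in> G; y \<in> G; z \<in> G\<rbrakk> \<Longrightarrow> basis_vec C x \<ominus>\<^bsub>free_module C G\<^esub>
      (basis_vec C y \<oplus>\<^bsub>free_module C G\<^esub> basis_vec C z) \<in> carrier (free_module C G)"
    and "\<lbrakk>x \<in> G; y \<in> G; c \<in> carrier C\<rbrakk> \<Longrightarrow> basis_vec C x \<ominus>\<^bsub>free_module C G\<^esub>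
      (c \<odot>\<^bsub>free_module C G\<^esub> basis_vec C y) \<in> carrier (free_module C G)"
    by (auto simp: a_minus_def intro!: e)
qed

subsection \<open>Tensor products\<close>

lemma tensor_relsI:
  fixes C M N
  defines "F \<equiv> free_module C (carrier M \<times> carrier N)"
  shows "\<lbrakk>x \<in> carrier M; x' \<in> carrier M; y \<in> carrier N\<rbrakk> \<Longrightarrow> basis_vec C (x \<oplus>\<^bsub>M\<^esub> x', y) \<ominus>\<^bsub>F\<^esub>
      (basis_vec C (x, y) \<oplus>\<^bsub>F\<^esub> basis_vec C (x', y)) \<in> tensor_rels C M N"
    and "\<lbrakk>x \<in> carrier M; y \<in> carrier N; y' \<in> carrier N\<rbrakk> \<Longrightarrow> basis_vec C (x, y \<oplus>\<^bsub>N\<^esub> y') \<ominus>\<^bsub>F\<^esub>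
      (basis_vec C (x, y) \<oplus>\<^bsub>F\<^esub> basis_vec C (x, y')) \<in> tensor_rels C M N"
    and "\<lbrakk>c \<in> carrier C; x \<in> carrier M; y \<in> carrier N\<rbrakk> \<Longrightarrow> basis_vec C (c \<odot>\<^bsub>M\<^esub> x, y) \<ominus>\<^bsub>F\<^esub>
      (c \<odot>\<^bsub>F\<^esub> basis_vec C (x, y)) \<in> tensor_rels C M N"
    and "\<lbrakk>c \<in> carrier C; x \<in> carrier M; y \<in> carrier N\<rbrakk> \<Longrightarrow> basis_vec C (x, c \<odot>\<^bsub>N\<^esub> y) \<ominus>\<^bsub>F\<^esub>
      (c \<odot>\<^bsub>F\<^esub> basis_vec C (x, y)) \<in> tensor_rels C M N"
  unfolding tensor_rels_def Let_def F_def
  subgoal by (rule UnI1, rule UnI1, rule UnI1, intro CollectI exI conjI, rule refl)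
  subgoal by (rule UnI1, rule UnI1, rule UnI2, intro CollectI exI conjI, rule refl)
  subgoal by (rule UnI1, rule UnI2, intro CollectI exI conjI, rule refl)
  subgoal by (rule UnI2, intro CollectI exI conjI, rule refl)
  done

lemma tensor_rels_subset:
  assumes "module C M" "module C N"
  shows "tensor_rels C M N \<subseteq> carrier (free_module C (carrier M \<times> carrier N))"
proof -
  interpret M: module C M by fact
  interpret N: module C N by fact
  show ?thesis
    unfolding tensor_rels_def Let_def
    by (intro Un_least subsetI; elim CollectE exE conjE; simp only:; intro free_rel_closed[OF M.R.is_cring])
      auto
qed

lemma
  assumes M: "module C M" and N: "module C N"
  shows tensor_module_module: "module C (tensor_module C M N)"
    and tensor_bilinear: "tensor C M N \<in> bilinear_maps C M N (tensor_module C M N)"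
    and tensor_spans': "spans C (tensor_module C M N)
      {tensor C M N x y | x y. x \<in> carrier M \<and> y \<in> carrier N}"
proof -
  interpret M: module C M by fact
  interpret N: module C N by fact
  note C = M.R.is_cring
  note R = tensor_rels_subset[OF M N]
  show "module C (tensor_module C M N)"
    unfolding tensor_module_def by (rule presented_module_module[OF C R])
  have sp: "spans C (tensor_module C M N)
      (presented_gen C (carrier M \<times> carrier N) (tensor_rels C M N) ` (carrier M \<times> carrier N))"
    unfolding tensor_module_def by (rule presented_spans[OF C R])
  moreover have "presented_gen C (carrier M \<times> carrier N) (tensor_rels C M N) ` (carrier M \<times> carrier N) =
      {tensor C M N x y | x y. x \<in> carrier M \<and> y \<in> carrier N}"
    by (auto simp: tensor_def)
  ultimately show "spans C (tensor_module C M N)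
      {tensor C M N x y | x y. x \<in> carrier M \<and> y \<in> carrier N}" by simp
  then have cl: "tensor C M N x y \<in> carrier (tensor_module C M N)"
    if "x \<in> carrier M" "y \<in> carrier N" for x y
    using that by (auto simp: spans_def)
  show "tensor C M N \<in> bilinear_maps C M N (tensor_module C M N)"
  proof (intro bilinear_mapsI linear_mapsI cl)
    fix x y y' assume "x \<in> carrier M" "y \<in> carrier N" "y' \<in> carrier N"
    then show "tensor C M N x (y \<oplus>\<^bsub>N\<^esub> y') =
        tensor C M N x y \<oplus>\<^bsub>tensor_module C M N\<^esub> tensor C M N x y'"
      unfolding tensor_def tensor_module_def
      by (intro presented_rel_add[OF C R] tensor_relsI) auto
  next
    fix x x' y assume "x \<in> carrier M" "x' \<in> carrier M" "y \<in> carrier N"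
    then show "tensor C M N (x \<oplus>\<^bsub>M\<^esub> x') y =
        tensor C M N x y \<oplus>\<^bsub>tensor_module C M N\<^esub> tensor C M N x' y"
      unfolding tensor_def tensor_module_def
      by (intro presented_rel_add[OF C R] tensor_relsI) auto
  next
    fix c x y assume "c \<in> carrier C" "x \<in> carrier M" "y \<in> carrier N"
    then show "tensor C M N (c \<odot>\<^bsub>M\<^esub> x) y = c \<odot>\<^bsub>tensor_module C M N\<^esub> tensor C M N x y"
      unfolding tensor_def tensor_module_def
      by (intro presented_rel_smult[OF C R] tensor_relsI) auto
  next
    fix c x y assume "c \<in> carrier C" "x \<in> carrier M" "y \<in> carrier N"
    then show "tensor C M N x (c \<odot>\<^bsub>N\<^esub> y) = c \<odot>\<^bsub>tensor_module C M N\<^esub> tensor C M N x y"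
      unfolding tensor_def tensor_module_def
      by (intro presented_rel_smult[OF C R] tensor_relsI) auto
  qed
qed

lemma tensor_lift:
  assumes M: "module C M" and N: "module C N" and P: "module C P"
    and B: "B \<in> bilinear_maps C M N P"
  shows "\<exists>h\<in>linear_maps C (tensor_module C M N) P.
    \<forall>x\<in>carrier M. \<forall>y\<in>carrier N. h (tensor C M N x y) = B x y"
proof -
  interpret M: module C M by fact
  interpret N: module C N by fact
  note C = M.R.is_cring
  note l = bilinear_maps_left[OF B] and r = bilinear_maps_right[OF B]
  have "\<exists>k\<in>linear_maps C (presented_module C (carrier M \<times> carrier N) (tensor_rels C M N)) P.
    \<forall>p\<in>carrier M \<times> carrier N.
      k (presented_gen C (carrier M \<times> carrier N) (tensor_rels C M N) p) = (\<lambda>(x, y). B x y) p"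
  proof (rule presented_module_lift[OF C tensor_rels_subset[OF M N] P])
    show "(\<lambda>(x, y). B x y) p \<in> carrier P" if "p \<in> carrier M \<times> carrier N" for p
      using that bilinear_maps_closed[OF B] by auto
    fix h a assume h: "h \<in> linear_maps C (free_module C (carrier M \<times> carrier N)) P"
      "\<And>p. p \<in> carrier M \<times> carrier N \<Longrightarrow> h (basis_vec C p) = (\<lambda>(x, y). B x y) p"
    note ra = free_lift_rel_add[OF C P h(1)] and rs = free_lift_rel_smult[OF C P h(1)]
    assume "a \<in> tensor_rels C M N"
    then show "h a = \<zero>\<^bsub>P\<^esub>"
      unfolding tensor_rels_def Let_def
      by (elim UnE CollectE exE conjE; simp only:; intro ra rs)
         (auto simp: h(2) linear_maps_add[OF l] linear_maps_add[OF r] linear_maps_smult[OF l]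
            linear_maps_smult[OF r])
  qed
  then show ?thesis unfolding tensor_def tensor_module_def by auto
qed

lemma tensor_spans:
  assumes M: "module C M" "spans C M A" and N: "module C N" "spans C N B"
  shows "spans C (tensor_module C M N) {tensor C M N x y | x y. x \<in> A \<and> y \<in> B}"
    (is "spans C ?T ?A")
proof -
  note T = tensor_module_module[OF M(1) N(1)] and t = tensor_bilinear[OF M(1) N(1)]
  have sub: "?A \<subseteq> carrier ?T"
  proof
    fix z assume "z \<in> ?A"
    then obtain x y where "z = tensor C M N x y" "x \<in> A" "y \<in> B" by (elim CollectE exE conjE)
    then show "z \<in> carrier ?T"
      using bilinear_maps_closed[OF t spans_subset[OF M(2)] spans_subset[OF N(2)]] by (simp only:)
  qed
  note S = span_submodule[OF T sub]
  have 1: "tensor C M N x y \<in> span C ?T ?A" if "x \<in> A" "y \<in> carrier N" for x y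
  proof -
    from that M(2) have x: "x \<in> carrier M" by (blast intro: spans_subset)
    show ?thesis
      by (rule linear_maps_into_submodule[OF N(2) bilinear_maps_right[OF t x] N(1) T S _ that(2)])
         (rule subsetD[OF span_superset], use that(1) in blast)
  qed
  have 2: "tensor C M N x y \<in> span C ?T ?A" if "x \<in> carrier M" "y \<in> carrier N" for x y
  proof -
    show ?thesis
      by (rule linear_maps_into_submodule[OF M(2) bilinear_maps_left[OF t that(2)] M(1) T S _ that(1)])
         (rule 1[OF _ that(2)])
  qed
  have "z \<in> span C ?T ?A" if "z \<in> carrier ?T" for z
    by (rule spans_submodule[OF tensor_spans'[OF M(1) N(1)] S _ that]) (use 2 in blast)
  with sub show ?thesis unfolding spans_def by blast
qed

subsection \<open>Tensor powers and the shuffle product\<close>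

text \<open>
  Linearity in every letter, phrased by \<^const>\<open>linear_maps\<close> so that it is inherited by sums and
  compositions.  The empty word has no letters and needs a condition of its own.
\<close>

definition word_multilinear where
  "word_multilinear C M N v \<longleftrightarrow> v [] \<in> carrier N \<and>
    (\<forall>xs\<in>lists (carrier M). \<forall>ys\<in>lists (carrier M). (\<lambda>x. v (xs @ x # ys)) \<in> linear_maps C M N)"

lemma word_multilinearI:
  assumes "v [] \<in> carrier N"
    "\<And>xs ys. xs \<in> lists (carrier M) \<Longrightarrow> ys \<in> lists (carrier M) \<Longrightarrow>
      (\<lambda>x. v (xs @ x # ys)) \<in> linear_maps C M N"
  shows "word_multilinear C M N v"
  using assms by (simp add: word_multilinear_def)

lemma word_multilinear_slot:
  "word_multilinear C M N v \<Longrightarrow> xs \<in> lists (carrier M) \<Longrightarrow> ys \<in> lists (carrier M) \<Longrightarrow>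
    (\<lambda>x. v (xs @ x # ys)) \<in> linear_maps C M N"
  by (simp add: word_multilinear_def)

lemma word_multilinear_closed:
  assumes "word_multilinear C M N v" "xs \<in> lists (carrier M)"
  shows "v xs \<in> carrier N"
proof (cases xs)
  case Nil
  with assms show ?thesis by (simp add: word_multilinear_def)
next
  case (Cons x ys)
  with assms have "x \<in> carrier M" "ys \<in> lists (carrier M)" by auto
  from linear_maps_closed[OF word_multilinear_slot[OF assms(1) _ this(2), of "[]"] this(1)] Cons
  show ?thesis by simp
qed

lemma words_relsI:
  fixes C M
  defines "F \<equiv> free_module C (lists (carrier M))"
  shows "\<lbrakk>xs \<in> lists (carrier M); x \<in> carrier M; y \<in> carrier M; ys \<in> lists (carrier M)\<rbrakk> \<Longrightarrow>
      basis_vec C (xs @ (x \<oplus>\<^bsub>M\<^esub> y) # ys) \<ominus>\<^bsub>F\<^esub>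
      (basis_vec C (xs @ x # ys) \<oplus>\<^bsub>F\<^esub> basis_vec C (xs @ y # ys)) \<in> words_rels C M"
    and "\<lbrakk>c \<in> carrier C; xs \<in> lists (carrier M); x \<in> carrier M; ys \<in> lists (carrier M)\<rbrakk> \<Longrightarrow>
      basis_vec C (xs @ (c \<odot>\<^bsub>M\<^esub> x) # ys) \<ominus>\<^bsub>F\<^esub> (c \<odot>\<^bsub>F\<^esub> basis_vec C (xs @ x # ys)) \<in> words_rels C M"
  unfolding words_rels_def Let_def F_def
  subgoal by (rule UnI1, intro CollectI exI conjI, rule refl)
  subgoal by (rule UnI2, intro CollectI exI conjI, rule refl)
  done

lemma words_rels_subset:
  assumes "module C M"
  shows "words_rels C M \<subseteq> carrier (free_module C (lists (carrier M)))"
proof -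
  interpret M: module C M by fact
  show ?thesis
    unfolding words_rels_def Let_def
    by (intro Un_least subsetI; elim CollectE exE conjE; simp only:; intro free_rel_closed[OF M.R.is_cring])
      auto
qed

lemma
  assumes M: "module C M"
  shows words_module_module: "module C (words_module C M)"
    and word_multilinear: "word_multilinear C M (words_module C M) (word C M)"
    and words_spans: "spans C (words_module C M) (word C M ` lists (carrier M))"
proof -
  interpret M: module C M by fact
  note C = M.R.is_cring
  note R = words_rels_subset[OF M]
  show "module C (words_module C M)"
    unfolding words_module_def by (rule presented_module_module[OF C R])
  have "word C M ` lists (carrier M) =
      presented_gen C (lists (carrier M)) (words_rels C M) ` lists (carrier M)"
    by (rule image_cong) (simp_all add: word_def)
  then show sp: "spans C (words_module C M) (word C M ` lists (carrier M))"
    unfolding words_module_def using presented_spans[OF C R] by (simp only:)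
  have cl: "word C M xs \<in> carrier (words_module C M)" if "xs \<in> lists (carrier M)" for xs
    by (rule spans_subset[OF sp]) (use that in blast)
  show "word_multilinear C M (words_module C M) (word C M)"
  proof (intro word_multilinearI linear_mapsI cl)
    fix xs ys x y assume "xs \<in> lists (carrier M)" "ys \<in> lists (carrier M)" "x \<in> carrier M" "y \<in> carrier M"
    then show "word C M (xs @ (x \<oplus>\<^bsub>M\<^esub> y) # ys) =
        word C M (xs @ x # ys) \<oplus>\<^bsub>words_module C M\<^esub> word C M (xs @ y # ys)"
      unfolding word_def words_module_def
      by (intro presented_rel_add[OF C R] words_relsI) auto
  next
    fix xs ys c x assume "xs \<in> lists (carrier M)" "ys \<in> lists (carrier M)" "c \<in> carrier C" "x \<in> carrier M"
    then show "word C M (xs @ (c \<odot>\<^bsub>M\<^esub> x) # ys) = c \<odot>\<^bsub>words_module C M\<^esub> word C M (xs @ x # ys)"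
      unfolding word_def words_module_def
      by (intro presented_rel_smult[OF C R] words_relsI) auto
  qed auto
qed

lemma words_lift:
  assumes M: "module C M" and P: "module C P" and v: "word_multilinear C M P v"
  shows "\<exists>h\<in>linear_maps C (words_module C M) P. \<forall>xs\<in>lists (carrier M). h (word C M xs) = v xs"
proof -
  interpret M: module C M by fact
  note C = M.R.is_cring
  show ?thesis
    unfolding word_def words_module_def
  proof (rule presented_module_lift[OF C words_rels_subset[OF M] P])
    show "v xs \<in> carrier P" if "xs \<in> lists (carrier M)" for xs
      using word_multilinear_closed[OF v that] .
    fix h a assume h: "h \<in> linear_maps C (free_module C (lists (carrier M))) P"
      "\<And>xs. xs \<in> lists (carrier M) \<Longrightarrow> h (basis_vec C xs) = v xs"
    note ra = free_lift_rel_add[OF C P h(1)] and rs = free_lift_rel_smult[OF C P h(1)]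
    assume "a \<in> words_rels C M"
    then show "h a = \<zero>\<^bsub>P\<^esub>"
      unfolding words_rels_def Let_def
      by (elim UnE CollectE exE conjE; simp only:; intro ra rs)
         (auto simp: h(2) linear_maps_add[OF word_multilinear_slot[OF v]]
            linear_maps_smult[OF word_multilinear_slot[OF v]])
  qed
qed

lemma words_bilinear_extension:
  assumes M: "module C M" and N: "module C N" and P: "module C P"
    and right: "\<And>xs. xs \<in> lists (carrier M) \<Longrightarrow> word_multilinear C N P (v xs)"
    and left: "\<And>ys. ys \<in> lists (carrier N) \<Longrightarrow> word_multilinear C M P (\<lambda>xs. v xs ys)"
  shows "\<exists>B\<in>bilinear_maps C (words_module C M) (words_module C N) P.
    \<forall>xs\<in>lists (carrier M). \<forall>ys\<in>lists (carrier N). B (word C M xs) (word C N ys) = v xs ys"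
  by (rule bilinear_extension[OF words_module_module[OF M] words_spans[OF M]
        words_module_module[OF N] words_spans[OF N] P words_lift[OF N P right] words_lift[OF M P left]])

lemma words_algebra_simps:
  "carrier (words_algebra C M) = carrier (words_module C M)"
  "zero (words_algebra C M) = zero (words_module C M)"
  "add (words_algebra C M) = add (words_module C M)"
  "smult (words_algebra C M) = smult (words_module C M)"
  "one (words_algebra C M) = word C M []"
  by (simp_all add: words_algebra_def Let_def)

lemma
  assumes M: "module C M"
  shows words_algebra_bilinear: "monoid.mult (words_algebra C M) \<in>
      bilinear_maps C (words_module C M) (words_module C M) (words_module C M)"
    and words_algebra_mult: "\<And>xs ys. xs \<in> lists (carrier M) \<Longrightarrow> ys \<in> lists (carrier M) \<Longrightarrow>
      word C M xs \<otimes>\<^bsub>words_algebra C M\<^esub> word C M ys = word C M (xs @ ys)"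
proof -
  let ?T = "words_module C M"
  let ?P = "\<lambda>b. b \<in> bilinear_maps C ?T ?T ?T \<and> (\<forall>xs\<in>lists (carrier M). \<forall>ys\<in>lists (carrier M).
            b (word C M xs) (word C M ys) = word C M (xs @ ys))"
  note sl = word_multilinear_slot[OF word_multilinear[OF M]]
    and cl = word_multilinear_closed[OF word_multilinear[OF M]]
  have "\<exists>B\<in>bilinear_maps C ?T ?T ?T. \<forall>xs\<in>lists (carrier M). \<forall>ys\<in>lists (carrier M).
      B (word C M xs) (word C M ys) = word C M (xs @ ys)"
    by (rule words_bilinear_extension[OF M M words_module_module[OF M]];
        rule word_multilinearI) (auto simp: cl simp flip: append_assoc intro!: sl[simplified], auto intro!: sl)
  then have "\<exists>b. ?P b" by blast
  from someI_ex[OF this] have "?P (SOME b. ?P b)" .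
  moreover have "monoid.mult (words_algebra C M) = (SOME b. ?P b)"
    by (simp add: words_algebra_def Let_def)
  ultimately show "monoid.mult (words_algebra C M) \<in> bilinear_maps C ?T ?T ?T"
    "\<And>xs ys. xs \<in> lists (carrier M) \<Longrightarrow> ys \<in> lists (carrier M) \<Longrightarrow>
      word C M xs \<otimes>\<^bsub>words_algebra C M\<^esub> word C M ys = word C M (xs @ ys)"
    by auto
qed

text \<open>
  The recursion for the shuffle product as a function of words, which is yet to be shown to
  respect the relations between words.
\<close>

fun shuffle_words where
  "shuffle_words C M [] ys = word C M ys"
| "shuffle_words C M (x # xs) [] = word C M (x # xs)"
| "shuffle_words C M (x # xs) (y # ys) =
    word C M [x] \<otimes>\<^bsub>words_algebra C M\<^esub> shuffle_words C M xs (y # ys) \<oplus>\<^bsub>words_module C M\<^esub>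
    word C M [y] \<otimes>\<^bsub>words_algebra C M\<^esub> shuffle_words C M (x # xs) ys"

lemma shuffle_words_Nil: "shuffle_words C M xs [] = word C M xs"
  by (cases xs) auto


lemma shuffle_words_closed:
  "module C M \<Longrightarrow> xs \<in> lists (carrier M) \<Longrightarrow> ys \<in> lists (carrier M) \<Longrightarrow>
    shuffle_words C M xs ys \<in> carrier (words_module C M)"
proof (induction C M xs ys rule: shuffle_words.induct)
  case (3 C M x xs y ys)
  interpret W: module C "words_module C M" by (rule words_module_module[OF 3(3)])
  show ?case
    using 3 by (auto intro!: word_multilinear_closed[OF word_multilinear]
        bilinear_maps_closed[OF words_algebra_bilinear])
qed (auto intro!: word_multilinear_closed[OF word_multilinear])

text \<open>
  By symmetry, multilinearity then has to be shown in one argument only.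
\<close>

lemma shuffle_words_comm:
  "module C M \<Longrightarrow> xs \<in> lists (carrier M) \<Longrightarrow> ys \<in> lists (carrier M) \<Longrightarrow>
    shuffle_words C M xs ys = shuffle_words C M ys xs"
proof (induction C M xs ys rule: shuffle_words.induct)
  case (3 C M x xs y ys)
  interpret W: module C "words_module C M" by (rule words_module_module[OF 3(3)])
  show ?case
    using 3 by (auto intro!: W.M.a_comm word_multilinear_closed[OF word_multilinear]
        bilinear_maps_closed[OF words_algebra_bilinear] shuffle_words_closed)
qed (simp_all add: shuffle_words_Nil)

text \<open>
  The letter in question is either the first one of the left word, where the recursion puts it in
  front of a shuffle, or the recursion makes one of the two words shorter.
\<close>

lemma shuffle_words_multilinear:
  assumes M: "module C M" and zs: "zs \<in> lists (carrier M)"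
  shows "word_multilinear C M (words_module C M) (\<lambda>xs. shuffle_words C M xs zs)"
proof (rule word_multilinearI)
  let ?W = "words_module C M"
  note W = words_module_module[OF M]
  note sl = word_multilinear_slot[OF word_multilinear[OF M]]
    and cl = word_multilinear_closed[OF word_multilinear[OF M]]
  note l = bilinear_maps_left[OF words_algebra_bilinear[OF M]]
    and r = bilinear_maps_right[OF words_algebra_bilinear[OF M]]
  note sc = shuffle_words_closed[OF M]
  show "shuffle_words C M [] zs \<in> carrier ?W" using zs cl by simp
  fix xs ys assume "xs \<in> lists (carrier M)" and ys: "ys \<in> lists (carrier M)"
  with zs show "(\<lambda>x. shuffle_words C M (xs @ x # ys) zs) \<in> linear_maps C M ?W"
  proof (induction zs arbitrary: xs rule: list.induct)
    case Nil
    then show ?case using sl by (simp add: shuffle_words_Nil)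
  next
    case (Cons z zs)
    from Cons.prems have z: "z \<in> carrier M" and zs: "zs \<in> lists (carrier M)" by auto
    note IH = Cons.IH[OF zs _ ys]
    have wz: "word C M [z] \<in> carrier ?W" using z cl by simp
    show ?case using Cons.prems(2)
    proof (induction xs rule: list.induct)
      case Nil
      have "(\<lambda>x. word C M [x] \<otimes>\<^bsub>words_algebra C M\<^esub> shuffle_words C M ys (z # zs)) \<in> linear_maps C M ?W"
        by (rule linear_maps_comp[OF l sl[of "[]" "[]", simplified]]) (use sc ys z zs in auto)
      moreover have "(\<lambda>x. word C M [z] \<otimes>\<^bsub>words_algebra C M\<^esub> shuffle_words C M (x # ys) zs) \<in> linear_maps C M ?W"
        using linear_maps_comp[OF r[OF wz] IH[of "[]"]] by simp
      ultimately show ?case using linear_maps_sum W by fastforce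
    next
      case (Cons x' xs)
      then have x': "x' \<in> carrier M" and xs: "xs \<in> lists (carrier M)" by auto
      then have wx: "word C M [x'] \<in> carrier ?W" using cl by simp
      have "(\<lambda>x. word C M [x'] \<otimes>\<^bsub>words_algebra C M\<^esub> shuffle_words C M (xs @ x # ys) (z # zs)) \<in> linear_maps C M ?W"
        by (rule linear_maps_comp[OF r[OF wx] Cons.IH[OF xs]])
      moreover have "(\<lambda>x. word C M [z] \<otimes>\<^bsub>words_algebra C M\<^esub> shuffle_words C M (x' # xs @ x # ys) zs) \<in> linear_maps C M ?W"
        using linear_maps_comp[OF r[OF wz] IH[of "x' # xs"]] x' xs by simp
      ultimately show ?case using linear_maps_sum W by fastforce
    qed
  qed
qed

lemma shuffle_algebra_simps:
  "carrier (shuffle_algebra C M) = carrier (words_module C M)"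
  "zero (shuffle_algebra C M) = zero (words_module C M)"
  "add (shuffle_algebra C M) = add (words_module C M)"
  "smult (shuffle_algebra C M) = smult (words_module C M)"
  "one (shuffle_algebra C M) = word C M []"
  by (simp_all add: shuffle_algebra_def words_algebra_simps Let_def)

lemma
  assumes M: "module C M"
  shows shuffle_algebra_bilinear: "monoid.mult (shuffle_algebra C M) \<in>
      bilinear_maps C (words_module C M) (words_module C M) (words_module C M)" (is ?bil)
    and shuffle_algebra_mult: "\<And>xs ys. xs \<in> lists (carrier M) \<Longrightarrow> ys \<in> lists (carrier M) \<Longrightarrow>
      word C M xs \<otimes>\<^bsub>shuffle_algebra C M\<^esub> word C M ys = shuffle_words C M xs ys"
proof -
  let ?T = "words_algebra C M" and ?W = "words_module C M" and ?w = "word C M"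
  let ?P = "\<lambda>b. b \<in> bilinear_maps C ?T ?T ?T \<and>
         (\<forall>xs\<in>lists (carrier M).
            b (?w []) (?w xs) = ?w [] \<otimes>\<^bsub>?T\<^esub> ?w xs \<and> b (?w xs) (?w []) = ?w xs \<otimes>\<^bsub>?T\<^esub> ?w []) \<and>
         (\<forall>x\<in>carrier M. \<forall>xs\<in>lists (carrier M). \<forall>y\<in>carrier M. \<forall>ys\<in>lists (carrier M).
            b (?w (x # xs)) (?w (y # ys)) =
              ?w [x] \<otimes>\<^bsub>?T\<^esub> b (?w xs) (?w (y # ys)) \<oplus>\<^bsub>?T\<^esub> ?w [y] \<otimes>\<^bsub>?T\<^esub> b (?w (x # xs)) (?w ys))"
  have bil: "bilinear_maps C ?T ?T ?T = bilinear_maps C ?W ?W ?W"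
    by (rule bilinear_maps_record_cong) (simp_all add: words_algebra_simps)
  have "word_multilinear C M ?W (shuffle_words C M xs)" if "xs \<in> lists (carrier M)" for xs
  proof (rule word_multilinearI)
    show "shuffle_words C M xs [] \<in> carrier ?W" using shuffle_words_closed[OF M that] by simp
    show "(\<lambda>x. shuffle_words C M xs (ys @ x # zs)) \<in> linear_maps C M ?W"
      if "ys \<in> lists (carrier M)" "zs \<in> lists (carrier M)" for ys zs
      by (rule linear_maps_cong[OF word_multilinear_slot[OF shuffle_words_multilinear[OF M \<open>xs \<in> _\<close>] that] M])
         (rule shuffle_words_comm[OF M \<open>xs \<in> _\<close>], use that in auto)
  qed
  then have "\<exists>B\<in>bilinear_maps C ?W ?W ?W. \<forall>xs\<in>lists (carrier M). \<forall>ys\<in>lists (carrier M).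
      B (?w xs) (?w ys) = shuffle_words C M xs ys"
    by (intro words_bilinear_extension[OF M M words_module_module[OF M]]
        shuffle_words_multilinear[OF M])
  then obtain B where B: "B \<in> bilinear_maps C ?W ?W ?W"
    "\<And>xs ys. xs \<in> lists (carrier M) \<Longrightarrow> ys \<in> lists (carrier M) \<Longrightarrow> B (?w xs) (?w ys) = shuffle_words C M xs ys"
    by blast
  have "?P B"
    using B by (auto simp: bil words_algebra_mult[OF M] shuffle_words_Nil words_algebra_simps)
  then have P: "?P (SOME b. ?P b)" by (rule someI[of ?P])
  have eq: "monoid.mult (shuffle_algebra C M) = (SOME b. ?P b)"
    by (simp add: shuffle_algebra_def Let_def)
  note P = P[folded eq]
  from P show ?bil by (simp add: bil)
  fix xs ys assume "xs \<in> lists (carrier M)" "ys \<in> lists (carrier M)"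
  then show "?w xs \<otimes>\<^bsub>shuffle_algebra C M\<^esub> ?w ys = shuffle_words C M xs ys"
  proof (induction xs arbitrary: ys rule: list.induct)
    case Nil
    with P show ?case by (simp add: words_algebra_mult[OF M])
  next
    case (Cons x xs)
    from Cons.prems(2,1) Cons.IH show ?case
    proof (induction ys rule: list.induct)
      case Nil
      with P show ?case by (simp add: words_algebra_mult[OF M])
    next
      case (Cons y ys)
      with P have "?w (x # xs) \<otimes>\<^bsub>shuffle_algebra C M\<^esub> ?w (y # ys) =
         ?w [x] \<otimes>\<^bsub>?T\<^esub> (?w xs \<otimes>\<^bsub>shuffle_algebra C M\<^esub> ?w (y # ys)) \<oplus>\<^bsub>?T\<^esub>
         ?w [y] \<otimes>\<^bsub>?T\<^esub> (?w (x # xs) \<otimes>\<^bsub>shuffle_algebra C M\<^esub> ?w ys)" by simp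
      with Cons show ?case by (simp add: words_algebra_simps)
    qed
  qed
qed

lemma bilinear_maps_comp:
  assumes "B \<in> bilinear_maps C M N P" "h \<in> linear_maps C P Q"
  shows "(\<lambda>x y. h (B x y)) \<in> bilinear_maps C M N Q"
  by (intro bilinear_mapsI linear_maps_comp[OF assms(2)] bilinear_maps_right[OF assms(1)]
      bilinear_maps_left[OF assms(1)])

lemma bilinear_maps_precomp:
  assumes "B \<in> bilinear_maps C M' N' P" "f \<in> linear_maps C M M'" "g \<in> linear_maps C N N'"
  shows "(\<lambda>x y. B (f x) (g y)) \<in> bilinear_maps C M N P"
  by (intro bilinear_mapsI linear_maps_comp[OF bilinear_maps_right[OF assms(1)] assms(3)]
      linear_maps_comp[OF bilinear_maps_left[OF assms(1)] assms(2)]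
      linear_maps_closed[OF assms(2)] linear_maps_closed[OF assms(3)])

lemma bilinear_maps_flip:
  "B \<in> bilinear_maps C M N P \<Longrightarrow> (\<lambda>x y. B y x) \<in> bilinear_maps C N M P"
  unfolding bilinear_maps_def by auto

subsection \<open>The symmetric square\<close>

lemma
  assumes M: "module C M"
  shows sym_square_module: "module C (sym_square C M)"
    and sym_prod_bilinear: "sym_prod C M \<in> bilinear_maps C M M (sym_square C M)"
    and sym_prod_spans: "\<And>A B. spans C M A \<Longrightarrow> spans C M B \<Longrightarrow>
      spans C (sym_square C M) {sym_prod C M x y | x y. x \<in> A \<and> y \<in> B}"
    and sym_square_lift: "\<And>B P. \<lbrakk>module C P; B \<in> bilinear_maps C M M P;
        \<And>x y. x \<in> carrier M \<Longrightarrow> y \<in> carrier M \<Longrightarrow> B x y = B y x\<rbrakk> \<Longrightarrow>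
      \<exists>h\<in>linear_maps C (sym_square C M) P.
        \<forall>x\<in>carrier M. \<forall>y\<in>carrier M. h (sym_prod C M x y) = B x y"
proof -
  let ?T = "tensor_module C M M" and ?S = "sym_square_rels C M"
  note T = tensor_module_module[OF M M] and t = tensor_bilinear[OF M M]
  interpret T: module C ?T by (rule T)
  note tc = bilinear_maps_closed[OF t]
  have sub: "?S \<subseteq> carrier ?T"
    unfolding sym_square_rels_def using tc by auto
  note N = span_submodule[OF T sub]
  have pr: "(\<lambda>x. span C ?T ?S +>\<^bsub>?T\<^esub> x) \<in> linear_maps C ?T (sym_square C M)"
    unfolding sym_square_def Let_def by (rule quot_proj_linear[OF T N])
  have eq: "sym_prod C M = (\<lambda>x y. span C ?T ?S +>\<^bsub>?T\<^esub> tensor C M M x y)"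
    by (intro ext) (simp add: sym_prod_def Let_def)
  show S: "module C (sym_square C M)"
    unfolding sym_square_def Let_def by (rule quot_module_module[OF T N])
  show "sym_prod C M \<in> bilinear_maps C M M (sym_square C M)"
    unfolding eq by (rule bilinear_maps_comp[OF t pr])
  show "spans C (sym_square C M) {sym_prod C M x y | x y. x \<in> A \<and> y \<in> B}"
    if "spans C M A" "spans C M B" for A B
  proof -
    have "{sym_prod C M x y | x y. x \<in> A \<and> y \<in> B} =
        (\<lambda>x. span C ?T ?S +>\<^bsub>?T\<^esub> x) ` {tensor C M M x y | x y. x \<in> A \<and> y \<in> B}"
      unfolding eq by blast
    then show ?thesis
      using spans_image[OF tensor_spans[OF M that(1) M that(2)] T S pr]
      by (simp add: sym_square_def quot_module_carrier Let_def)
  qed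
  fix B and P :: "('a, 'g, 'h) module_scheme"
  assume P: "module C P" and B: "B \<in> bilinear_maps C M M P"
    and sym: "\<And>x y. x \<in> carrier M \<Longrightarrow> y \<in> carrier M \<Longrightarrow> B x y = B y x"
  interpret P: module C P by fact
  from tensor_lift[OF M M P B] obtain h where h: "h \<in> linear_maps C ?T P"
    "\<And>x y. x \<in> carrier M \<Longrightarrow> y \<in> carrier M \<Longrightarrow> h (tensor C M M x y) = B x y" by blast
  have "submodule {\<zero>\<^bsub>P\<^esub>} C P" by (rule module_submoduleI[OF P]) auto
  then have "submodule {x \<in> carrier ?T. h x \<in> {\<zero>\<^bsub>P\<^esub>}} C ?T"
    by (rule submodule_vimage[OF h(1) T P])
  moreover have "?S \<subseteq> {x \<in> carrier ?T. h x \<in> {\<zero>\<^bsub>P\<^esub>}}"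
  proof
    fix z assume z: "z \<in> ?S"
    then obtain x y where xy: "x \<in> carrier M" "y \<in> carrier M"
      "z = tensor C M M x y \<ominus>\<^bsub>?T\<^esub> tensor C M M y x" by (auto simp: sym_square_rels_def)
    then have "h z = B x y \<ominus>\<^bsub>P\<^esub> B x y"
      by (simp add: linear_maps_minus[OF h(1) T P] tc h(2) sym[of y x])
    also have "\<dots> = \<zero>\<^bsub>P\<^esub>"
      using bilinear_maps_closed[OF B xy(1,2)] by (simp add: a_minus_def P.M.r_neg)
    finally show "z \<in> {x \<in> carrier ?T. h x \<in> {\<zero>\<^bsub>P\<^esub>}}" using z sub by blast
  qed
  ultimately have "span C ?T ?S \<subseteq> {x \<in> carrier ?T. h x \<in> {\<zero>\<^bsub>P\<^esub>}}"
    by (rule span_least)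
  then have "h x = \<zero>\<^bsub>P\<^esub>" if "x \<in> span C ?T ?S" for x using that by blast
  from quot_module_lift[OF T N P h(1) this]
  obtain k where "k \<in> linear_maps C (sym_square C M) P"
    "\<forall>u\<in>carrier ?T. k (span C ?T ?S +>\<^bsub>?T\<^esub> u) = h u"
    unfolding sym_square_def Let_def by blast
  then show "\<exists>h\<in>linear_maps C (sym_square C M) P.
        \<forall>x\<in>carrier M. \<forall>y\<in>carrier M. h (sym_prod C M x y) = B x y"
    by (intro bexI[of _ k]) (simp_all add: eq tc h(2))
qed

subsection \<open>Symmetric algebras\<close>

lemma algebra_mult_bilinear:
  assumes "algebra C A"
  shows "monoid.mult A \<in> bilinear_maps C A A A"
proof -
  interpret A: algebra C A by fact
  have "x \<otimes>\<^bsub>A\<^esub> (c \<odot>\<^bsub>A\<^esub> y) = c \<odot>\<^bsub>A\<^esub> (x \<otimes>\<^bsub>A\<^esub> y)"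
    if "c \<in> carrier C" "x \<in> carrier A" "y \<in> carrier A" for c x y
    using that A.smult_assoc2[of c y x] by (simp add: A.m_comm)
  then show ?thesis
    by (intro bilinear_mapsI linear_mapsI) (auto simp: A.l_distr A.r_distr A.smult_assoc2)
qed

definition sym_multilinear where
  "sym_multilinear C M N v \<longleftrightarrow> v {#} \<in> carrier N \<and>
    (\<forall>A\<in>monomials M. (\<lambda>x. v (add_mset x A)) \<in> linear_maps C M N)"

lemma sym_multilinear_slot:
  "sym_multilinear C M N v \<Longrightarrow> A \<in> monomials M \<Longrightarrow> (\<lambda>x. v (add_mset x A)) \<in> linear_maps C M N"
  by (simp add: sym_multilinear_def)

lemma monomials_simps [simp]:
  "{#} \<in> monomials M" "add_mset x A \<in> monomials M \<longleftrightarrow> x \<in> carrier M \<and> A \<in> monomials M"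
  "A + B \<in> monomials M \<longleftrightarrow> A \<in> monomials M \<and> B \<in> monomials M"
  by (auto simp: monomials_def)

lemma sym_multilinear_closed:
  assumes "sym_multilinear C M N v" "A \<in> monomials M"
  shows "v A \<in> carrier N"
proof (cases A)
  case empty
  with assms show ?thesis by (simp add: sym_multilinear_def)
next
  case (add x B)
  with assms show ?thesis
    using linear_maps_closed[OF sym_multilinear_slot[OF assms(1), of B]] by auto
qed

lemma sym_relsI:
  fixes C M
  defines "F \<equiv> free_module C (monomials M)"
  shows "\<lbrakk>x \<in> carrier M; y \<in> carrier M; A \<in> monomials M\<rbrakk> \<Longrightarrow>
      basis_vec C (add_mset (x \<oplus>\<^bsub>M\<^esub> y) A) \<ominus>\<^bsub>F\<^esub>
      (basis_vec C (add_mset x A) \<oplus>\<^bsub>F\<^esub> basis_vec C (add_mset y A)) \<in> sym_rels C M"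
    and "\<lbrakk>c \<in> carrier C; x \<in> carrier M; A \<in> monomials M\<rbrakk> \<Longrightarrow>
      basis_vec C (add_mset (c \<odot>\<^bsub>M\<^esub> x) A) \<ominus>\<^bsub>F\<^esub> (c \<odot>\<^bsub>F\<^esub> basis_vec C (add_mset x A)) \<in> sym_rels C M"
  unfolding sym_rels_def Let_def F_def
  subgoal by (rule UnI1, intro CollectI exI conjI, rule refl)
  subgoal by (rule UnI2, intro CollectI exI conjI, rule refl)
  done

lemma sym_rels_subset:
  assumes "module C M"
  shows "sym_rels C M \<subseteq> carrier (free_module C (monomials M))"
proof -
  interpret M: module C M by fact
  show ?thesis
    unfolding sym_rels_def Let_def
    by (intro Un_least subsetI; elim CollectE exE conjE; simp only:; intro free_rel_closed[OF M.R.is_cring])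
      auto
qed

abbreviation sym_module where
  "sym_module C M \<equiv> presented_module C (monomials M) (sym_rels C M)"

lemma
  assumes M: "module C M"
  shows sym_module_module: "module C (sym_module C M)"
    and sym_monomial_multilinear: "sym_multilinear C M (sym_module C M) (sym_monomial C M)"
    and sym_module_spans: "spans C (sym_module C M) (sym_monomial C M ` monomials M)"
proof -
  interpret M: module C M by fact
  note C = M.R.is_cring
  note R = sym_rels_subset[OF M]
  show "module C (sym_module C M)"
    by (rule presented_module_module[OF C R])
  have "sym_monomial C M ` monomials M =
      presented_gen C (monomials M) (sym_rels C M) ` monomials M"
    by (rule image_cong) (simp_all add: sym_monomial_def)
  then show sp: "spans C (sym_module C M) (sym_monomial C M ` monomials M)"
    using presented_spans[OF C R] by (simp only:)
  have cl: "sym_monomial C M A \<in> carrier (sym_module C M)" if "A \<in> monomials M" for A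
    by (rule spans_subset[OF sp]) (use that in blast)
  have "(\<lambda>x. sym_monomial C M (add_mset x A)) \<in> linear_maps C M (sym_module C M)"
    if A: "A \<in> monomials M" for A
  proof (intro linear_mapsI cl)
    fix x y assume "x \<in> carrier M" "y \<in> carrier M"
    with A show "sym_monomial C M (add_mset (x \<oplus>\<^bsub>M\<^esub> y) A) =
        sym_monomial C M (add_mset x A) \<oplus>\<^bsub>sym_module C M\<^esub> sym_monomial C M (add_mset y A)"
      unfolding sym_monomial_def
      by (intro presented_rel_add[OF C R] sym_relsI) auto
  next
    fix c x assume "c \<in> carrier C" "x \<in> carrier M"
    with A show "sym_monomial C M (add_mset (c \<odot>\<^bsub>M\<^esub> x) A) =
        c \<odot>\<^bsub>sym_module C M\<^esub> sym_monomial C M (add_mset x A)"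
      unfolding sym_monomial_def
      by (intro presented_rel_smult[OF C R] sym_relsI) auto
  qed (use A in auto)
  with cl show "sym_multilinear C M (sym_module C M) (sym_monomial C M)"
    by (simp add: sym_multilinear_def)
qed

lemma sym_module_lift:
  assumes M: "module C M" and P: "module C P" and v: "sym_multilinear C M P v"
  shows "\<exists>h\<in>linear_maps C (sym_module C M) P. \<forall>A\<in>monomials M. h (sym_monomial C M A) = v A"
proof -
  interpret M: module C M by fact
  note C = M.R.is_cring
  show ?thesis
    unfolding sym_monomial_def
  proof (rule presented_module_lift[OF C sym_rels_subset[OF M] P])
    show "v A \<in> carrier P" if "A \<in> monomials M" for A
      using sym_multilinear_closed[OF v that] .
    fix h a assume h: "h \<in> linear_maps C (free_module C (monomials M)) P"
      "\<And>A. A \<in> monomials M \<Longrightarrow> h (basis_vec C A) = v A"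
    note ra = free_lift_rel_add[OF C P h(1)] and rs = free_lift_rel_smult[OF C P h(1)]
    assume "a \<in> sym_rels C M"
    then show "h a = \<zero>\<^bsub>P\<^esub>"
      unfolding sym_rels_def Let_def
      by (elim UnE CollectE exE conjE; simp only:; intro ra rs)
         (auto simp: h(2) linear_maps_add[OF sym_multilinear_slot[OF v]]
            linear_maps_smult[OF sym_multilinear_slot[OF v]])
  qed
qed

lemma sym_algebra_simps:
  "carrier (sym_algebra C M) = carrier (sym_module C M)"
  "zero (sym_algebra C M) = zero (sym_module C M)"
  "add (sym_algebra C M) = add (sym_module C M)"
  "smult (sym_algebra C M) = smult (sym_module C M)"
  "one (sym_algebra C M) = sym_monomial C M {#}"
  by (simp_all add: sym_algebra_def Let_def)

lemma
  assumes M: "module C M"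
  shows sym_algebra_module: "module C (sym_algebra C M)"
    and sym_algebra_bilinear: "monoid.mult (sym_algebra C M) \<in>
      bilinear_maps C (sym_algebra C M) (sym_algebra C M) (sym_algebra C M)"
    and sym_algebra_mult: "\<And>A B. A \<in> monomials M \<Longrightarrow> B \<in> monomials M \<Longrightarrow>
      sym_monomial C M A \<otimes>\<^bsub>sym_algebra C M\<^esub> sym_monomial C M B = sym_monomial C M (A + B)"
    and sym_algebra_spans: "spans C (sym_algebra C M) (sym_monomial C M ` monomials M)"
    and sym_gen_linear: "sym_gen C M \<in> linear_maps C M (sym_algebra C M)"
proof -
  let ?T = "sym_module C M" and ?m = "sym_monomial C M"
  let ?P = "\<lambda>b. b \<in> bilinear_maps C ?T ?T ?T \<and> (\<forall>A\<in>monomials M. \<forall>B\<in>monomials M.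
            b (?m A) (?m B) = ?m (A + B))"
  note T = sym_module_module[OF M] and sp = sym_module_spans[OF M]
  note sl = sym_multilinear_slot[OF sym_monomial_multilinear[OF M]]
    and cl = sym_multilinear_closed[OF sym_monomial_multilinear[OF M]]
  have ml: "sym_multilinear C M ?T (\<lambda>B. ?m (A + B))" if "A \<in> monomials M" for A
    using that sl[of "A + _"] cl by (auto simp: sym_multilinear_def)
  have ml': "sym_multilinear C M ?T (\<lambda>A. ?m (A + B))" if "B \<in> monomials M" for B
    using ml[OF that] by (simp add: add.commute)
  have "\<exists>b\<in>bilinear_maps C ?T ?T ?T. \<forall>A\<in>monomials M. \<forall>B\<in>monomials M. b (?m A) (?m B) = ?m (A + B)"
    by (rule bilinear_extension[OF T sp T sp T sym_module_lift[OF M T ml] sym_module_lift[OF M T ml']])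
  then have "\<exists>b. ?P b" by blast
  from someI_ex[OF this] have P: "?P (SOME b. ?P b)" .
  have eq: "monoid.mult (sym_algebra C M) = (SOME b. ?P b)"
    by (simp add: sym_algebra_def Let_def)
  show "module C (sym_algebra C M)"
    using T by (subst module_cong[of _ ?T]) (simp_all add: sym_algebra_simps)
  have "bilinear_maps C (sym_algebra C M) (sym_algebra C M) (sym_algebra C M) = bilinear_maps C ?T ?T ?T"
    by (rule bilinear_maps_record_cong) (simp_all add: sym_algebra_simps)
  with P show "monoid.mult (sym_algebra C M) \<in>
      bilinear_maps C (sym_algebra C M) (sym_algebra C M) (sym_algebra C M)"
    by (simp add: eq)
  show "?m A \<otimes>\<^bsub>sym_algebra C M\<^esub> ?m B = ?m (A + B)"
    if "A \<in> monomials M" "B \<in> monomials M" for A B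
    using P that by (simp add: eq)
  show "spans C (sym_algebra C M) (sym_monomial C M ` monomials M)"
    using sp by (subst spans_record_cong(1)[of _ ?T]) (simp_all add: sym_algebra_simps)
  have "sym_gen C M \<in> linear_maps C M ?T"
    using sl[of "{#}"] by (simp add: sym_gen_def[abs_def])
  moreover have "linear_maps C M (sym_algebra C M) = linear_maps C M ?T"
    by (rule linear_maps_record_cong) (simp_all add: sym_algebra_simps)
  ultimately show "sym_gen C M \<in> linear_maps C M (sym_algebra C M)" by simp
qed

text \<open>
  Associativity, commutativity and the unit law are equations between multilinear maps, so they
  need to be checked on a spanning set only.
\<close>

lemma commutative_algebraI:
  assumes A: "module C A" and bil: "monoid.mult A \<in> bilinear_maps C A A A"
    and one: "\<one>\<^bsub>A\<^esub> \<in> carrier A" and sp: "spans C A G"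
    and assoc: "\<And>x y z. x \<in> G \<Longrightarrow> y \<in> G \<Longrightarrow> z \<in> G \<Longrightarrow> (x \<otimes>\<^bsub>A\<^esub> y) \<otimes>\<^bsub>A\<^esub> z = x \<otimes>\<^bsub>A\<^esub> (y \<otimes>\<^bsub>A\<^esub> z)"
    and comm: "\<And>x y. x \<in> G \<Longrightarrow> y \<in> G \<Longrightarrow> x \<otimes>\<^bsub>A\<^esub> y = y \<otimes>\<^bsub>A\<^esub> x"
    and l_one: "\<And>x. x \<in> G \<Longrightarrow> \<one>\<^bsub>A\<^esub> \<otimes>\<^bsub>A\<^esub> x = x"
  shows "algebra C A"
proof -
  interpret A: module C A by fact
  note cl = bilinear_maps_closed[OF bil]
  have comm': "x \<otimes>\<^bsub>A\<^esub> y = y \<otimes>\<^bsub>A\<^esub> x" if "x \<in> carrier A" "y \<in> carrier A" for x y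
    by (rule bilinear_maps_eq_on_spans[OF sp sp A A A bil bilinear_maps_flip[OF bil] comm that])
  have l_one': "\<one>\<^bsub>A\<^esub> \<otimes>\<^bsub>A\<^esub> x = x" if "x \<in> carrier A" for x
    by (rule linear_maps_eq_on_spans[OF sp A A bilinear_maps_right[OF bil one] linear_maps_id l_one that])
  note l = bilinear_maps_left[OF bil] and r = bilinear_maps_right[OF bil]
  have assoc1: "(x \<otimes>\<^bsub>A\<^esub> y) \<otimes>\<^bsub>A\<^esub> z = x \<otimes>\<^bsub>A\<^esub> (y \<otimes>\<^bsub>A\<^esub> z)"
    if "x \<in> G" "y \<in> carrier A" "z \<in> carrier A" for x y z
  proof -
    have x: "x \<in> carrier A" by (rule spans_subset[OF sp that(1)])
    show ?thesis
      by (rule bilinear_maps_eq_on_spans[OF sp sp A A A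
            bilinear_maps_precomp[OF bil r[OF x] linear_maps_id]
            bilinear_maps_comp[OF bil r[OF x]] assoc[OF that(1)] that(2,3)])
  qed
  have assoc': "(x \<otimes>\<^bsub>A\<^esub> y) \<otimes>\<^bsub>A\<^esub> z = x \<otimes>\<^bsub>A\<^esub> (y \<otimes>\<^bsub>A\<^esub> z)"
    if "x \<in> carrier A" "y \<in> carrier A" "z \<in> carrier A" for x y z
    by (rule linear_maps_eq_on_spans[OF sp A A linear_maps_comp[OF l[OF that(3)] l[OF that(2)]]
          l[OF cl[OF that(2,3)]] _ that(1)])
       (use assoc1 that in auto)
  have "cring A"
    by (intro cringI A.abelian_group_axioms comm_monoidI)
       (use cl one assoc' l_one' comm' linear_maps_add[OF l] in auto)
  then show ?thesis
    by (intro algebraI A.R.is_cring)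
       (auto simp: A.smult_l_distr A.smult_r_distr A.smult_assoc1 linear_maps_smult[OF l])
qed

lemma sym_algebra_algebra:
  assumes M: "module C M"
  shows "algebra C (sym_algebra C M)"
proof (rule commutative_algebraI[OF sym_algebra_module[OF M] sym_algebra_bilinear[OF M] _ sym_algebra_spans[OF M]])
  show "\<one>\<^bsub>sym_algebra C M\<^esub> \<in> carrier (sym_algebra C M)"
    using sym_multilinear_closed[OF sym_monomial_multilinear[OF M]] by (simp add: sym_algebra_simps)
qed (auto simp: sym_algebra_mult[OF M] ac_simps sym_algebra_simps(5))

lemma sym_monomial_add_mset:
  assumes "module C M" "x \<in> carrier M" "A \<in> monomials M"
  shows "sym_monomial C M (add_mset x A) = sym_gen C M x \<otimes>\<^bsub>sym_algebra C M\<^esub> sym_monomial C M A"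
  using assms by (simp add: sym_gen_def sym_algebra_mult)

text \<open>
  Every monomial arises from \<open>1\<close> by multiplication with elements of the module, and the
  monomials span.
\<close>

lemma sym_algebra_into_submodule:
  assumes M: "module C M" and h: "h \<in> linear_maps C (sym_algebra C M) N"
    and N: "module C N" "submodule H C N"
    and one: "h \<one>\<^bsub>sym_algebra C M\<^esub> \<in> H"
    and step: "\<And>x p. x \<in> carrier M \<Longrightarrow> p \<in> carrier (sym_algebra C M) \<Longrightarrow> h p \<in> H \<Longrightarrow>
      h (sym_gen C M x \<otimes>\<^bsub>sym_algebra C M\<^esub> p) \<in> H"
    and p: "p \<in> carrier (sym_algebra C M)"
  shows "h p \<in> H"
proof (rule linear_maps_into_submodule[OF sym_algebra_spans[OF M] h sym_algebra_module[OF M] N _ p])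
  fix q assume "q \<in> sym_monomial C M ` monomials M"
  then obtain A where A: "A \<in> monomials M" and q: "q = sym_monomial C M A" by blast
  have "h (sym_monomial C M A) \<in> H" using A
  proof (induction A)
    case empty
    then show ?case using one by (simp add: sym_algebra_simps)
  next
    case (add x A)
    moreover have "sym_monomial C M A \<in> carrier (sym_algebra C M)"
      by (rule spans_subset[OF sym_algebra_spans[OF M]]) (use add.prems in simp)
    ultimately show ?case using step by (simp add: sym_monomial_add_mset[OF M])
  qed
  then show "h q \<in> H" by (simp only: q)
qed

text \<open>
  A monomial is sent to the product of the images of its factors.
\<close>

lemma sym_algebra_lift:
  assumes M: "module C M" and S: "algebra C S" and l: "l \<in> linear_maps C M S"
  shows "\<exists>h\<in>linear_maps C (sym_algebra C M) S. h \<in> ring_hom (sym_algebra C M) S \<and>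
    (\<forall>x\<in>carrier M. h (sym_gen C M x) = l x)"
proof -
  interpret M: module C M by fact
  interpret S: algebra C S by fact
  let ?A = "sym_algebra C M"
  interpret A: algebra C ?A by (rule sym_algebra_algebra[OF M])
  note lc = linear_maps_closed[OF l]
  \<comment> \<open>Outside the carrier \<open>g\<close> does nothing; so it commutes with itself for all arguments, as is
      required for folding over a multiset.\<close>
  define g where "g a s = (if l a \<in> carrier S \<and> s \<in> carrier S then l a \<otimes>\<^bsub>S\<^esub> s else s)" for a s
  interpret g: comp_fun_commute g
    by unfold_locales (auto simp: g_def fun_eq_iff S.m_lcomm)
  define v where "v A = fold_mset g \<one>\<^bsub>S\<^esub> A" for A
  have v_empty: "v {#} = \<one>\<^bsub>S\<^esub>" by (simp add: v_def)
  have vc: "v A \<in> carrier S" for A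
    by (induction A) (auto simp: v_def g_def)
  have v_add: "v (add_mset x A) = l x \<otimes>\<^bsub>S\<^esub> v A" if "x \<in> carrier M" for x A
    using vc[of A] lc[OF that] by (simp add: v_def g_def)
  have v_plus: "v (A + B) = v A \<otimes>\<^bsub>S\<^esub> v B" if "A \<in> monomials M" for A B
    using that by (induction A) (auto simp: v_empty v_add vc lc S.m_assoc)
  have "sym_multilinear C M S v"
    unfolding sym_multilinear_def
    using vc linear_maps_cong[OF linear_maps_comp[OF bilinear_maps_left[OF algebra_mult_bilinear[OF S] vc] l] M v_add]
    by blast
  from sym_module_lift[OF M S.module_axioms this] obtain h where
    h: "h \<in> linear_maps C (sym_module C M) S" "\<And>A. A \<in> monomials M \<Longrightarrow> h (sym_monomial C M A) = v A"
    by blast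
  have "linear_maps C ?A S = linear_maps C (sym_module C M) S"
    by (rule linear_maps_record_cong) (simp_all add: sym_algebra_simps)
  with h(1) have hl: "h \<in> linear_maps C ?A S" by simp
  have mult: "h (p \<otimes>\<^bsub>?A\<^esub> q) = h p \<otimes>\<^bsub>S\<^esub> h q" if "p \<in> carrier ?A" "q \<in> carrier ?A" for p q
    by (rule bilinear_maps_eq_on_spans[OF sym_algebra_spans[OF M] sym_algebra_spans[OF M]
          A.module_axioms A.module_axioms S.module_axioms
          bilinear_maps_comp[OF sym_algebra_bilinear[OF M] hl]
          bilinear_maps_precomp[OF algebra_mult_bilinear[OF S] hl hl] _ that])
       (auto simp: sym_algebra_mult[OF M] h(2) v_plus)
  have "h \<in> ring_hom ?A S"
    by (rule ring_hom_memI)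
       (auto simp: mult linear_maps_closed[OF hl] linear_maps_add[OF hl] sym_algebra_simps(5) h(2) v_empty)
  moreover have "h (sym_gen C M x) = l x" if "x \<in> carrier M" for x
    using that by (simp add: sym_gen_def h(2) v_add v_empty lc)
  ultimately show ?thesis using hl by blast
qed

subsection \<open>Quotients of algebras\<close>

lemma
  assumes A: "algebra C A" and J: "ideal J A"
  shows ideal_submodule: "submodule J C A"
    and quot_algebra_mult: "\<And>x y. x \<in> carrier A \<Longrightarrow> y \<in> carrier A \<Longrightarrow>
      (J +>\<^bsub>A\<^esub> x) \<otimes>\<^bsub>quot_module A J\<^esub> (J +>\<^bsub>A\<^esub> y) = J +>\<^bsub>A\<^esub> (x \<otimes>\<^bsub>A\<^esub> y)"
    and quot_algebra_algebra: "algebra C (quot_module A J)"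
proof -
  interpret A: algebra C A by fact
  interpret J: ideal J A by fact
  show sub: "submodule J C A"
  proof (rule module_submoduleI[OF A.module_axioms])
    fix c x assume c: "c \<in> carrier C" and x: "x \<in> J"
    have "c \<odot>\<^bsub>A\<^esub> x = (c \<odot>\<^bsub>A\<^esub> \<one>\<^bsub>A\<^esub>) \<otimes>\<^bsub>A\<^esub> x"
      using c J.a_Hcarr[OF x] by (simp add: A.smult_assoc2)
    then show "c \<odot>\<^bsub>A\<^esub> x \<in> J" using c x by (simp add: J.I_l_closed)
  qed (auto intro: J.a_Hcarr)
  show mult: "(J +>\<^bsub>A\<^esub> x) \<otimes>\<^bsub>quot_module A J\<^esub> (J +>\<^bsub>A\<^esub> y) = J +>\<^bsub>A\<^esub> (x \<otimes>\<^bsub>A\<^esub> y)"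
    if "x \<in> carrier A" "y \<in> carrier A" for x y
    using J.rcoset_mult_add[OF that] by (simp add: quot_module_simps)
  note pr = quot_proj_linear[OF A.module_axioms sub]
  interpret Q: module C "quot_module A J" by (rule quot_module_module[OF A.module_axioms sub])
  note [simp] = linear_maps_add[OF pr, symmetric] linear_maps_smult[OF pr, symmetric]
  have cr: "cring (quot_module A J)"
    by (intro cringI Q.abelian_group_axioms comm_monoidI)
       (auto simp: quot_module_carrier mult quot_module_simps(6) A.m_ac A.l_distr A.r_distr)
  show "algebra C (quot_module A J)"
    by (intro algebraI A.R.is_cring cr)
       (auto simp: Q.smult_l_distr Q.smult_r_distr Q.smult_assoc1 simp del: linear_maps_add,
        auto simp: quot_module_carrier mult A.smult_assoc2)
qed

subsection \<open>Tensor products of algebras\<close>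

lemma tensor_algebra_simps:
  "carrier (tensor_algebra_product C A B) = carrier (tensor_module C A B)"
  "zero (tensor_algebra_product C A B) = zero (tensor_module C A B)"
  "add (tensor_algebra_product C A B) = add (tensor_module C A B)"
  "smult (tensor_algebra_product C A B) = smult (tensor_module C A B)"
  "one (tensor_algebra_product C A B) = tensor C A B \<one>\<^bsub>A\<^esub> \<one>\<^bsub>B\<^esub>"
  by (simp_all add: tensor_algebra_product_def Let_def)

text \<open>
  For a fixed tensor \<open>x \<otimes> y\<close> on one side, the formula for the product is bilinear in the two factors
  on the other side; \<open>bilinear_extension\<close> combines both.
\<close>

lemma
  assumes A: "module C A" "monoid.mult A \<in> bilinear_maps C A A A"
    and B: "module C B" "monoid.mult B \<in> bilinear_maps C B B B"
  shows tensor_algebra_module: "module C (tensor_algebra_product C A B)"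
    and tensor_algebra_bilinear: "monoid.mult (tensor_algebra_product C A B) \<in>
      bilinear_maps C (tensor_algebra_product C A B) (tensor_algebra_product C A B) (tensor_algebra_product C A B)"
    and tensor_algebra_mult: "\<And>x x' y y'. \<lbrakk>x \<in> carrier A; x' \<in> carrier A; y \<in> carrier B; y' \<in> carrier B\<rbrakk> \<Longrightarrow>
      tensor C A B x y \<otimes>\<^bsub>tensor_algebra_product C A B\<^esub> tensor C A B x' y' =
        tensor C A B (x \<otimes>\<^bsub>A\<^esub> x') (y \<otimes>\<^bsub>B\<^esub> y')"
    and tensor_algebra_tensor: "tensor C A B \<in> bilinear_maps C A B (tensor_algebra_product C A B)"
    and tensor_algebra_lift: "\<And>P b. module C P \<Longrightarrow> b \<in> bilinear_maps C A B P \<Longrightarrow>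
      \<exists>h\<in>linear_maps C (tensor_algebra_product C A B) P.
        \<forall>x\<in>carrier A. \<forall>y\<in>carrier B. h (tensor C A B x y) = b x y"
    and tensor_algebra_spans: "\<And>X Y. spans C A X \<Longrightarrow> spans C B Y \<Longrightarrow>
      spans C (tensor_algebra_product C A B) {tensor C A B x y | x y. x \<in> X \<and> y \<in> Y}"
proof -
  let ?T = "tensor_module C A B" and ?t = "tensor C A B" and ?G = "carrier A \<times> carrier B"
    and ?AB = "tensor_algebra_product C A B"
  let ?P = "\<lambda>b. b \<in> bilinear_maps C ?T ?T ?T \<and>
         (\<forall>x\<in>carrier A. \<forall>x'\<in>carrier A. \<forall>y\<in>carrier B. \<forall>y'\<in>carrier B.
            b (?t x y) (?t x' y') = ?t (x \<otimes>\<^bsub>A\<^esub> x') (y \<otimes>\<^bsub>B\<^esub> y'))"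
  note T = tensor_module_module[OF A(1) B(1)] and t = tensor_bilinear[OF A(1) B(1)]
  have "{?t x y | x y. x \<in> carrier A \<and> y \<in> carrier B} = case_prod ?t ` ?G" by auto
  then have sp: "spans C ?T (case_prod ?t ` ?G)" using tensor_spans'[OF A(1) B(1)] by simp
  have right: "\<exists>k\<in>linear_maps C ?T ?T. \<forall>q\<in>?G. k (case_prod ?t q) =
      ?t (fst p \<otimes>\<^bsub>A\<^esub> fst q) (snd p \<otimes>\<^bsub>B\<^esub> snd q)" if "p \<in> ?G" for p
  proof -
    from that have p: "fst p \<in> carrier A" "snd p \<in> carrier B" by auto
    from tensor_lift[OF A(1) B(1) T bilinear_maps_precomp[OF t bilinear_maps_right[OF A(2) p(1)]
          bilinear_maps_right[OF B(2) p(2)]]]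
    obtain k where "k \<in> linear_maps C ?T ?T" "\<forall>x\<in>carrier A. \<forall>y\<in>carrier B. k (?t x y) =
      ?t (fst p \<otimes>\<^bsub>A\<^esub> x) (snd p \<otimes>\<^bsub>B\<^esub> y)" by blast
    then show ?thesis by (intro bexI[of _ k]) auto
  qed
  have left: "\<exists>k\<in>linear_maps C ?T ?T. \<forall>p\<in>?G. k (case_prod ?t p) =
      ?t (fst p \<otimes>\<^bsub>A\<^esub> fst q) (snd p \<otimes>\<^bsub>B\<^esub> snd q)" if "q \<in> ?G" for q
  proof -
    from that have p: "fst q \<in> carrier A" "snd q \<in> carrier B" by auto
    from tensor_lift[OF A(1) B(1) T bilinear_maps_precomp[OF t bilinear_maps_left[OF A(2) p(1)]
          bilinear_maps_left[OF B(2) p(2)]]]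
    obtain k where "k \<in> linear_maps C ?T ?T" "\<forall>x\<in>carrier A. \<forall>y\<in>carrier B. k (?t x y) =
      ?t (x \<otimes>\<^bsub>A\<^esub> fst q) (y \<otimes>\<^bsub>B\<^esub> snd q)" by blast
    then show ?thesis by (intro bexI[of _ k]) auto
  qed
  from bilinear_extension[OF T sp T sp T right left]
  obtain b where "b \<in> bilinear_maps C ?T ?T ?T" "\<forall>p\<in>?G. \<forall>q\<in>?G. b (case_prod ?t p) (case_prod ?t q) =
      ?t (fst p \<otimes>\<^bsub>A\<^esub> fst q) (snd p \<otimes>\<^bsub>B\<^esub> snd q)" by blast
  then have "?P b" by simp
  then have P: "?P (SOME b. ?P b)" by (rule someI[of ?P])
  have eq: "monoid.mult ?AB = (SOME b. ?P b)"
    by (simp add: tensor_algebra_product_def Let_def)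
  note P = P[folded eq]
  show "module C ?AB"
    using T by (subst module_cong[of _ ?T]) (simp_all add: tensor_algebra_simps)
  have "bilinear_maps C ?AB ?AB ?AB = bilinear_maps C ?T ?T ?T"
    by (rule bilinear_maps_record_cong) (simp_all add: tensor_algebra_simps)
  with P show "monoid.mult ?AB \<in> bilinear_maps C ?AB ?AB ?AB" by simp
  show "?t x y \<otimes>\<^bsub>?AB\<^esub> ?t x' y' = ?t (x \<otimes>\<^bsub>A\<^esub> x') (y \<otimes>\<^bsub>B\<^esub> y')"
    if "x \<in> carrier A" "x' \<in> carrier A" "y \<in> carrier B" "y' \<in> carrier B" for x x' y y'
    using P that by simp
  have "bilinear_maps C A B ?AB = bilinear_maps C A B ?T"
    by (rule bilinear_maps_record_cong) (simp_all add: tensor_algebra_simps)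
  with t show "?t \<in> bilinear_maps C A B ?AB" by simp
  show "\<exists>h\<in>linear_maps C ?AB P. \<forall>x\<in>carrier A. \<forall>y\<in>carrier B. h (?t x y) = b x y"
    if "module C P" "b \<in> bilinear_maps C A B P" for b and P :: "('a, 'i, 'j) module_scheme"
    using tensor_lift[OF A(1) B(1) that] linear_maps_record_cong[of ?AB ?T P P C]
    by (simp add: tensor_algebra_simps)
  show "spans C ?AB {?t x y | x y. x \<in> X \<and> y \<in> Y}" if "spans C A X" "spans C B Y" for X Y
    using tensor_spans[OF A(1) that(1) B(1) that(2)]
    by (subst spans_record_cong(1)[of _ ?T]) (simp_all add: tensor_algebra_simps)
qed

lemma tensor_algebra_hom:
  assumes A: "module C A" "monoid.mult A \<in> bilinear_maps C A A A" "\<one>\<^bsub>A\<^esub> \<in> carrier A"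
    and B: "module C B" "monoid.mult B \<in> bilinear_maps C B B B" "\<one>\<^bsub>B\<^esub> \<in> carrier B"
    and S: "algebra C S"
    and f: "f \<in> linear_maps C A S" "f \<in> ring_hom A S"
    and g: "g \<in> linear_maps C B S" "g \<in> ring_hom B S"
  shows "\<exists>h\<in>linear_maps C (tensor_algebra_product C A B) S. h \<in> ring_hom (tensor_algebra_product C A B) S \<and>
    (\<forall>x\<in>carrier A. \<forall>y\<in>carrier B. h (tensor C A B x y) = f x \<otimes>\<^bsub>S\<^esub> g y)"
proof -
  interpret S: algebra C S by fact
  let ?AB = "tensor_algebra_product C A B"
  note AB = tensor_algebra_module[OF A(1,2) B(1,2)]
  note bil = tensor_algebra_bilinear[OF A(1,2) B(1,2)]
  note sp = tensor_algebra_spans[OF A(1,2) B(1,2) spans_carrier spans_carrier]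
  note Sb = algebra_mult_bilinear[OF S]
  from tensor_algebra_lift[OF A(1,2) B(1,2) S.module_axioms bilinear_maps_precomp[OF Sb f(1) g(1)]]
  obtain h where h: "h \<in> linear_maps C ?AB S"
    "\<And>x y. x \<in> carrier A \<Longrightarrow> y \<in> carrier B \<Longrightarrow> h (tensor C A B x y) = f x \<otimes>\<^bsub>S\<^esub> g y" by blast
  note fc = linear_maps_closed[OF f(1)] and gc = linear_maps_closed[OF g(1)]
  have mult: "h (p \<otimes>\<^bsub>?AB\<^esub> q) = h p \<otimes>\<^bsub>S\<^esub> h q" if "p \<in> carrier ?AB" "q \<in> carrier ?AB" for p q
  proof (rule bilinear_maps_eq_on_spans[OF sp sp AB AB S.module_axioms bilinear_maps_comp[OF bil h(1)]
          bilinear_maps_precomp[OF Sb h(1) h(1)] _ that])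
    fix a b assume "a \<in> {tensor C A B x y |x y. x \<in> carrier A \<and> y \<in> carrier B}"
      "b \<in> {tensor C A B x y |x y. x \<in> carrier A \<and> y \<in> carrier B}"
    then obtain x y x' y' where "a = tensor C A B x y" "b = tensor C A B x' y'"
      and xy: "x \<in> carrier A" "y \<in> carrier B" "x' \<in> carrier A" "y' \<in> carrier B" by blast
    then show "h (a \<otimes>\<^bsub>?AB\<^esub> b) = h a \<otimes>\<^bsub>S\<^esub> h b"
      by (simp add: tensor_algebra_mult[OF A(1,2) B(1,2)] h(2) bilinear_maps_closed[OF A(2)]
          bilinear_maps_closed[OF B(2)] ring_hom_mult[OF f(2)] ring_hom_mult[OF g(2)] fc gc S.m_ac)
  qed
  have "h \<in> ring_hom ?AB S"
    by (rule ring_hom_memI)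
       (auto simp: mult linear_maps_closed[OF h(1)] linear_maps_add[OF h(1)] tensor_algebra_simps(5)
          h(2) A(3) B(3) ring_hom_one[OF f(2)] ring_hom_one[OF g(2)])
  with h show ?thesis by blast
qed

lemma tensor_family_spans:
  assumes M: "module C M" and N: "module C N" "spans C N (g ` G)"
  shows "spans C (tensor_module C M N) ((\<lambda>(x, i). tensor C M N x (g i)) ` (carrier M \<times> G))"
proof -
  have "(\<lambda>(x, i). tensor C M N x (g i)) ` (carrier M \<times> G) =
      {tensor C M N x y | x y. x \<in> carrier M \<and> y \<in> g ` G}" by auto
  then show ?thesis using tensor_spans[OF M spans_carrier N] by simp
qed

text \<open>
  When the right factor is itself a tensor product, \<open>g\<close> runs through its pure tensors.  Iteration
  describes the linear maps out of a product of several factors.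
\<close>

lemma tensor_family_lift:
  assumes M: "module C M" and N: "module C N" "spans C N (g ` G)" and P: "module C P"
    and right: "\<And>x. x \<in> carrier M \<Longrightarrow> \<exists>k\<in>linear_maps C N P. \<forall>i\<in>G. k (g i) = v x i"
    and left: "\<And>i. i \<in> G \<Longrightarrow> (\<lambda>x. v x i) \<in> linear_maps C M P"
  shows "\<exists>h\<in>linear_maps C (tensor_module C M N) P. \<forall>x\<in>carrier M. \<forall>i\<in>G. h (tensor C M N x (g i)) = v x i"
proof -
  have sp: "spans C M ((\<lambda>x. x) ` carrier M)" using spans_carrier by simp
  have "\<exists>B\<in>bilinear_maps C M N P. \<forall>x\<in>carrier M. \<forall>i\<in>G. B x (g i) = v x i"
  proof (rule bilinear_extension[OF M sp N P right])
    fix i assume "i \<in> G"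
    from left[OF this] show "\<exists>h\<in>linear_maps C M P. \<forall>x\<in>carrier M. h x = v x i"
      by (rule rev_bexI) simp
  qed
  then obtain B where B: "B \<in> bilinear_maps C M N P"
    "\<And>x i. x \<in> carrier M \<Longrightarrow> i \<in> G \<Longrightarrow> B x (g i) = v x i" by blast
  from tensor_lift[OF M N(1) P B(1)] obtain h where h: "h \<in> linear_maps C (tensor_module C M N) P"
    "\<And>x y. x \<in> carrier M \<Longrightarrow> y \<in> carrier N \<Longrightarrow> h (tensor C M N x y) = B x y" by blast
  have "g i \<in> carrier N" if "i \<in> G" for i
    using spans_subset[OF N(2)] that by blast
  then show ?thesis using h B(2) by (intro bexI[of _ h]) auto
qed

lemma algebra_module: "algebra C A \<Longrightarrow> module C A"
  by (simp add: algebra_def)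

section \<open>The free integro-differential ring\<close>

context diff_cring
begin

lemma constantsD: "c \<in> constants R der \<Longrightarrow> c \<in> carrier R" "c \<in> constants R der \<Longrightarrow> der c = \<zero>"
  by (simp_all add: constants_def)

lemma der_zero: "der \<zero> = \<zero>"
proof -
  have "der \<zero> = der \<zero> \<oplus> der \<zero>" using der_add[of \<zero> \<zero>] by simp
  then show ?thesis using der_closed[of \<zero>] by (metis add.l_cancel_one zero_closed)
qed

lemma der_one: "der \<one> = \<zero>"
proof -
  have "der \<one> = der \<one> \<oplus> der \<one>" using der_mult[of \<one> \<one>] der_closed[of \<one>] by simp
  then show ?thesis using der_closed[of \<one>] by (metis add.l_cancel_one one_closed)
qed

lemma der_uminus: "x \<in> carrier R \<Longrightarrow> der (\<ominus> x) = \<ominus> der x"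
proof -
  assume x: "x \<in> carrier R"
  then have "der (\<ominus> x) \<oplus> der x = \<zero>"
    using der_add[of "\<ominus> x" x] by (simp add: l_neg der_zero)
  then show ?thesis using x der_closed minus_equality by (metis a_inv_closed)
qed

lemma constants_closed:
  "\<zero> \<in> constants R der" "\<one> \<in> constants R der"
  "\<lbrakk>a \<in> constants R der; b \<in> constants R der\<rbrakk> \<Longrightarrow> a \<oplus> b \<in> constants R der"
  "\<lbrakk>a \<in> constants R der; b \<in> constants R der\<rbrakk> \<Longrightarrow> a \<otimes> b \<in> constants R der"
  "a \<in> constants R der \<Longrightarrow> \<ominus> a \<in> constants R der"
  by (auto simp: constants_def der_zero der_one der_add der_mult der_uminus)

end

context quasi_integro_diff_cring
begin

subsection \<open>The base ring and its modules\<close>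

lemma C_simps [simp]:
  "carrier C = constants R der" "monoid.mult C = monoid.mult R" "one C = \<one>" "zero C = \<zero>"
  "add C = add R"
  by (simp_all add: C_def)

lemma C_cring: "cring C"
proof (rule cringI)
  show "abelian_group C"
  proof (rule abelian_groupI)
    fix x assume "x \<in> carrier C"
    then show "\<exists>y\<in>carrier C. y \<oplus>\<^bsub>C\<^esub> x = \<zero>\<^bsub>C\<^esub>"
      by (intro bexI[of _ "\<ominus> x"]) (auto simp: constants_closed constantsD l_neg)
  qed (auto simp: constants_closed constantsD a_ac)
  show "comm_monoid C"
    by (rule comm_monoidI) (auto simp: constants_closed constantsD m_ac)
qed (auto simp: constantsD l_distr)

lemma R_alg_simps [simp]:
  "carrier R_alg = carrier R" "monoid.mult R_alg = monoid.mult R" "one R_alg = \<one>" "zero R_alg = \<zero>"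
  "add R_alg = add R" "smult R_alg = monoid.mult R"
  by (simp_all add: R_alg_def)

lemma R_alg_algebra: "algebra C R_alg"
proof (rule algebraI[OF C_cring])
  show "cring R_alg" by (rule cring_record_cong[OF is_cring]) simp_all
qed (auto simp: constantsD l_distr r_distr m_assoc)

lemma R_alg_module: "module C R_alg"
  by (rule algebra_module[OF R_alg_algebra])

lemma R_bilinear: "monoid.mult R_alg \<in> bilinear_maps C R_alg R_alg R_alg"
  by (rule algebra_mult_bilinear[OF R_alg_algebra])

lemma der_linear: "der \<in> linear_maps C R_alg R_alg"
  by (rule linear_mapsI) (auto simp: der_closed der_add der_mult constantsD)

lemma Q_linear: "Q \<in> linear_maps C R_alg R_alg"
  by (rule linear_mapsI) (auto simp: Q_closed Q_add Q_const)

lemma RJ_simps [simp]: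
  "carrier RJ = Q ` carrier R" "zero RJ = \<zero>" "add RJ = add R" "smult RJ = monoid.mult R"
  by (simp_all add: RJ_def)

lemma RT_carrier: "x \<in> carrier RT \<longleftrightarrow> x \<in> carrier R \<and> Q x = \<zero>"
  by (simp add: RT_def)

lemma RT_simps [simp]:
  "zero RT = \<zero>" "add RT = add R" "smult RT = monoid.mult R"
  by (simp_all add: RT_def)

lemma Q_zero: "Q \<zero> = \<zero>"
  using linear_maps_zero[OF Q_linear R_alg_module R_alg_module] by simp

lemma RJ_module: "module C RJ"
proof -
  have "submodule (Q ` carrier R) C R_alg"
  proof (rule module_submoduleI[OF R_alg_module])
    show "\<zero>\<^bsub>R_alg\<^esub> \<in> Q ` carrier R" using Q_zero by (metis R_alg_simps(4) image_eqI zero_closed)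
  qed (auto simp: Q_closed constantsD simp flip: Q_add Q_const)
  from submodule.submodule_is_module[OF this R_alg_module] show ?thesis by (simp add: RJ_def)
qed

lemma RT_module: "module C RT"
proof -
  have "submodule {x \<in> carrier R. Q x = \<zero>} C R_alg"
    by (rule module_submoduleI[OF R_alg_module]) (auto simp: Q_zero Q_add Q_const constantsD)
  from submodule.submodule_is_module[OF this R_alg_module] show ?thesis by (simp add: RT_def)
qed

lemma linear_maps_RT_restrict: "h \<in> linear_maps C R_alg P \<Longrightarrow> h \<in> linear_maps C RT P"
  by (rule linear_mapsI) (auto simp: RT_carrier dest: linear_maps_closed linear_maps_add linear_maps_smult)

lemma Q_linear_RJ: "Q \<in> linear_maps C R_alg RJ"
  by (rule linear_mapsI) (auto simp: Q_add Q_const)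

text \<open>
  \<open>Q \<partial> Q = Q\<close> yields \<open>Q (x - \<partial> (Q x)) = 0\<close>: this is the projection onto \<open>ker Q\<close> along the image of
  the derivation.
\<close>

lemma transcendental_part:
  assumes "x \<in> carrier R"
  shows "x \<ominus> der (Q x) \<in> carrier RT"
proof -
  note l = linear_maps_minus[OF Q_linear R_alg_module R_alg_module]
  have "Q (x \<ominus>\<^bsub>R_alg\<^esub> der (Q x)) = Q x \<ominus>\<^bsub>R_alg\<^esub> Q (der (Q x))"
    using assms Q_closed der_closed by (intro l) auto
  moreover have "a \<ominus>\<^bsub>R_alg\<^esub> b = a \<ominus> b" for a b
    by (simp add: a_minus_def a_inv_def m_inv_def)
  ultimately show ?thesis using assms Q_closed der_closed by (simp add: RT_carrier Q_der_Q r_neg a_minus_def)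
qed

lemma transcendental_part_linear: "(\<lambda>x. x \<ominus> der (Q x)) \<in> linear_maps C R_alg RT"
proof (rule linear_mapsI)
  show "x \<ominus> der (Q x) \<in> carrier RT" if "x \<in> carrier R_alg" for x
    using transcendental_part that by simp
qed (auto simp: Q_add der_add Q_const der_mult constantsD Q_closed der_closed a_minus_def r_distr
    minus_add a_ac r_minus)

lemma T_simps:
  "carrier T = carrier (words_module C RT)" "zero T = zero (words_module C RT)"
  "add T = add (words_module C RT)" "smult T = smult (words_module C RT)" "one T = w []"
  by (simp_all add: T_def shuffle_algebra_simps)

lemma T_module: "module C T"
  using words_module_module[OF RT_module] by (subst module_cong[of _ "words_module C RT"]) (simp_all add: T_simps)

lemma linear_maps_T: "linear_maps C T P = linear_maps C (words_module C RT) P"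
  "linear_maps C M T = linear_maps C M (words_module C RT)"
  by (rule linear_maps_record_cong; simp add: T_simps)+

lemma T_bilinear: "monoid.mult T \<in> bilinear_maps C T T T"
  using shuffle_algebra_bilinear[OF RT_module]
  by (subst bilinear_maps_record_cong[of _ "words_module C RT" _ "words_module C RT" _ "words_module C RT"])
     (simp_all add: T_simps, simp add: T_def)

lemma w_multilinear: "word_multilinear C RT T w"
  using word_multilinear[OF RT_module] unfolding word_multilinear_def linear_maps_T by (simp add: T_simps)

lemmas w_slot = word_multilinear_slot[OF w_multilinear]
lemmas w_closed = word_multilinear_closed[OF w_multilinear]

lemma T_spans: "spans C T (w ` RT_lists)"
  using words_spans[OF RT_module] by (subst spans_record_cong[of _ "words_module C RT"]) (simp_all add: T_simps)

lemma T_lift: "module C P \<Longrightarrow> word_multilinear C RT P v \<Longrightarrow> \<exists>h\<in>linear_maps C T P. \<forall>f\<in>RT_lists. h (w f) = v f"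
  using words_lift[OF RT_module] by (simp only: linear_maps_T)

definition cons :: "'a \<Rightarrow> ('a list \<Rightarrow> 'a) set \<Rightarrow> ('a list \<Rightarrow> 'a) set" where
  "cons x t = w [x] \<otimes>\<^bsub>words_algebra C RT\<^esub> t"

lemma cons_linear: "x \<in> carrier RT \<Longrightarrow> cons x \<in> linear_maps C T T"
  unfolding cons_def[abs_def] linear_maps_T
  using bilinear_maps_right[OF words_algebra_bilinear[OF RT_module]] w_closed[of "[x]"]
  by (simp add: T_simps)

lemma cons_w: "x \<in> carrier RT \<Longrightarrow> f \<in> RT_lists \<Longrightarrow> cons x (w f) = w (x # f)"
  using words_algebra_mult[OF RT_module, of "[x]" f] by (simp add: cons_def)

lemma T_mult_words:
  "f \<in> RT_lists \<Longrightarrow> w [] \<otimes>\<^bsub>T\<^esub> w f = w f" "f \<in> RT_lists \<Longrightarrow> w f \<otimes>\<^bsub>T\<^esub> w [] = w f"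
  "\<lbrakk>x \<in> carrier RT; f \<in> RT_lists; y \<in> carrier RT; g \<in> RT_lists\<rbrakk> \<Longrightarrow>
    w (x # f) \<otimes>\<^bsub>T\<^esub> w (y # g) = cons x (w f \<otimes>\<^bsub>T\<^esub> w (y # g)) \<oplus>\<^bsub>T\<^esub> cons y (w (x # f) \<otimes>\<^bsub>T\<^esub> w g)"
  using shuffle_algebra_mult[OF RT_module]
  by (simp_all add: T_def shuffle_words_Nil cons_def shuffle_algebra_simps)

lemma T_mult_comm: "f \<in> RT_lists \<Longrightarrow> g \<in> RT_lists \<Longrightarrow> w f \<otimes>\<^bsub>T\<^esub> w g = w g \<otimes>\<^bsub>T\<^esub> w f"
  using shuffle_algebra_mult[OF RT_module] shuffle_words_comm[OF RT_module] by (simp add: T_def)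

lemma T_mult_closed: "f \<in> RT_lists \<Longrightarrow> g \<in> RT_lists \<Longrightarrow> w f \<otimes>\<^bsub>T\<^esub> w g \<in> carrier T"
  by (intro bilinear_maps_closed[OF T_bilinear] w_closed)

lemma T_pos_simps:
  "carrier T_pos = span C T (w ` (RT_lists - {[]}))" "zero T_pos = zero T" "add T_pos = add T"
  "smult T_pos = smult T"
  by (simp_all add: T_pos_def)

lemma T_pos_submodule: "submodule (carrier T_pos) C T"
  unfolding T_pos_simps by (rule span_submodule[OF T_module]) (auto intro: w_closed)

lemma T_pos_module: "module C T_pos"
proof -
  have "T\<lparr>carrier := carrier T_pos\<rparr> = T_pos" by (simp add: T_pos_def)
  then show ?thesis using submodule.submodule_is_module[OF T_pos_submodule T_module] by simp
qed

lemma T_pos_subset: "t \<in> carrier T_pos \<Longrightarrow> t \<in> carrier T"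
  using submoduleD(1)[OF T_pos_submodule T_module] by blast

lemma w_pos: "f \<in> RT_lists \<Longrightarrow> f \<noteq> [] \<Longrightarrow> w f \<in> carrier T_pos"
  unfolding T_pos_simps by (rule subsetD[OF span_superset]) blast

text \<open>
  A submodule of \<open>T_pos\<close> is a submodule of \<open>T\<close>, so that spans may be formed in either module.
\<close>

lemma T_pos_spans: "spans C T_pos (w ` (RT_lists - {[]}))"
proof -
  have "carrier T_pos \<subseteq> N" if N: "submodule N C T_pos" "w ` (RT_lists - {[]}) \<subseteq> N" for N
  proof -
    note D = submoduleD[OF N(1) T_pos_module]
    have "submodule N C T"
      by (rule module_submoduleI[OF T_module]) (use D T_pos_subset in \<open>auto simp: T_pos_simps(2-)\<close>)
    then show ?thesis unfolding T_pos_simps by (rule span_least[OF _ N(2)])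
  qed
  then show ?thesis by (auto simp: spans_def span_def[of _ T_pos] intro: w_pos)
qed

lemma linear_maps_T_pos: "h \<in> linear_maps C T P \<Longrightarrow> h \<in> linear_maps C T_pos P"
  by (rule linear_mapsI)
     (auto simp: T_pos_simps(2-) dest: T_pos_subset linear_maps_closed linear_maps_add linear_maps_smult)

lemma w_pos_slot:
  assumes "xs \<in> RT_lists" "ys \<in> RT_lists"
  shows "(\<lambda>x. w (xs @ x # ys)) \<in> linear_maps C RT T_pos"
proof (rule linear_mapsI)
  show "w (xs @ x # ys) \<in> carrier T_pos" if "x \<in> carrier RT" for x
    using that assms by (intro w_pos) auto
qed (simp_all only: T_pos_simps(2-) linear_maps_add[OF w_slot[OF assms]] linear_maps_smult[OF w_slot[OF assms]])

lemma cons_pos: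
  assumes x: "x \<in> carrier RT" and t: "t \<in> carrier T"
  shows "cons x t \<in> carrier T_pos"
proof -
  show ?thesis
  proof (rule linear_maps_into_submodule[OF T_spans cons_linear[OF x] T_module T_module T_pos_submodule _ t])
    fix u assume "u \<in> w ` RT_lists"
    then obtain f where f: "f \<in> RT_lists" and u: "u = w f" by blast
    show "cons x u \<in> carrier T_pos"
      unfolding u cons_w[OF x f] by (rule w_pos) (use x f in simp_all)
  qed
qed

text \<open>
  Unless both words are empty, every term of the recursion has a letter in front.
\<close>

lemma shuffle_pos:
  assumes "f \<in> RT_lists" "g \<in> RT_lists" "f \<noteq> [] \<or> g \<noteq> []"
  shows "w f \<otimes>\<^bsub>T\<^esub> w g \<in> carrier T_pos"
proof (cases f)
  case Nil
  with assms show ?thesis by (simp add: T_mult_words(1) w_pos)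
next
  case f: (Cons x f')
  show ?thesis
  proof (cases g)
    case Nil
    with assms f show ?thesis by (simp add: T_mult_words(2) w_pos)
  next
    case (Cons y g')
    note cl = bilinear_maps_closed[OF T_bilinear w_closed w_closed]
    from assms f Cons have "x \<in> carrier RT" "f' \<in> RT_lists" "y \<in> carrier RT" "g' \<in> RT_lists" by auto
    then show ?thesis
      unfolding f Cons
      by - (subst T_mult_words(3), assumption+,
         intro submoduleD(3)[OF T_pos_submodule T_module] cons_pos cl, simp_all)
  qed
qed

subsection \<open>The rings of constants\<close>

lemma M1_module: "module C M1"
  unfolding M1_def by (rule tensor_module_module[OF RJ_module T_pos_module])

lemma C1_algebra: "algebra C C1"
  unfolding C1_def by (rule sym_algebra_algebra[OF M1_module])

lemma C1_module: "module C C1"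
  by (rule algebra_module[OF C1_algebra])

lemmas C1_bilinear = algebra_mult_bilinear[OF C1_algebra]

lemma eps1_bilinear: "eps1 \<in> bilinear_maps C RJ T_pos C1"
  unfolding eps1_def[abs_def] C1_def
  by (rule bilinear_maps_comp[OF tensor_bilinear[OF RJ_module T_pos_module, folded M1_def] sym_gen_linear[OF M1_module]])

lemma M2_module: "module C M2"
  unfolding M2_def by (rule sym_square_module[OF T_pos_module])

lemma Sym2_algebra: "algebra C Sym2"
  unfolding Sym2_def by (rule sym_algebra_algebra[OF M2_module])

lemma eps_sym2_bilinear: "eps_sym2 \<in> bilinear_maps C T_pos T_pos Sym2"
  unfolding eps_sym2_def[abs_def] Sym2_def
  by (rule bilinear_maps_comp[OF sym_prod_bilinear[OF T_pos_module, folded M2_def] sym_gen_linear[OF M2_module]])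

lemma take_drop_RT_lists:
  "f \<in> RT_lists \<Longrightarrow> take i f \<in> RT_lists" "f \<in> RT_lists \<Longrightarrow> drop i f \<in> RT_lists"
  by (auto dest: in_set_takeD in_set_dropD)

lemma J2_gen_closed:
  assumes f: "f \<in> RT_lists - {[]}" and g: "g \<in> RT_lists - {[]}" and h: "h \<in> RT_lists - {[]}"
  shows "J2_gen f g h \<in> carrier Sym2"
proof -
  interpret S: algebra C Sym2 by (rule Sym2_algebra)
  note cl = bilinear_maps_closed[OF eps_sym2_bilinear]
  note td = take_drop_RT_lists
  have 1: "eps_sym2 (w (drop i a)) (w (drop j b)) \<in> carrier Sym2"
    if "a \<in> RT_lists" "b \<in> RT_lists" "i < length a" "j < length b" for a b i j
    by (intro cl w_pos td that) (use that in auto)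
  have 2: "w (take i a) \<otimes>\<^bsub>T\<^esub> w (take j b) \<in> carrier T_pos"
    if "a \<in> RT_lists" "b \<in> RT_lists" "i < length a" "j < length b" "1 - j \<le> i" for a b i j
    by (intro shuffle_pos td that) (use that in auto)
  have 3: "w a \<in> carrier T_pos" if "a \<in> RT_lists - {[]}" for a using that by (auto intro: w_pos)
  have 4: "w a \<otimes>\<^bsub>T\<^esub> w b \<in> carrier T_pos" if "a \<in> RT_lists - {[]}" "b \<in> RT_lists - {[]}" for a b
    using that by (auto intro: shuffle_pos)
  have 5: "w (take j a) \<otimes>\<^bsub>T\<^esub> w (take i b) \<in> carrier T_pos"
    if "a \<in> RT_lists" "b \<in> RT_lists" "j < length a" "i < length b" "1 - j \<le> i" for a b i j
    by (intro shuffle_pos td that) (use that in auto)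
  have f': "f \<in> RT_lists" and g': "g \<in> RT_lists" and h': "h \<in> RT_lists" using f g h by auto
  have A: "(\<Oplus>\<^bsub>Sym2\<^esub>i\<in>{1 - j..<length f}.
           eps_sym2 (w (drop i f)) (w (drop j g)) \<otimes>\<^bsub>Sym2\<^esub>
           eps_sym2 (w (take i f) \<otimes>\<^bsub>T\<^esub> w (take j g)) (w h)) \<in> carrier Sym2" if "j < length g" for j
    using that by (intro S.finsum_closed funcsetI S.m_closed 1 cl 2 3 f' g' h' h) auto
  have B: "(\<Oplus>\<^bsub>Sym2\<^esub>k\<in>{1 - j..<length h}.
           eps_sym2 (w f) (w (take j g) \<otimes>\<^bsub>T\<^esub> w (take k h)) \<otimes>\<^bsub>Sym2\<^esub>
           eps_sym2 (w (drop j g)) (w (drop k h))) \<in> carrier Sym2" if "j < length g" for j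
    using that by (intro S.finsum_closed funcsetI S.m_closed 1 cl 5 3 f' g' h' f) auto
  show ?thesis
    unfolding J2_gen_def
    by (intro S.a_closed S.minus_closed S.finsum_closed funcsetI A B cl 3 4 f g h) auto
qed

lemma J2_ideal: "ideal J2 Sym2"
proof -
  interpret S: algebra C Sym2 by (rule Sym2_algebra)
  show ?thesis unfolding J2_def by (rule S.genideal_ideal) (auto intro!: J2_gen_closed)
qed

lemma C2_algebra: "algebra C C2"
  unfolding C2_def by (rule quot_algebra_algebra[OF Sym2_algebra J2_ideal])

lemma C2_module: "module C C2"
  by (rule algebra_module[OF C2_algebra])

lemmas C2_bilinear = algebra_mult_bilinear[OF C2_algebra]

lemma C2_proj_linear: "(\<lambda>x. J2 +>\<^bsub>Sym2\<^esub> x) \<in> linear_maps C Sym2 C2"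
  unfolding C2_def
  by (rule quot_proj_linear[OF algebra_module[OF Sym2_algebra] ideal_submodule[OF Sym2_algebra J2_ideal]])

lemma eps2_bilinear: "eps2 \<in> bilinear_maps C T_pos T_pos C2"
  unfolding eps2_def[abs_def] by (rule bilinear_maps_comp[OF eps_sym2_bilinear C2_proj_linear])


subsection \<open>The product of words with coefficients\<close>

lemma RT_lists_append [simp]:
  "xs @ x # ys \<in> RT_lists \<longleftrightarrow> xs \<in> RT_lists \<and> x \<in> carrier RT \<and> ys \<in> RT_lists"
  by auto

text \<open>
  If \<open>xs @ x # ys\<close> is cut after \<open>i\<close> letters, then \<open>x\<close> lies in the second part for \<open>i \<le> length xs\<close>
  and in the first part otherwise.  So one argument of \<open>F\<close> is constant and the other is a word
  with \<open>x\<close> in a single slot.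
\<close>

lemma deconcatenation_slot:
  assumes F: "F \<in> bilinear_maps C T_pos T P" and xs: "xs \<in> RT_lists" and ys: "ys \<in> RT_lists"
    and i: "i < length xs + Suc (length ys)"
  shows "(\<lambda>x. F (w (drop i (xs @ x # ys))) (w (take i (xs @ x # ys)))) \<in> linear_maps C RT P"
proof (cases "i \<le> length xs")
  case True
  then have eq: "drop i (xs @ x # ys) = drop i xs @ x # ys" "take i (xs @ x # ys) = take i xs" for x
    by simp_all
  show ?thesis
    unfolding eq using xs ys
    by (intro linear_maps_comp[OF bilinear_maps_left[OF F] w_pos_slot] w_closed take_drop_RT_lists)
next
  case False
  define k where "k = i - Suc (length xs)"
  have ik: "i = Suc (length xs) + k" using False by (simp add: k_def)
  have eq: "drop i (xs @ x # ys) = drop k ys" "take i (xs @ x # ys) = xs @ x # take k ys" for x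
    by (simp_all add: ik)
  have "drop k ys \<noteq> []" using i by (simp add: ik)
  then show ?thesis
    unfolding eq using xs ys
    by (intro linear_maps_comp[OF bilinear_maps_right[OF F] w_slot] w_pos take_drop_RT_lists)
qed

abbreviation t2 where "t2 \<equiv> tensor C C2 T"

lemma C2T_simps:
  "carrier C2T = carrier (tensor_module C C2 T)" "zero C2T = zero (tensor_module C C2 T)"
  "add C2T = add (tensor_module C C2 T)" "smult C2T = smult (tensor_module C C2 T)"
  "one C2T = t2 \<one>\<^bsub>C2\<^esub> (w [])"
  by (simp_all add: C2T_def Let_def)

lemma C2T_module: "module C C2T"
  using tensor_module_module[OF C2_module T_module]
  by (subst module_cong[of _ "tensor_module C C2 T"]) (simp_all add: C2T_simps)

lemma t2_bilinear: "t2 \<in> bilinear_maps C C2 T C2T"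
  using tensor_bilinear[OF C2_module T_module]
  by (subst bilinear_maps_record_cong[of _ C2 _ T _ "tensor_module C C2 T"]) (simp_all add: C2T_simps)

lemma C2T_spans: "spans C C2T ((\<lambda>(c, f). t2 c (w f)) ` (carrier C2 \<times> RT_lists))"
  using tensor_family_spans[OF C2_module T_module T_spans]
  by (subst spans_record_cong(1)[of _ "tensor_module C C2 T"]) (simp_all add: C2T_simps)

lemma C2T_lift:
  assumes P: "module C P" and "\<And>c. c \<in> carrier C2 \<Longrightarrow> word_multilinear C RT P (u c)"
    and "\<And>f. f \<in> RT_lists \<Longrightarrow> (\<lambda>c. u c f) \<in> linear_maps C C2 P"
  shows "\<exists>h\<in>linear_maps C C2T P. \<forall>c\<in>carrier C2. \<forall>f\<in>RT_lists. h (t2 c (w f)) = u c f"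
  using tensor_family_lift[OF C2_module T_module T_spans P T_lift[OF P assms(2)] assms(3)]
  by (subst linear_maps_record_cong[of C2T "tensor_module C C2 T" P P]) (simp_all add: C2T_simps)

text \<open>
  The formula for the product in \<open>C\<^sub>2 \<otimes> T\<close>, where \<open>e\<close> stands for the product of the two
  coefficients.
\<close>

definition word_product where
  "word_product e f g = t2 e (w f \<otimes>\<^bsub>T\<^esub> w g) \<oplus>\<^bsub>C2T\<^esub>
     (\<Oplus>\<^bsub>C2T\<^esub>i\<in>{0..<length f}. \<Oplus>\<^bsub>C2T\<^esub>j\<in>{0..<length g}.
        t2 (e \<otimes>\<^bsub>C2\<^esub> eps2 (w (drop i f)) (w (drop j g))) (w (take i f) \<otimes>\<^bsub>T\<^esub> w (take j g)))"

lemma word_product_linear: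
  assumes f: "f \<in> RT_lists" and g: "g \<in> RT_lists"
  shows "(\<lambda>e. word_product e f g) \<in> linear_maps C C2 C2T"
proof -
  note td = take_drop_RT_lists
  have e: "eps2 (w (drop i f)) (w (drop j g)) \<in> carrier C2" if "i < length f" "j < length g" for i j
    by (intro bilinear_maps_closed[OF eps2_bilinear] w_pos td f g) (use that in auto)
  show ?thesis
    unfolding word_product_def
    by (intro linear_maps_sum linear_maps_finsum_map C2_module C2T_module
        linear_maps_comp[OF bilinear_maps_left[OF t2_bilinear] bilinear_maps_left[OF C2_bilinear]]
        bilinear_maps_left[OF t2_bilinear] bilinear_maps_closed[OF T_bilinear] w_closed td f g e) auto
qed

lemma word_product_multilinear_left:
  assumes e: "e \<in> carrier C2" and g: "g \<in> RT_lists"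
  shows "word_multilinear C RT C2T (\<lambda>f. word_product e f g)"
proof (rule word_multilinearI)
  note td = take_drop_RT_lists
  show "word_product e [] g \<in> carrier C2T"
    by (rule linear_maps_closed[OF word_product_linear[OF _ g] e]) simp
  fix xs ys assume xs: "xs \<in> RT_lists" and ys: "ys \<in> RT_lists"
  have F: "(\<lambda>s r. t2 (e \<otimes>\<^bsub>C2\<^esub> eps2 s (w (drop j g))) (r \<otimes>\<^bsub>T\<^esub> w (take j g))) \<in> bilinear_maps C T_pos T C2T"
    if "j < length g" for j
  proof -
    have "w (drop j g) \<in> carrier T_pos" by (intro w_pos td g) (use that in auto)
    then show ?thesis
      by (intro bilinear_maps_precomp[OF t2_bilinear]
          linear_maps_comp[OF bilinear_maps_right[OF C2_bilinear e]]
          bilinear_maps_left[OF eps2_bilinear] bilinear_maps_left[OF T_bilinear] w_closed td g)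
  qed
  have len: "length (xs @ x # ys) = length xs + Suc (length ys)" for x :: 'a by simp
  show "(\<lambda>x. word_product e (xs @ x # ys) g) \<in> linear_maps C RT C2T"
    unfolding word_product_def len
    by (intro linear_maps_sum linear_maps_finsum_map C2T_module RT_module
        deconcatenation_slot[OF F xs ys] linear_maps_comp[OF bilinear_maps_right[OF t2_bilinear e]]
        linear_maps_comp[OF bilinear_maps_left[OF T_bilinear] w_slot[OF xs ys]] w_closed g) auto
qed

lemma word_product_multilinear_right:
  assumes e: "e \<in> carrier C2" and f: "f \<in> RT_lists"
  shows "word_multilinear C RT C2T (word_product e f)"
proof (rule word_multilinearI)
  note td = take_drop_RT_lists
  show "word_product e f [] \<in> carrier C2T"
    by (rule linear_maps_closed[OF word_product_linear[OF f] e]) simp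
  fix xs ys assume xs: "xs \<in> RT_lists" and ys: "ys \<in> RT_lists"
  have F: "(\<lambda>s r. t2 (e \<otimes>\<^bsub>C2\<^esub> eps2 (w (drop i f)) s) (w (take i f) \<otimes>\<^bsub>T\<^esub> r)) \<in> bilinear_maps C T_pos T C2T"
    if "i < length f" for i
  proof -
    have "w (drop i f) \<in> carrier T_pos" by (intro w_pos td f) (use that in auto)
    then show ?thesis
      by (intro bilinear_maps_precomp[OF t2_bilinear]
          linear_maps_comp[OF bilinear_maps_right[OF C2_bilinear e]]
          bilinear_maps_right[OF eps2_bilinear] bilinear_maps_right[OF T_bilinear] w_closed td f)
  qed
  have len: "length (xs @ x # ys) = length xs + Suc (length ys)" for x :: 'a by simp
  show "(\<lambda>x. word_product e f (xs @ x # ys)) \<in> linear_maps C RT C2T"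
    unfolding word_product_def len
    by (intro linear_maps_sum linear_maps_finsum_map C2T_module RT_module
        deconcatenation_slot[OF F xs ys] linear_maps_comp[OF bilinear_maps_right[OF t2_bilinear e]]
        linear_maps_comp[OF bilinear_maps_right[OF T_bilinear] w_slot[OF xs ys]] w_closed f) auto
qed

text \<open>
  The formula is linear in the coefficient and multilinear in both words.
\<close>

lemma
  shows C2T_bilinear: "monoid.mult C2T \<in> bilinear_maps C C2T C2T C2T"
    and C2T_mult: "\<lbrakk>c \<in> carrier C2; d \<in> carrier C2; f \<in> RT_lists; g \<in> RT_lists\<rbrakk> \<Longrightarrow>
      t2 c (w f) \<otimes>\<^bsub>C2T\<^esub> t2 d (w g) = word_product (c \<otimes>\<^bsub>C2\<^esub> d) f g"
proof -
  let ?P = "tensor_module C C2 T"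
  let ?Q = "\<lambda>b. b \<in> bilinear_maps C ?P ?P ?P \<and>
         (\<forall>c\<in>carrier C2. \<forall>d\<in>carrier C2. \<forall>f\<in>RT_lists. \<forall>g\<in>RT_lists.
            b (t2 c (w f)) (t2 d (w g)) =
              t2 (c \<otimes>\<^bsub>C2\<^esub> d) (w f \<otimes>\<^bsub>T\<^esub> w g) \<oplus>\<^bsub>?P\<^esub>
              (\<Oplus>\<^bsub>?P\<^esub>i\<in>{0..<length f}. \<Oplus>\<^bsub>?P\<^esub>j\<in>{0..<length g}.
                 t2 (c \<otimes>\<^bsub>C2\<^esub> d \<otimes>\<^bsub>C2\<^esub> eps2 (w (drop i f)) (w (drop j g)))
                   (w (take i f) \<otimes>\<^bsub>T\<^esub> w (take j g))))"
  have bil: "bilinear_maps C C2T C2T C2T = bilinear_maps C ?P ?P ?P"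
    by (rule bilinear_maps_record_cong) (simp_all add: C2T_simps)
  have fs: "finsum C2T = finsum ?P" by (intro ext) (simp add: finsum_def finprod_def C2T_simps)
  let ?G = "carrier C2 \<times> RT_lists" and ?g = "\<lambda>(c, f). t2 c (w f)"
  note mc = bilinear_maps_closed[OF C2_bilinear]
  have right: "\<exists>k\<in>linear_maps C C2T C2T. \<forall>q\<in>?G. k (?g q) =
      word_product (fst p \<otimes>\<^bsub>C2\<^esub> fst q) (snd p) (snd q)" if "p \<in> ?G" for p
  proof -
    from that have p: "fst p \<in> carrier C2" "snd p \<in> RT_lists" by auto
    have "\<exists>h\<in>linear_maps C C2T C2T. \<forall>c\<in>carrier C2. \<forall>f\<in>RT_lists. h (t2 c (w f)) =
        word_product (fst p \<otimes>\<^bsub>C2\<^esub> c) (snd p) f"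
      by (intro C2T_lift C2T_module word_product_multilinear_right mc p
          linear_maps_comp[OF word_product_linear bilinear_maps_right[OF C2_bilinear]])
    then show ?thesis by (elim bexE) (rule bexI, auto)
  qed
  have left: "\<exists>k\<in>linear_maps C C2T C2T. \<forall>p\<in>?G. k (?g p) =
      word_product (fst p \<otimes>\<^bsub>C2\<^esub> fst q) (snd p) (snd q)" if "q \<in> ?G" for q
  proof -
    from that have q: "fst q \<in> carrier C2" "snd q \<in> RT_lists" by auto
    have "\<exists>h\<in>linear_maps C C2T C2T. \<forall>c\<in>carrier C2. \<forall>f\<in>RT_lists. h (t2 c (w f)) =
        word_product (c \<otimes>\<^bsub>C2\<^esub> fst q) f (snd q)"
      by (intro C2T_lift C2T_module word_product_multilinear_left mc q
          linear_maps_comp[OF word_product_linear bilinear_maps_left[OF C2_bilinear]])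
    then show ?thesis by (elim bexE) (rule bexI, auto)
  qed
  from bilinear_extension[OF C2T_module C2T_spans C2T_module C2T_spans C2T_module right left]
  obtain b where b: "b \<in> bilinear_maps C C2T C2T C2T"
    "\<forall>p\<in>?G. \<forall>q\<in>?G. b (?g p) (?g q) = word_product (fst p \<otimes>\<^bsub>C2\<^esub> fst q) (snd p) (snd q)" by blast
  have "?Q b"
    using b unfolding bil word_product_def fs C2T_simps(3) by simp
  then have Q: "?Q (SOME b. ?Q b)" by (rule someI[of ?Q])
  have eq: "monoid.mult C2T = (SOME b. ?Q b)"
    by (simp add: C2T_def Let_def)
  note Q = Q[folded eq]
  from Q show "monoid.mult C2T \<in> bilinear_maps C C2T C2T C2T" by (simp add: bil)
  assume "c \<in> carrier C2" "d \<in> carrier C2" "f \<in> RT_lists" "g \<in> RT_lists"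
  with Q show "t2 c (w f) \<otimes>\<^bsub>C2T\<^esub> t2 d (w g) = word_product (c \<otimes>\<^bsub>C2\<^esub> d) f g"
    unfolding word_product_def fs C2T_simps(3) by blast
qed

lemma C2_one_closed: "\<one>\<^bsub>C2\<^esub> \<in> carrier C2" and C1_one_closed: "\<one>\<^bsub>C1\<^esub> \<in> carrier C1"
proof -
  interpret C1: algebra C C1 by (rule C1_algebra)
  interpret C2: algebra C C2 by (rule C2_algebra)
  show "\<one>\<^bsub>C2\<^esub> \<in> carrier C2" "\<one>\<^bsub>C1\<^esub> \<in> carrier C1" by simp_all
qed

lemma C2_one_left: "c \<in> carrier C2 \<Longrightarrow> \<one>\<^bsub>C2\<^esub> \<otimes>\<^bsub>C2\<^esub> c = c"
  and C1_one_left: "d \<in> carrier C1 \<Longrightarrow> \<one>\<^bsub>C1\<^esub> \<otimes>\<^bsub>C1\<^esub> d = d"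
  and C2_one_right: "c \<in> carrier C2 \<Longrightarrow> c \<otimes>\<^bsub>C2\<^esub> \<one>\<^bsub>C2\<^esub> = c"
  and C1_one_right: "d \<in> carrier C1 \<Longrightarrow> d \<otimes>\<^bsub>C1\<^esub> \<one>\<^bsub>C1\<^esub> = d"
proof -
  interpret C1: algebra C C1 by (rule C1_algebra)
  interpret C2: algebra C C2 by (rule C2_algebra)
  show "c \<in> carrier C2 \<Longrightarrow> \<one>\<^bsub>C2\<^esub> \<otimes>\<^bsub>C2\<^esub> c = c" "d \<in> carrier C1 \<Longrightarrow> \<one>\<^bsub>C1\<^esub> \<otimes>\<^bsub>C1\<^esub> d = d"
    "c \<in> carrier C2 \<Longrightarrow> c \<otimes>\<^bsub>C2\<^esub> \<one>\<^bsub>C2\<^esub> = c" "d \<in> carrier C1 \<Longrightarrow> d \<otimes>\<^bsub>C1\<^esub> \<one>\<^bsub>C1\<^esub> = d" by simp_all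
qed

text \<open>
  The correction terms run over proper prefixes of both words, and the empty word has none.
\<close>

lemma C2T_mult_Nil:
  assumes "c \<in> carrier C2" "d \<in> carrier C2" "g \<in> RT_lists"
  shows "t2 c (w []) \<otimes>\<^bsub>C2T\<^esub> t2 d (w g) = t2 (c \<otimes>\<^bsub>C2\<^esub> d) (w g)"
proof -
  interpret P: module C C2T by (rule C2T_module)
  have "t2 (c \<otimes>\<^bsub>C2\<^esub> d) (w g) \<in> carrier C2T"
    by (intro bilinear_maps_closed[OF t2_bilinear] bilinear_maps_closed[OF C2_bilinear] w_closed assms)
  then show ?thesis
    using assms by (simp add: C2T_mult word_product_def T_mult_words(1) P.M.r_zero)
qed

lemma C2T_one_closed: "\<one>\<^bsub>C2T\<^esub> \<in> carrier C2T"
  unfolding C2T_simps(5) by (intro bilinear_maps_closed[OF t2_bilinear] C2_one_closed w_closed) simp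

subsection \<open>Pure tensors\<close>

abbreviation CT where "CT \<equiv> tensor_algebra_product C C1 C2T"
abbreviation tC where "tC \<equiv> tensor C C1 C2T"
abbreviation tR where "tR \<equiv> tensor C R_alg CT"

lemmas CT_module = tensor_algebra_module[OF C1_module C1_bilinear C2T_module C2T_bilinear]
lemmas CT_bilinear = tensor_algebra_bilinear[OF C1_module C1_bilinear C2T_module C2T_bilinear]
lemmas CT_mult = tensor_algebra_mult[OF C1_module C1_bilinear C2T_module C2T_bilinear]
lemmas tC_bilinear = tensor_algebra_tensor[OF C1_module C1_bilinear C2T_module C2T_bilinear]
lemmas IDR_module = tensor_algebra_module[OF R_alg_module R_bilinear CT_module CT_bilinear, folded IDR_def]
lemmas IDR_bilinear = tensor_algebra_bilinear[OF R_alg_module R_bilinear CT_module CT_bilinear, folded IDR_def]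
lemmas IDR_mult = tensor_algebra_mult[OF R_alg_module R_bilinear CT_module CT_bilinear, folded IDR_def]
lemmas tR_bilinear = tensor_algebra_tensor[OF R_alg_module R_bilinear CT_module CT_bilinear, folded IDR_def]

lemma CT_simps: "carrier CT = carrier (tensor_module C C1 C2T)" "zero CT = zero (tensor_module C C1 C2T)"
  "add CT = add (tensor_module C C1 C2T)" "smult CT = smult (tensor_module C C1 C2T)"
  "one CT = tC \<one>\<^bsub>C1\<^esub> \<one>\<^bsub>C2T\<^esub>"
  by (rule tensor_algebra_simps)+

lemma IDR_simps: "carrier IDR = carrier (tensor_module C R_alg CT)" "zero IDR = zero (tensor_module C R_alg CT)"
  "add IDR = add (tensor_module C R_alg CT)" "smult IDR = smult (tensor_module C R_alg CT)"
  "one IDR = tR \<one>\<^bsub>R_alg\<^esub> \<one>\<^bsub>CT\<^esub>"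
  unfolding IDR_def by (rule tensor_algebra_simps)+

lemma CT_one_closed: "\<one>\<^bsub>CT\<^esub> \<in> carrier CT"
  unfolding CT_simps(5) by (rule bilinear_maps_closed[OF tC_bilinear C1_one_closed C2T_one_closed])

lemma CT_spans: "spans C CT ((\<lambda>(c1, q). tC c1 ((\<lambda>(c, f). t2 c (w f)) q)) ` (carrier C1 \<times> (carrier C2 \<times> RT_lists)))"
  using tensor_family_spans[OF C1_module C2T_module C2T_spans]
  by (subst spans_record_cong(1)[of _ "tensor_module C C1 C2T"]) (simp_all only: CT_simps)

lemma CT_lift:
  assumes P: "module C P"
    and w: "\<And>c c'. c \<in> carrier C1 \<Longrightarrow> c' \<in> carrier C2 \<Longrightarrow> word_multilinear C RT P (u c c')"
    and c2: "\<And>c f. c \<in> carrier C1 \<Longrightarrow> f \<in> RT_lists \<Longrightarrow> (\<lambda>c'. u c c' f) \<in> linear_maps C C2 P"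
    and c1: "\<And>c' f. c' \<in> carrier C2 \<Longrightarrow> f \<in> RT_lists \<Longrightarrow> (\<lambda>c. u c c' f) \<in> linear_maps C C1 P"
  shows "\<exists>h\<in>linear_maps C CT P. \<forall>c\<in>carrier C1. \<forall>c'\<in>carrier C2. \<forall>f\<in>RT_lists.
    h (tC c (t2 c' (w f))) = u c c' f"
proof -
  have "\<exists>h\<in>linear_maps C (tensor_module C C1 C2T) P. \<forall>c\<in>carrier C1. \<forall>q\<in>carrier C2 \<times> RT_lists.
    h (tC c ((\<lambda>(c, f). t2 c (w f)) q)) = u c (fst q) (snd q)"
  proof (rule tensor_family_lift[OF C1_module C2T_module C2T_spans P])
    fix c assume c: "c \<in> carrier C1"
    have "\<exists>h\<in>linear_maps C C2T P. \<forall>c'\<in>carrier C2. \<forall>f\<in>RT_lists. h (t2 c' (w f)) = u c c' f"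
      by (rule C2T_lift[OF P w[OF c] c2[OF c]])
    then show "\<exists>k\<in>linear_maps C C2T P. \<forall>q\<in>carrier C2 \<times> RT_lists. k ((\<lambda>(c, f). t2 c (w f)) q) = u c (fst q) (snd q)"
      by (elim bexE) (rule bexI, auto)
  next
    fix q assume "q \<in> carrier C2 \<times> RT_lists"
    then show "(\<lambda>c. u c (fst q) (snd q)) \<in> linear_maps C C1 P" by (intro c1) auto
  qed
  then show ?thesis
    by (subst linear_maps_record_cong[of CT "tensor_module C C1 C2T" P P]) (simp_all add: CT_simps)
qed

lemma pure_eq: "pure x c1 c2 f = tR x (tC c1 (t2 c2 (w f)))"
  by (simp add: pure_def)

lemma pure_spans: "spans C IDR ((\<lambda>(x, c1, c2, f). pure x c1 c2 f) `
    (carrier R \<times> carrier C1 \<times> carrier C2 \<times> RT_lists))"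
proof -
  have "(\<lambda>(x, c1, c2, f). pure x c1 c2 f) = (\<lambda>(x, p). tR x ((\<lambda>(c1, q). tC c1 ((\<lambda>(c, f). t2 c (w f)) q)) p))"
    by (auto simp: pure_eq fun_eq_iff)
  then show ?thesis
    using tensor_family_spans[OF R_alg_module CT_module CT_spans]
    by (subst spans_record_cong(1)[of _ "tensor_module C R_alg CT"]) (simp_all only: IDR_simps R_alg_simps)
qed

lemma t2_familyE:
  assumes "a \<in> (\<lambda>(c, f). t2 c (w f)) ` (carrier C2 \<times> RT_lists)"
  obtains c f where "a = t2 c (w f)" "c \<in> carrier C2" "f \<in> RT_lists"
proof -
  from assms obtain p where "p \<in> carrier C2 \<times> RT_lists" "a = (\<lambda>(c, f). t2 c (w f)) p"
    by (elim imageE)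
  then show thesis
    by (intro that[of "fst p" "snd p"]) (simp_all only: case_prod_unfold mem_Times_iff)
qed

lemma pure_familyE:
  assumes "a \<in> (\<lambda>(x, c1, c2, f). pure x c1 c2 f) ` (carrier R \<times> carrier C1 \<times> carrier C2 \<times> RT_lists)"
  obtains x c c' f where "a = pure x c c' f" "x \<in> carrier R" "c \<in> carrier C1" "c' \<in> carrier C2" "f \<in> RT_lists"
proof -
  from assms obtain p where "p \<in> carrier R \<times> carrier C1 \<times> carrier C2 \<times> RT_lists"
    "a = (\<lambda>(x, c1, c2, f). pure x c1 c2 f) p" by (elim imageE)
  then show thesis
    by (intro that[of "fst p" "fst (snd p)" "fst (snd (snd p))" "snd (snd (snd p))"])
       (simp_all only: case_prod_unfold mem_Times_iff)
qed

lemma IDR_lift: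
  assumes P: "module C P"
    and w: "\<And>x c c'. x \<in> carrier R \<Longrightarrow> c \<in> carrier C1 \<Longrightarrow> c' \<in> carrier C2 \<Longrightarrow>
      word_multilinear C RT P (u x c c')"
    and c2: "\<And>x c f. x \<in> carrier R \<Longrightarrow> c \<in> carrier C1 \<Longrightarrow> f \<in> RT_lists \<Longrightarrow>
      (\<lambda>c'. u x c c' f) \<in> linear_maps C C2 P"
    and c1: "\<And>x c' f. x \<in> carrier R \<Longrightarrow> c' \<in> carrier C2 \<Longrightarrow> f \<in> RT_lists \<Longrightarrow>
      (\<lambda>c. u x c c' f) \<in> linear_maps C C1 P"
    and x: "\<And>c c' f. c \<in> carrier C1 \<Longrightarrow> c' \<in> carrier C2 \<Longrightarrow> f \<in> RT_lists \<Longrightarrow>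
      (\<lambda>x. u x c c' f) \<in> linear_maps C R_alg P"
  shows "\<exists>h\<in>linear_maps C IDR P. \<forall>x\<in>carrier R. \<forall>c\<in>carrier C1. \<forall>c'\<in>carrier C2. \<forall>f\<in>RT_lists.
    h (pure x c c' f) = u x c c' f"
proof -
  let ?G = "carrier C1 \<times> (carrier C2 \<times> RT_lists)"
  let ?g = "\<lambda>(c1, q). tC c1 ((\<lambda>(c, f). t2 c (w f)) q)"
  have "\<exists>h\<in>linear_maps C (tensor_module C R_alg CT) P. \<forall>x\<in>carrier R_alg. \<forall>q\<in>?G.
    h (tR x (?g q)) = u x (fst q) (fst (snd q)) (snd (snd q))"
  proof (rule tensor_family_lift[OF R_alg_module CT_module CT_spans P])
    fix x assume "x \<in> carrier R_alg"
    then have x: "x \<in> carrier R" by simp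
    have "\<exists>h\<in>linear_maps C CT P. \<forall>c\<in>carrier C1. \<forall>c'\<in>carrier C2. \<forall>f\<in>RT_lists.
        h (tC c (t2 c' (w f))) = u x c c' f"
      by (rule CT_lift[OF P w[OF x] c2[OF x] c1[OF x]])
    then show "\<exists>k\<in>linear_maps C CT P. \<forall>q\<in>?G. k (?g q) = u x (fst q) (fst (snd q)) (snd (snd q))"
      by (elim bexE) (rule bexI, auto)
  next
    fix q assume "q \<in> ?G"
    then show "(\<lambda>x. u x (fst q) (fst (snd q)) (snd (snd q))) \<in> linear_maps C R_alg P" by (intro x) auto
  qed
  then show ?thesis
    by (subst linear_maps_record_cong[of IDR "tensor_module C R_alg CT" P P]) (simp_all add: IDR_simps pure_eq)
qed

lemma t2_closed: "c2 \<in> carrier C2 \<Longrightarrow> f \<in> RT_lists \<Longrightarrow> t2 c2 (w f) \<in> carrier C2T"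
  by (intro bilinear_maps_closed[OF t2_bilinear] w_closed)

lemma tC_closed: "c1 \<in> carrier C1 \<Longrightarrow> p \<in> carrier C2T \<Longrightarrow> tC c1 p \<in> carrier CT"
  by (rule bilinear_maps_closed[OF tC_bilinear])

lemma pure_closed: "\<lbrakk>x \<in> carrier R; c1 \<in> carrier C1; c2 \<in> carrier C2; f \<in> RT_lists\<rbrakk> \<Longrightarrow>
    pure x c1 c2 f \<in> carrier IDR"
  unfolding pure_eq by (intro bilinear_maps_closed[OF tR_bilinear] tC_closed t2_closed) simp_all

lemma pure_linear_R: "\<lbrakk>c1 \<in> carrier C1; c2 \<in> carrier C2; f \<in> RT_lists\<rbrakk> \<Longrightarrow>
    (\<lambda>x. pure x c1 c2 f) \<in> linear_maps C R_alg IDR"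
  unfolding pure_eq by (intro bilinear_maps_left[OF tR_bilinear] tC_closed t2_closed)

lemma pure_linear_C1: "\<lbrakk>x \<in> carrier R; c2 \<in> carrier C2; f \<in> RT_lists\<rbrakk> \<Longrightarrow>
    (\<lambda>c1. pure x c1 c2 f) \<in> linear_maps C C1 IDR"
  unfolding pure_eq
  by (intro linear_maps_comp[OF bilinear_maps_right[OF tR_bilinear]] bilinear_maps_left[OF tC_bilinear] t2_closed) simp_all

lemma pure_linear_C2: "\<lbrakk>x \<in> carrier R; c1 \<in> carrier C1; f \<in> RT_lists\<rbrakk> \<Longrightarrow>
    (\<lambda>c2. pure x c1 c2 f) \<in> linear_maps C C2 IDR"
  unfolding pure_eq
  by (intro linear_maps_comp[OF bilinear_maps_right[OF tR_bilinear]]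
      linear_maps_comp[OF bilinear_maps_right[OF tC_bilinear]] bilinear_maps_left[OF t2_bilinear] w_closed) simp_all

lemma pure_slot: "\<lbrakk>x \<in> carrier R; c1 \<in> carrier C1; c2 \<in> carrier C2; xs \<in> RT_lists; ys \<in> RT_lists\<rbrakk> \<Longrightarrow>
    (\<lambda>y. pure x c1 c2 (xs @ y # ys)) \<in> linear_maps C RT IDR"
  unfolding pure_eq
  by (intro linear_maps_comp[OF bilinear_maps_right[OF tR_bilinear]]
      linear_maps_comp[OF bilinear_maps_right[OF tC_bilinear]]
      linear_maps_comp[OF bilinear_maps_right[OF t2_bilinear]] w_slot) simp_all

lemma pure_mult_Nil:
  assumes "x \<in> carrier R" "y \<in> carrier R" "c \<in> carrier C1" "d \<in> carrier C1"
    "c' \<in> carrier C2" "d' \<in> carrier C2" "g \<in> RT_lists"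
  shows "pure x c c' [] \<otimes>\<^bsub>IDR\<^esub> pure y d d' g = pure (x \<otimes> y) (c \<otimes>\<^bsub>C1\<^esub> d) (c' \<otimes>\<^bsub>C2\<^esub> d') g"
  using assms by (simp add: pure_eq IDR_mult CT_mult C2T_mult_Nil tC_closed t2_closed)


subsection \<open>Derivation and integral on pure tensors\<close>

lemma R_mult_linear: "x \<in> carrier R \<Longrightarrow> (\<lambda>y. x \<otimes> y) \<in> linear_maps C R_alg R_alg"
  "x \<in> carrier R \<Longrightarrow> (\<lambda>y. y \<otimes> x) \<in> linear_maps C R_alg R_alg"
  using bilinear_maps_right[OF R_bilinear] bilinear_maps_left[OF R_bilinear] by simp_all

lemma RT_into_R: "x \<in> carrier RT \<Longrightarrow> x \<in> carrier R"
  by (simp add: RT_carrier)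

fun der_pure where
  "der_pure x c c' [] = pure (der x) c c' []"
| "der_pure x c c' (y # f) = pure (der x) c c' (y # f) \<oplus>\<^bsub>IDR\<^esub> pure (x \<otimes> y) c c' f"

lemma
  shows IDR_der_linear: "IDR_der \<in> linear_maps C IDR IDR"
    and IDR_der_pure: "\<lbrakk>x \<in> carrier R; c \<in> carrier C1; c' \<in> carrier C2; f \<in> RT_lists\<rbrakk> \<Longrightarrow>
      IDR_der (pure x c c' f) = der_pure x c c' f"
proof -
  interpret P: module C IDR by (rule IDR_module)
  have cl: "der_pure x c c' f \<in> carrier IDR"
    if "x \<in> carrier R" "c \<in> carrier C1" "c' \<in> carrier C2" "f \<in> RT_lists" for x c c' f
    using that by (cases f) (auto intro!: P.M.a_closed pure_closed der_closed simp: RT_into_R)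
  have "\<exists>h\<in>linear_maps C IDR IDR. \<forall>x\<in>carrier R. \<forall>c\<in>carrier C1. \<forall>c'\<in>carrier C2. \<forall>f\<in>RT_lists.
    h (pure x c c' f) = der_pure x c c' f"
  proof (rule IDR_lift[OF IDR_module])
    fix x c c' assume xc: "x \<in> carrier R" "c \<in> carrier C1" "c' \<in> carrier C2"
    show "word_multilinear C RT IDR (der_pure x c c')"
    proof (rule word_multilinearI)
      show "der_pure x c c' [] \<in> carrier IDR" by (rule cl[OF xc]) simp
      fix xs ys assume xs: "xs \<in> RT_lists" and ys: "ys \<in> RT_lists"
      show "(\<lambda>y. der_pure x c c' (xs @ y # ys)) \<in> linear_maps C RT IDR"
      proof (cases xs)
        case Nil
        have "(\<lambda>y. pure (der x) c c' ([] @ y # ys) \<oplus>\<^bsub>IDR\<^esub> pure (x \<otimes> y) c c' ys) \<in> linear_maps C RT IDR"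
          using xc ys by (intro linear_maps_sum pure_slot IDR_module der_closed
              linear_maps_comp[OF pure_linear_R] linear_maps_RT_restrict R_mult_linear) auto
        then show ?thesis by (simp add: Nil)
      next
        case (Cons a as)
        with xs have a: "a \<in> carrier RT" "as \<in> RT_lists" by auto
        have "(\<lambda>y. pure (der x) c c' ((a # as) @ y # ys) \<oplus>\<^bsub>IDR\<^esub> pure (x \<otimes> a) c c' (as @ y # ys)) \<in> linear_maps C RT IDR"
          using xc ys a by (intro linear_maps_sum pure_slot IDR_module der_closed m_closed) (auto intro: RT_into_R)
        then show ?thesis by (simp add: Cons)
      qed
    qed
  next
    fix x c f assume *: "x \<in> carrier R" "c \<in> carrier C1" "f \<in> RT_lists"
    then show "(\<lambda>c'. der_pure x c c' f) \<in> linear_maps C C2 IDR"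
      by (cases f) (auto simp: RT_into_R Q_closed der_closed intro!: linear_maps_sum pure_linear_C2 IDR_module der_closed m_closed)
  next
    fix x c' f assume *: "x \<in> carrier R" "c' \<in> carrier C2" "f \<in> RT_lists"
    then show "(\<lambda>c. der_pure x c c' f) \<in> linear_maps C C1 IDR"
      by (cases f) (auto simp: RT_into_R Q_closed der_closed intro!: linear_maps_sum pure_linear_C1 IDR_module der_closed m_closed)
  next
    fix c c' f assume *: "c \<in> carrier C1" "c' \<in> carrier C2" "f \<in> RT_lists"
    then show "(\<lambda>x. der_pure x c c' f) \<in> linear_maps C R_alg IDR"
      by (cases f) (auto simp: RT_into_R Q_closed der_closed intro!: linear_maps_sum linear_maps_comp[OF pure_linear_R] IDR_module
          R_mult_linear der_linear pure_linear_R)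
  qed
  then obtain D where D: "D \<in> linear_maps C IDR IDR"
    "\<And>x c c' f. \<lbrakk>x \<in> carrier R; c \<in> carrier C1; c' \<in> carrier C2; f \<in> RT_lists\<rbrakk> \<Longrightarrow>
      D (pure x c c' f) = der_pure x c c' f" by blast
  let ?P = "\<lambda>D. D \<in> linear_maps C IDR IDR \<and>
     (\<forall>x\<in>carrier R. \<forall>c1\<in>carrier C1. \<forall>c2\<in>carrier C2.
        D (pure x c1 c2 []) = pure (der x) c1 c2 [] \<and>
        (\<forall>y\<in>carrier RT. \<forall>f\<in>RT_lists.
           D (pure x c1 c2 (y # f)) = pure (der x) c1 c2 (y # f) \<oplus>\<^bsub>IDR\<^esub> pure (x \<otimes> y) c1 c2 f))"
  have "?P D" using D by simp
  then have P: "?P IDR_der" unfolding IDR_der_def by (rule someI[of ?P])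
  then show "IDR_der \<in> linear_maps C IDR IDR" by blast
  assume "x \<in> carrier R" "c \<in> carrier C1" "c' \<in> carrier C2" "f \<in> RT_lists"
  with P show "IDR_der (pure x c c' f) = der_pure x c c' f" by (cases f) auto
qed

text \<open>
  With the integral of pure tensors given by recursion over the word, its multilinearity can be
  shown by induction over the word, before there is a linear map to speak of.
\<close>

fun itg_pure where
  "itg_pure x c c' [] = pure (Q x) c c' [] \<oplus>\<^bsub>IDR\<^esub> pure \<one> c c' [x \<ominus> der (Q x)]"
| "itg_pure x c c' (y # f) =
     pure (Q x) c c' (y # f)
     \<ominus>\<^bsub>IDR\<^esub> pure \<one> (c \<otimes>\<^bsub>C1\<^esub> eps1 (Q x) (w (y # f))) c' []
     \<ominus>\<^bsub>IDR\<^esub> itg_pure (Q x \<otimes> y) c c' f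
     \<oplus>\<^bsub>IDR\<^esub> pure \<one> c c' ((x \<ominus> der (Q x)) # y # f)"

lemma eps1_closed: "x \<in> carrier R \<Longrightarrow> f \<in> RT_lists \<Longrightarrow> f \<noteq> [] \<Longrightarrow> eps1 (Q x) (w f) \<in> carrier C1"
  by (intro bilinear_maps_closed[OF eps1_bilinear] w_pos) auto

lemma eps2_closed: "\<lbrakk>f \<in> RT_lists; f \<noteq> []; g \<in> RT_lists; g \<noteq> []\<rbrakk> \<Longrightarrow> eps2 (w f) (w g) \<in> carrier C2"
  by (intro bilinear_maps_closed[OF eps2_bilinear] w_pos)

lemma itg_pure_closed:
  "\<lbrakk>x \<in> carrier R; c \<in> carrier C1; c' \<in> carrier C2; f \<in> RT_lists\<rbrakk> \<Longrightarrow> itg_pure x c c' f \<in> carrier IDR"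
proof -
  interpret P: module C IDR by (rule IDR_module)
  show "\<lbrakk>x \<in> carrier R; c \<in> carrier C1; c' \<in> carrier C2; f \<in> RT_lists\<rbrakk> \<Longrightarrow> itg_pure x c c' f \<in> carrier IDR"
    by (induction f arbitrary: x rule: list.induct)
       (auto simp: RT_into_R Q_closed der_closed intro!: P.M.a_closed pure_closed Q_closed transcendental_part P.M.minus_closed m_closed
         bilinear_maps_closed[OF C1_bilinear] eps1_closed)
qed

lemma itg_pure_linear_C2:
  "\<lbrakk>x \<in> carrier R; c \<in> carrier C1; f \<in> RT_lists\<rbrakk> \<Longrightarrow> (\<lambda>c'. itg_pure x c c' f) \<in> linear_maps C C2 IDR"
  by (induction f arbitrary: x rule: list.induct)
     (auto simp: RT_into_R Q_closed der_closed intro!: linear_maps_sum linear_maps_diff pure_linear_C2 IDR_module Q_closed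
        transcendental_part m_closed bilinear_maps_closed[OF C1_bilinear] eps1_closed)

lemma itg_pure_linear_C1:
  "\<lbrakk>x \<in> carrier R; c' \<in> carrier C2; f \<in> RT_lists\<rbrakk> \<Longrightarrow> (\<lambda>c. itg_pure x c c' f) \<in> linear_maps C C1 IDR"
  by (induction f arbitrary: x rule: list.induct)
     (auto simp: RT_into_R Q_closed der_closed intro!: linear_maps_sum linear_maps_diff pure_linear_C1 IDR_module Q_closed
        transcendental_part m_closed linear_maps_comp[OF pure_linear_C1 bilinear_maps_left[OF C1_bilinear]]
        eps1_closed)

lemma itg_pure_linear_R:
  assumes c: "c \<in> carrier C1" and c': "c' \<in> carrier C2" and f: "f \<in> RT_lists"
  shows "(\<lambda>x. itg_pure x c c' f) \<in> linear_maps C R_alg IDR"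
  using f
proof (induction f rule: list.induct)
  case Nil
  have "(\<lambda>x. pure \<one> c c' ([] @ (x \<ominus> der (Q x)) # [])) \<in> linear_maps C R_alg IDR"
    using c c' by (intro linear_maps_comp[OF pure_slot transcendental_part_linear]) auto
  then show ?case
    using c c' by (auto intro!: linear_maps_sum linear_maps_comp[OF pure_linear_R Q_linear] IDR_module)
next
  case (Cons y f)
  then have y: "y \<in> carrier RT" and f: "f \<in> RT_lists" by auto
  have 1: "(\<lambda>x. pure \<one> c c' ([] @ (x \<ominus> der (Q x)) # (y # f))) \<in> linear_maps C R_alg IDR"
    using c c' y f by (intro linear_maps_comp[OF pure_slot transcendental_part_linear]) auto
  have 2: "(\<lambda>x. pure \<one> (c \<otimes>\<^bsub>C1\<^esub> eps1 (Q x) (w (y # f))) c' []) \<in> linear_maps C R_alg IDR"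
    using c c' y f
    by (intro linear_maps_comp[OF pure_linear_C1] linear_maps_comp[OF bilinear_maps_right[OF C1_bilinear]]
       linear_maps_comp[OF bilinear_maps_left[OF eps1_bilinear] Q_linear_RJ] w_pos) auto
  have 3: "(\<lambda>x. itg_pure (Q x \<otimes> y) c c' f) \<in> linear_maps C R_alg IDR"
    by (rule linear_maps_comp[OF Cons.IH[OF f] linear_maps_comp[OF R_mult_linear(2) Q_linear]])
       (rule RT_into_R[OF y])
  have 4: "(\<lambda>x. pure (Q x) c c' (y # f)) \<in> linear_maps C R_alg IDR"
    using c c' y f by (intro linear_maps_comp[OF pure_linear_R Q_linear]) auto
  show ?case
    using linear_maps_sum[OF linear_maps_diff[OF linear_maps_diff[OF 4 2 IDR_module] 3 IDR_module] 1 IDR_module]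
    by simp
qed

lemma itg_pure_multilinear:
  assumes x: "x \<in> carrier R" and c: "c \<in> carrier C1" and c': "c' \<in> carrier C2"
  shows "word_multilinear C RT IDR (itg_pure x c c')"
proof (rule word_multilinearI)
  show "itg_pure x c c' [] \<in> carrier IDR" by (rule itg_pure_closed[OF x c c']) simp
  fix xs ys assume xs: "xs \<in> RT_lists" and ys: "ys \<in> RT_lists"
  from xs x show "(\<lambda>z. itg_pure x c c' (xs @ z # ys)) \<in> linear_maps C RT IDR"
  proof (induction xs arbitrary: x rule: list.induct)
    case Nil
    then have x: "x \<in> carrier R" by simp
    have Qx: "Q x \<in> carrier RJ" using x by simp
    have 1: "(\<lambda>z. pure \<one> c c' ([x \<ominus> der (Q x)] @ z # ys)) \<in> linear_maps C RT IDR"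
      using c c' ys transcendental_part[OF x] by (intro pure_slot) auto
    have 2: "(\<lambda>z. pure \<one> (c \<otimes>\<^bsub>C1\<^esub> eps1 (Q x) (w ([] @ z # ys))) c' []) \<in> linear_maps C RT IDR"
      using c c' ys Qx
      by (intro linear_maps_comp[OF pure_linear_C1] linear_maps_comp[OF bilinear_maps_right[OF C1_bilinear]]
         linear_maps_comp[OF bilinear_maps_right[OF eps1_bilinear]] w_pos_slot) auto
    have 3: "(\<lambda>z. itg_pure (Q x \<otimes> z) c c' ys) \<in> linear_maps C RT IDR"
      using c c' ys Q_closed[OF x]
      by (intro linear_maps_comp[OF itg_pure_linear_R] linear_maps_RT_restrict R_mult_linear)
    have 4: "(\<lambda>z. pure (Q x) c c' ([] @ z # ys)) \<in> linear_maps C RT IDR"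
      using c c' ys Q_closed[OF x] by (intro pure_slot) auto
    show ?case
      using linear_maps_sum[OF linear_maps_diff[OF linear_maps_diff[OF 4 2 IDR_module] 3 IDR_module] 1 IDR_module]
      by simp
  next
    case (Cons a as)
    then have x: "x \<in> carrier R" and a: "a \<in> carrier RT" and as: "as \<in> RT_lists" by auto
    have Qx: "Q x \<in> carrier RJ" using x by simp
    have 1: "(\<lambda>z. pure \<one> c c' (((x \<ominus> der (Q x)) # a # as) @ z # ys)) \<in> linear_maps C RT IDR"
      using c c' ys transcendental_part[OF x] a as by (intro pure_slot) auto
    have 2: "(\<lambda>z. pure \<one> (c \<otimes>\<^bsub>C1\<^esub> eps1 (Q x) (w ((a # as) @ z # ys))) c' []) \<in> linear_maps C RT IDR"
      using c c' ys Qx a as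
      by (intro linear_maps_comp[OF pure_linear_C1] linear_maps_comp[OF bilinear_maps_right[OF C1_bilinear]]
         linear_maps_comp[OF bilinear_maps_right[OF eps1_bilinear]] w_pos_slot) auto
    have 3: "(\<lambda>z. itg_pure (Q x \<otimes> a) c c' (as @ z # ys)) \<in> linear_maps C RT IDR"
      by (rule Cons.IH[OF as]) (use x a Q_closed RT_into_R in auto)
    have 4: "(\<lambda>z. pure (Q x) c c' ((a # as) @ z # ys)) \<in> linear_maps C RT IDR"
      using c c' ys Q_closed[OF x] a as by (intro pure_slot) auto
    show ?case
      using linear_maps_sum[OF linear_maps_diff[OF linear_maps_diff[OF 4 2 IDR_module] 3 IDR_module] 1 IDR_module]
      by simp
  qed
qed

lemma
  shows IDR_itg_linear: "IDR_itg \<in> linear_maps C IDR IDR"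
    and IDR_itg_pure: "\<lbrakk>x \<in> carrier R; c \<in> carrier C1; c' \<in> carrier C2; f \<in> RT_lists\<rbrakk> \<Longrightarrow>
      IDR_itg (pure x c c' f) = itg_pure x c c' f"
proof -
  have "\<exists>h\<in>linear_maps C IDR IDR. \<forall>x\<in>carrier R. \<forall>c\<in>carrier C1. \<forall>c'\<in>carrier C2. \<forall>f\<in>RT_lists.
    h (pure x c c' f) = itg_pure x c c' f"
    by (rule IDR_lift[OF IDR_module itg_pure_multilinear itg_pure_linear_C2 itg_pure_linear_C1 itg_pure_linear_R])
  then obtain I where I: "I \<in> linear_maps C IDR IDR"
    "\<And>x c c' f. \<lbrakk>x \<in> carrier R; c \<in> carrier C1; c' \<in> carrier C2; f \<in> RT_lists\<rbrakk> \<Longrightarrow>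
      I (pure x c c' f) = itg_pure x c c' f" by blast
  let ?P = "\<lambda>I. I \<in> linear_maps C IDR IDR \<and>
     (\<forall>x\<in>carrier R. \<forall>c1\<in>carrier C1. \<forall>c2\<in>carrier C2.
        I (pure x c1 c2 []) =
          pure (Q x) c1 c2 [] \<oplus>\<^bsub>IDR\<^esub> pure \<one> c1 c2 [x \<ominus> der (Q x)] \<and>
        (\<forall>y\<in>carrier RT. \<forall>f\<in>RT_lists.
           I (pure x c1 c2 (y # f)) =
             pure (Q x) c1 c2 (y # f)
             \<ominus>\<^bsub>IDR\<^esub> pure \<one> (c1 \<otimes>\<^bsub>C1\<^esub> eps1 (Q x) (w (y # f))) c2 []
             \<ominus>\<^bsub>IDR\<^esub> I (pure (Q x \<otimes> y) c1 c2 f)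
             \<oplus>\<^bsub>IDR\<^esub> pure \<one> c1 c2 ((x \<ominus> der (Q x)) # y # f)))"
  have "?P I" using I by (simp add: RT_into_R Q_closed)
  then have P: "?P IDR_itg" unfolding IDR_itg_def by (rule someI[of ?P])
  then show "IDR_itg \<in> linear_maps C IDR IDR" by blast
  assume c: "c \<in> carrier C1" "c' \<in> carrier C2"
  assume "x \<in> carrier R" "f \<in> RT_lists"
  then show "IDR_itg (pure x c c' f) = itg_pure x c c' f"
  proof (induction f arbitrary: x)
    case Nil
    with P c show ?case by simp
  next
    case (Cons y f)
    then have *: "IDR_itg (pure (Q x \<otimes> y) c c' f) = itg_pure (Q x \<otimes> y) c c' f"
      by (intro Cons.IH) (auto simp: Q_closed RT_into_R)
    have "x \<in> carrier R" "y \<in> carrier RT" "f \<in> RT_lists" using Cons.prems by auto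
    with P c have "IDR_itg (pure x c c' (y # f)) = pure (Q x) c c' (y # f)
             \<ominus>\<^bsub>IDR\<^esub> pure \<one> (c \<otimes>\<^bsub>C1\<^esub> eps1 (Q x) (w (y # f))) c' []
             \<ominus>\<^bsub>IDR\<^esub> IDR_itg (pure (Q x \<otimes> y) c c' f)
             \<oplus>\<^bsub>IDR\<^esub> pure \<one> c c' ((x \<ominus> der (Q x)) # y # f)" by blast
    with * show ?case by simp
  qed
qed

end

section \<open>Nested integrals in an integro-differential ring\<close>

context integro_diff_cring
begin

text \<open>
  Evaluation, the projection onto the constants along the image of the integral.  It need not be
  multiplicative; the constants adjoined to the free ring stand for its values on products.
\<close>

definition ev :: "'a \<Rightarrow> 'a" where
  "ev x = x \<ominus> itg (der x)"

lemma ev_closed: "x \<in> carrier R \<Longrightarrow> ev x \<in> carrier R"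
  by (simp add: ev_def itg_closed der_closed)

lemma ev_add: "x \<in> carrier R \<Longrightarrow> y \<in> carrier R \<Longrightarrow> ev (x \<oplus> y) = ev x \<oplus> ev y"
  by (simp add: ev_def itg_closed der_closed der_add itg_add a_minus_def minus_add a_ac)

lemma der_const_mult: "c \<in> constants R der \<Longrightarrow> x \<in> carrier R \<Longrightarrow> der (c \<otimes> x) = c \<otimes> der x"
  by (simp add: der_mult constantsD der_closed)

lemma ev_const_mult: "c \<in> constants R der \<Longrightarrow> x \<in> carrier R \<Longrightarrow> ev (c \<otimes> x) = c \<otimes> ev x"
  by (simp add: ev_def der_const_mult itg_const constantsD itg_closed der_closed a_minus_def r_distr r_minus)

lemma ev_constant: "x \<in> carrier R \<Longrightarrow> ev x \<in> constants R der"
  unfolding constants_def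
  by (simp add: ev_closed) (simp add: ev_def a_minus_def der_add der_uminus itg_closed der_closed der_itg r_neg)

lemma ev_itg: "x \<in> carrier R \<Longrightarrow> ev (itg x) = \<zero>"
  by (simp add: ev_def der_itg itg_closed a_minus_def r_neg)

lemma ev_decomposition: "x \<in> carrier R \<Longrightarrow> x = ev x \<oplus> itg (der x)"
  by (simp add: ev_def itg_closed der_closed a_minus_def a_assoc l_neg)

end

lemma (in abelian_monoid) finsum_Suc_shift:
  assumes "f \<in> {0..<Suc n} \<rightarrow> carrier G"
  shows "(\<Oplus>i\<in>{0..<Suc n}. f i) = f 0 \<oplus> (\<Oplus>i\<in>{0..<n}. f (Suc i))"
  using assms
proof (induction n)
  case 0
  then show ?case by (simp add: Pi_iff)
next
  case (Suc n)
  then have f: "\<And>i. i \<le> Suc n \<Longrightarrow> f i \<in> carrier G" by (auto simp: Pi_iff)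
  have IH: "(\<Oplus>i\<in>{0..<Suc n}. f i) = f 0 \<oplus> (\<Oplus>i\<in>{0..<n}. f (Suc i))"
    by (rule Suc.IH) (use f in auto)
  have "(\<Oplus>i\<in>{0..<Suc (Suc n)}. f i) = f (Suc n) \<oplus> (\<Oplus>i\<in>{0..<Suc n}. f i)"
    using f by (subst atLeast0_lessThan_Suc, intro finsum_insert) auto
  also have "\<dots> = f 0 \<oplus> (f (Suc n) \<oplus> (\<Oplus>i\<in>{0..<n}. f (Suc i)))"
    unfolding IH using f by (intro a_lcomm finsum_closed) auto
  also have "f (Suc n) \<oplus> (\<Oplus>i\<in>{0..<n}. f (Suc i)) = (\<Oplus>i\<in>{0..<Suc n}. f (Suc i))"
    using f by (subst atLeast0_lessThan_Suc, intro finsum_insert[symmetric]) auto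
  finally show ?case .
qed

text \<open>
  The points of a grid that are off both axes count for \<open>X\<close> and for \<open>Y\<close>, those on one axis for one
  of them, and the corner for none.  With prefixes of two words as the points, this is the
  recursion of the shuffle product.
\<close>

lemma (in abelian_monoid) finsum_grid:
  assumes A00: "A 0 0 \<in> carrier G"
    and X: "\<And>i j. i < n \<Longrightarrow> j < Suc m \<Longrightarrow> X i j \<in> carrier G"
    and Y: "\<And>i j. i < Suc n \<Longrightarrow> j < m \<Longrightarrow> Y i j \<in> carrier G"
    and inner: "\<And>i j. i < n \<Longrightarrow> j < m \<Longrightarrow> A (Suc i) (Suc j) = X i (Suc j) \<oplus> Y (Suc i) j"
    and left: "\<And>i. i < n \<Longrightarrow> A (Suc i) 0 = X i 0"
    and bottom: "\<And>j. j < m \<Longrightarrow> A 0 (Suc j) = Y 0 j"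
  shows "(\<Oplus>i\<in>{0..<Suc n}. \<Oplus>j\<in>{0..<Suc m}. A i j) =
    A 0 0 \<oplus> ((\<Oplus>i\<in>{0..<n}. \<Oplus>j\<in>{0..<Suc m}. X i j) \<oplus> (\<Oplus>i\<in>{0..<Suc n}. \<Oplus>j\<in>{0..<m}. Y i j))"
proof -
  have Ac: "A i j \<in> carrier G" if "i < Suc n" "j < Suc m" for i j
    using that A00 by (cases i; cases j) (auto simp: inner left bottom intro!: a_closed X Y)
  have row0: "(\<Oplus>j\<in>{0..<Suc m}. A 0 j) = A 0 0 \<oplus> (\<Oplus>j\<in>{0..<m}. Y 0 j)"
    by (subst finsum_Suc_shift) (auto intro!: Ac Y finsum_cong' arg_cong2[of _ _ _ _ "(\<oplus>)"] simp: bottom)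
  have row: "(\<Oplus>j\<in>{0..<Suc m}. A (Suc i) j) = (\<Oplus>j\<in>{0..<Suc m}. X i j) \<oplus> (\<Oplus>j\<in>{0..<m}. Y (Suc i) j)"
    if i: "i < n" for i
  proof -
    have "(\<Oplus>j\<in>{0..<Suc m}. A (Suc i) j) = A (Suc i) 0 \<oplus> (\<Oplus>j\<in>{0..<m}. A (Suc i) (Suc j))"
      by (rule finsum_Suc_shift) (use i Ac in auto)
    also have "(\<Oplus>j\<in>{0..<m}. A (Suc i) (Suc j)) = (\<Oplus>j\<in>{0..<m}. X i (Suc j) \<oplus> Y (Suc i) j)"
      by (rule finsum_cong') (use i X Y inner in auto)
    also have "\<dots> = (\<Oplus>j\<in>{0..<m}. X i (Suc j)) \<oplus> (\<Oplus>j\<in>{0..<m}. Y (Suc i) j)"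
      by (rule finsum_addf) (use i X Y in auto)
    also have "A (Suc i) 0 \<oplus> \<dots> = (X i 0 \<oplus> (\<Oplus>j\<in>{0..<m}. X i (Suc j))) \<oplus> (\<Oplus>j\<in>{0..<m}. Y (Suc i) j)"
      unfolding left[OF i] by (rule a_assoc[symmetric]) (use i X Y in \<open>auto intro!: finsum_closed\<close>)
    also have "X i 0 \<oplus> (\<Oplus>j\<in>{0..<m}. X i (Suc j)) = (\<Oplus>j\<in>{0..<Suc m}. X i j)"
      by (rule finsum_Suc_shift[symmetric]) (use i X in auto)
    finally show ?thesis .
  qed
  have Xc: "(\<Oplus>j\<in>{0..<Suc m}. X i j) \<in> carrier G" if "i < n" for i
    using that X by (intro finsum_closed) auto
  have Yc: "(\<Oplus>j\<in>{0..<m}. Y i j) \<in> carrier G" if "i < Suc n" for i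
    using that Y by (intro finsum_closed) auto
  have "(\<Oplus>i\<in>{0..<Suc n}. \<Oplus>j\<in>{0..<Suc m}. A i j) =
      (\<Oplus>j\<in>{0..<Suc m}. A 0 j) \<oplus> (\<Oplus>i\<in>{0..<n}. \<Oplus>j\<in>{0..<Suc m}. A (Suc i) j)"
    by (rule finsum_Suc_shift) (use Ac in \<open>auto intro!: finsum_closed\<close>)
  also have "(\<Oplus>i\<in>{0..<n}. \<Oplus>j\<in>{0..<Suc m}. A (Suc i) j) =
      (\<Oplus>i\<in>{0..<n}. (\<Oplus>j\<in>{0..<Suc m}. X i j) \<oplus> (\<Oplus>j\<in>{0..<m}. Y (Suc i) j))"
    by (rule finsum_cong') (use row Xc Yc in auto)
  also have "\<dots> = (\<Oplus>i\<in>{0..<n}. \<Oplus>j\<in>{0..<Suc m}. X i j) \<oplus> (\<Oplus>i\<in>{0..<n}. \<Oplus>j\<in>{0..<m}. Y (Suc i) j)"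
    by (rule finsum_addf) (use Xc Yc in auto)
  also have "(\<Oplus>j\<in>{0..<Suc m}. A 0 j) \<oplus> \<dots> = A 0 0 \<oplus> ((\<Oplus>i\<in>{0..<n}. \<Oplus>j\<in>{0..<Suc m}. X i j) \<oplus>
      ((\<Oplus>j\<in>{0..<m}. Y 0 j) \<oplus> (\<Oplus>i\<in>{0..<n}. \<Oplus>j\<in>{0..<m}. Y (Suc i) j)))"
  proof -
    have "a \<oplus> b \<oplus> (c \<oplus> d) = a \<oplus> (c \<oplus> (b \<oplus> d))"
      if "a \<in> carrier G" "b \<in> carrier G" "c \<in> carrier G" "d \<in> carrier G" for a b c d
      using that by (simp add: a_ac)
    moreover have "(\<Oplus>i\<in>{0..<n}. \<Oplus>j\<in>{0..<Suc m}. X i j) \<in> carrier G"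
      "(\<Oplus>i\<in>{0..<n}. \<Oplus>j\<in>{0..<m}. Y (Suc i) j) \<in> carrier G"
      using Xc Yc by (auto intro!: finsum_closed)
    ultimately show ?thesis
      unfolding row0 using A00 Yc[of 0] by blast
  qed
  also have "(\<Oplus>j\<in>{0..<m}. Y 0 j) \<oplus> (\<Oplus>i\<in>{0..<n}. \<Oplus>j\<in>{0..<m}. Y (Suc i) j) =
      (\<Oplus>i\<in>{0..<Suc n}. \<Oplus>j\<in>{0..<m}. Y i j)"
    by (rule finsum_Suc_shift[symmetric]) (use Yc in auto)
  finally show ?thesis .
qed

text \<open>
  The ring homomorphism \<open>phi\<close> turns \<open>S\<close> into an algebra over the constants of \<open>R\<close>, below called
  \<open>S_alg\<close>.
\<close>

locale integro_diff_target =
  quasi_integro_diff_cring R der Q + S: integro_diff_cring S derS itgS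
  for R :: "('a, 'm) ring_scheme" (structure) and der Q
    and S :: "('b, 'n) ring_scheme" and derS itgS +
  fixes phi :: "'a \<Rightarrow> 'b"
  assumes phi_hom: "phi \<in> diff_ring_hom R der S derS"
    and phi_Q_der: "x \<in> carrier R \<Longrightarrow> phi (Q (der x)) = itgS (derS (phi x))"
begin

lemma phi_ring_hom: "phi \<in> ring_hom R S"
  and phi_der: "x \<in> carrier R \<Longrightarrow> phi (der x) = derS (phi x)"
  using phi_hom by (auto simp: diff_ring_hom_def)

lemma phi_closed: "x \<in> carrier R \<Longrightarrow> phi x \<in> carrier S"
  and phi_mult: "x \<in> carrier R \<Longrightarrow> y \<in> carrier R \<Longrightarrow> phi (x \<otimes> y) = phi x \<otimes>\<^bsub>S\<^esub> phi y"
  and phi_add: "x \<in> carrier R \<Longrightarrow> y \<in> carrier R \<Longrightarrow> phi (x \<oplus> y) = phi x \<oplus>\<^bsub>S\<^esub> phi y"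
  and phi_one: "phi \<one> = \<one>\<^bsub>S\<^esub>"
  using phi_ring_hom by (auto simp: ring_hom_def)

lemma phi_zero: "phi \<zero> = \<zero>\<^bsub>S\<^esub>"
  by (rule ring_hom_zero[OF phi_ring_hom ring_axioms S.ring_axioms])

lemma phi_constant: "c \<in> constants R der \<Longrightarrow> phi c \<in> constants S derS"
  by (simp add: constants_def phi_closed phi_der[symmetric] phi_zero)

definition S_alg :: "('a, 'b) module" where
  "S_alg = \<lparr>carrier = carrier S, monoid.mult = monoid.mult S, one = \<one>\<^bsub>S\<^esub>,
     zero = \<zero>\<^bsub>S\<^esub>, add = add S, smult = (\<lambda>c s. phi c \<otimes>\<^bsub>S\<^esub> s)\<rparr>"

lemma S_alg_simps [simp]:
  "carrier S_alg = carrier S" "monoid.mult S_alg = monoid.mult S" "one S_alg = \<one>\<^bsub>S\<^esub>"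
  "zero S_alg = \<zero>\<^bsub>S\<^esub>" "add S_alg = add S" "smult S_alg = (\<lambda>c s. phi c \<otimes>\<^bsub>S\<^esub> s)"
  by (simp_all add: S_alg_def)

lemma S_alg_derived [simp]: "finsum S_alg = finsum S" "a_inv S_alg x = a_inv S x" "a_minus S_alg x y = a_minus S x y"
  by (auto simp: finsum_def finprod_def a_inv_def m_inv_def a_minus_def fun_eq_iff)

lemma S_algebra: "algebra C S_alg"
proof (rule algebraI[OF C_cring])
  show "cring S_alg" by (rule cring_record_cong[OF S.is_cring]) simp_all
qed (auto simp: phi_closed constantsD phi_add phi_mult phi_one S.l_distr S.r_distr S.m_assoc)

lemma S_module: "module C S_alg"
  by (rule algebra_module[OF S_algebra])

lemma S_bilinear: "monoid.mult S \<in> bilinear_maps C S_alg S_alg S_alg"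
  using algebra_mult_bilinear[OF S_algebra] by simp

lemma phi_linear: "phi \<in> linear_maps C R_alg S_alg"
  by (rule linear_mapsI) (auto simp: phi_closed phi_add phi_mult constantsD)

lemma itgS_linear: "itgS \<in> linear_maps C S_alg S_alg"
  by (rule linear_mapsI) (auto simp: S.itg_closed S.itg_add S.itg_const phi_constant)

lemma derS_linear: "derS \<in> linear_maps C S_alg S_alg"
  by (rule linear_mapsI) (auto simp: S.der_closed S.der_add S.der_const_mult phi_constant)

lemma ev_linear: "S.ev \<in> linear_maps C S_alg S_alg"
  by (rule linear_mapsI) (auto simp: S.ev_closed S.ev_add S.ev_const_mult phi_constant)

text \<open>
  Integration against a letter, evaluation of the product with a fixed factor, and multiplication
  by a constant are maps of this kind; each is applied to a product formula.
\<close>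

lemma constant_linear_finsum:
  assumes E: "E \<in> linear_maps C S_alg S_alg"
    and Ec: "\<And>c s. c \<in> constants S derS \<Longrightarrow> s \<in> carrier S \<Longrightarrow> E (c \<otimes>\<^bsub>S\<^esub> s) = c \<otimes>\<^bsub>S\<^esub> E s"
    and a: "a \<in> carrier S" and c: "\<And>i j. c i j \<in> constants S derS" and s: "\<And>i j. s i j \<in> carrier S"
  shows "E (a \<oplus>\<^bsub>S\<^esub> (\<Oplus>\<^bsub>S\<^esub>i\<in>I. \<Oplus>\<^bsub>S\<^esub>j\<in>I'. c i j \<otimes>\<^bsub>S\<^esub> s i j)) =
    E a \<oplus>\<^bsub>S\<^esub> (\<Oplus>\<^bsub>S\<^esub>i\<in>I. \<Oplus>\<^bsub>S\<^esub>j\<in>I'. c i j \<otimes>\<^bsub>S\<^esub> E (s i j))"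
proof -
  note fin = linear_maps_finsum[OF E S_module S_module, simplified]
  have cl: "c i j \<otimes>\<^bsub>S\<^esub> s i j \<in> carrier S" for i j
    by (intro S.m_closed S.constantsD(1)[OF c] s)
  have "E (\<Oplus>\<^bsub>S\<^esub>i\<in>I. \<Oplus>\<^bsub>S\<^esub>j\<in>I'. c i j \<otimes>\<^bsub>S\<^esub> s i j) = (\<Oplus>\<^bsub>S\<^esub>i\<in>I. \<Oplus>\<^bsub>S\<^esub>j\<in>I'. c i j \<otimes>\<^bsub>S\<^esub> E (s i j))"
    using cl by (simp add: fin S.finsum_closed Pi_iff Ec[OF c s])
  moreover have "(\<Oplus>\<^bsub>S\<^esub>i\<in>I. \<Oplus>\<^bsub>S\<^esub>j\<in>I'. c i j \<otimes>\<^bsub>S\<^esub> s i j) \<in> carrier S"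
    using cl by (simp add: S.finsum_closed Pi_iff)
  ultimately show ?thesis
    using linear_maps_add[OF E, of a "\<Oplus>\<^bsub>S\<^esub>i\<in>I. \<Oplus>\<^bsub>S\<^esub>j\<in>I'. c i j \<otimes>\<^bsub>S\<^esub> s i j"] a by simp
qed

text \<open>
  For \<open>y\<close> in \<open>ker Q\<close> the integral of \<open>y \<otimes> f\<close> in the free ring is \<open>1 \<otimes> (y \<otimes> f)\<close>, which leaves no
  other choice for the image of a word.
\<close>

fun nested_itg :: "'a list \<Rightarrow> 'b" where
  "nested_itg [] = \<one>\<^bsub>S\<^esub>"
| "nested_itg (x # f) = itgS (phi x \<otimes>\<^bsub>S\<^esub> nested_itg f)"

lemma nested_itg_closed: "f \<in> RT_lists \<Longrightarrow> nested_itg f \<in> carrier S"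
  by (induction f rule: list.induct) (auto simp: S.itg_closed phi_closed RT_into_R)

definition integrate_against :: "'a \<Rightarrow> 'b \<Rightarrow> 'b" where
  "integrate_against x s = itgS (phi x \<otimes>\<^bsub>S\<^esub> s)"

lemma integrate_against_linear: "x \<in> carrier R \<Longrightarrow> integrate_against x \<in> linear_maps C S_alg S_alg"
  unfolding integrate_against_def[abs_def]
  by (intro linear_maps_comp[OF itgS_linear] bilinear_maps_right[OF S_bilinear]) (simp add: phi_closed)

lemma integrate_against_const:
  "\<lbrakk>x \<in> carrier R; c \<in> constants S derS; s \<in> carrier S\<rbrakk> \<Longrightarrow>
    integrate_against x (c \<otimes>\<^bsub>S\<^esub> s) = c \<otimes>\<^bsub>S\<^esub> integrate_against x s"
  unfolding integrate_against_def
  by (subst S.m_lcomm) (simp_all add: S.itg_const phi_closed S.constantsD)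

lemma nested_itg_multilinear: "word_multilinear C RT S_alg nested_itg"
proof (rule word_multilinearI)
  show "nested_itg [] \<in> carrier S_alg" by simp
  fix xs ys assume xs: "xs \<in> RT_lists" and ys: "ys \<in> RT_lists"
  from xs show "(\<lambda>z. nested_itg (xs @ z # ys)) \<in> linear_maps C RT S_alg"
  proof (induction xs rule: list.induct)
    case Nil
    show ?case
      using linear_maps_comp[OF itgS_linear linear_maps_comp[OF bilinear_maps_left[OF S_bilinear]
            linear_maps_RT_restrict[OF phi_linear]], of "nested_itg ys"] nested_itg_closed[OF ys]
      by simp
  next
    case (Cons a as)
    then have a: "a \<in> carrier RT" "as \<in> RT_lists" by auto
    show ?case
      using linear_maps_comp[OF integrate_against_linear[OF RT_into_R[OF a(1)]] Cons.IH[OF a(2)]]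
      by (simp add: integrate_against_def)
  qed
qed

definition J :: "('a list \<Rightarrow> 'a) set \<Rightarrow> 'b" where
  "J = (SOME h. h \<in> linear_maps C T S_alg \<and> (\<forall>f\<in>RT_lists. h (w f) = nested_itg f))"

lemma J_linear: "J \<in> linear_maps C T S_alg" and J_w: "f \<in> RT_lists \<Longrightarrow> J (w f) = nested_itg f"
proof -
  have "\<exists>h. h \<in> linear_maps C T S_alg \<and> (\<forall>f\<in>RT_lists. h (w f) = nested_itg f)"
    using T_lift[OF S_module nested_itg_multilinear] by blast
  from someI_ex[OF this, folded J_def]
  show "J \<in> linear_maps C T S_alg" "f \<in> RT_lists \<Longrightarrow> J (w f) = nested_itg f" by auto
qed

lemma J_closed: "t \<in> carrier T \<Longrightarrow> J t \<in> carrier S"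
  using linear_maps_closed[OF J_linear] by simp

lemma J_cons:
  assumes x: "x \<in> carrier RT" and t: "t \<in> carrier T"
  shows "J (cons x t) = integrate_against x (J t)"
  by (rule linear_maps_eq_on_spans[OF T_spans T_module S_module
        linear_maps_comp[OF J_linear cons_linear[OF x]]
        linear_maps_comp[OF integrate_against_linear[OF RT_into_R[OF x]] J_linear] _ t])
     (elim imageE, use x in \<open>simp add: cons_w J_w integrate_against_def\<close>)

text \<open>
  The image of \<open>\<epsilon>(f \<odot> g)\<close>.
\<close>

definition pairing :: "'a list \<Rightarrow> 'a list \<Rightarrow> 'b" where
  "pairing f g = S.ev (nested_itg f \<otimes>\<^bsub>S\<^esub> nested_itg g)"

lemma pairing_constant: "f \<in> RT_lists \<Longrightarrow> g \<in> RT_lists \<Longrightarrow> pairing f g \<in> constants S derS"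
  unfolding pairing_def by (intro S.ev_constant S.m_closed nested_itg_closed)

lemma pairing_closed: "f \<in> RT_lists \<Longrightarrow> g \<in> RT_lists \<Longrightarrow> pairing f g \<in> carrier S"
  by (intro S.constantsD pairing_constant)

text \<open>
  The product is its evaluation plus the integral of its derivative.  By the Leibniz rule the
  derivative for \<open>f = x # f'\<close> and \<open>g = y # g'\<close> is \<open>\<phi>(x) \<cdot> (J f' \<cdot> J g) + \<phi>(y) \<cdot> (J f \<cdot> J g')\<close>; the
  induction hypothesis applies to both products, and the pairings, being constant, can be pulled
  out of the integral.  The evaluation is the summand for \<open>i = j = 0\<close>, and the remaining summands
  combine according to the recursion of the shuffle product.
\<close>

lemma nested_itg_product:
  assumes "f \<in> RT_lists" "g \<in> RT_lists"
  shows "nested_itg f \<otimes>\<^bsub>S\<^esub> nested_itg g = J (w f \<otimes>\<^bsub>T\<^esub> w g) \<oplus>\<^bsub>S\<^esub>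
    (\<Oplus>\<^bsub>S\<^esub>i\<in>{0..<length f}. \<Oplus>\<^bsub>S\<^esub>j\<in>{0..<length g}.
       pairing (drop i f) (drop j g) \<otimes>\<^bsub>S\<^esub> J (w (take i f) \<otimes>\<^bsub>T\<^esub> w (take j g)))"
  using assms
proof (induction "length f + length g" arbitrary: f g rule: less_induct)
  case less
  note td = take_drop_RT_lists
  have wc: "w a \<otimes>\<^bsub>T\<^esub> w b \<in> carrier T" if "a \<in> RT_lists" "b \<in> RT_lists" for a b
    by (intro bilinear_maps_closed[OF T_bilinear] w_closed that)
  have sum: "integrate_against x (J t \<oplus>\<^bsub>S\<^esub> (\<Oplus>\<^bsub>S\<^esub>i\<in>I. \<Oplus>\<^bsub>S\<^esub>j\<in>I'. c i j \<otimes>\<^bsub>S\<^esub> J (t' i j))) =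
      J (cons x t) \<oplus>\<^bsub>S\<^esub> (\<Oplus>\<^bsub>S\<^esub>i\<in>I. \<Oplus>\<^bsub>S\<^esub>j\<in>I'. c i j \<otimes>\<^bsub>S\<^esub> J (cons x (t' i j)))"
    if x: "x \<in> carrier RT" and t: "t \<in> carrier T"
      and c: "\<And>i j. c i j \<in> constants S derS" and t': "\<And>i j. t' i j \<in> carrier T"
    for x t c t' and I I' :: "nat set"
    unfolding J_cons[OF x t'] J_cons[OF x t] using x
    by (intro constant_linear_finsum integrate_against_linear integrate_against_const RT_into_R
        J_closed t t' c)
  show ?case
  proof (cases f)
    case Nil
    then show ?thesis using less.prems
      by (simp add: T_mult_words(1) J_w nested_itg_closed S.finsum_empty)
  next
    case f: (Cons x f')
    show ?thesis
    proof (cases g)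
      case Nil
      have "(\<Oplus>\<^bsub>S\<^esub>i\<in>I. \<zero>\<^bsub>S\<^esub>) = \<zero>\<^bsub>S\<^esub>" for I :: "nat set" by (rule S.finsum_zero)
      with Nil show ?thesis using less.prems
        by (simp add: T_mult_words(2) J_w nested_itg_closed S.finsum_empty del: nested_itg.simps(2))
    next
      case g: (Cons y g')
      from less.prems have x: "x \<in> carrier RT" and f': "f' \<in> RT_lists"
        and y: "y \<in> carrier RT" and g': "g' \<in> RT_lists" unfolding f g by auto
      note F = less.prems(1) and G = less.prems(2)
      let ?f = "nested_itg f" and ?g = "nested_itg g" and ?f' = "nested_itg f'" and ?g' = "nested_itg g'"
      let ?n = "length f'" and ?m = "length g'"
      define X where "X i j = pairing (drop i f') (drop j g) \<otimes>\<^bsub>S\<^esub> J (cons x (w (take i f') \<otimes>\<^bsub>T\<^esub> w (take j g)))" for i j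
      define Y where "Y i j = pairing (drop i f) (drop j g') \<otimes>\<^bsub>S\<^esub> J (cons y (w (take i f) \<otimes>\<^bsub>T\<^esub> w (take j g')))" for i j
      define A where "A i j = pairing (drop i f) (drop j g) \<otimes>\<^bsub>S\<^esub> J (w (take i f) \<otimes>\<^bsub>T\<^esub> w (take j g))" for i j
      have c: "?f \<in> carrier S" "?g \<in> carrier S" "?f' \<in> carrier S" "?g' \<in> carrier S"
        by (rule nested_itg_closed[OF F] nested_itg_closed[OF G] nested_itg_closed[OF f'] nested_itg_closed[OF g'])+
      have px: "phi x \<in> carrier S" "phi y \<in> carrier S" using x y by (simp_all add: phi_closed RT_into_R)
      have df: "derS ?f = phi x \<otimes>\<^bsub>S\<^esub> ?f'" and dg: "derS ?g = phi y \<otimes>\<^bsub>S\<^esub> ?g'"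
        unfolding f g using c px by (simp_all add: S.der_itg)
      have "?f \<otimes>\<^bsub>S\<^esub> ?g = pairing f g \<oplus>\<^bsub>S\<^esub> itgS (derS (?f \<otimes>\<^bsub>S\<^esub> ?g))"
        unfolding pairing_def using c by (intro S.ev_decomposition S.m_closed)
      also have "itgS (derS (?f \<otimes>\<^bsub>S\<^esub> ?g)) =
          integrate_against x (?f' \<otimes>\<^bsub>S\<^esub> ?g) \<oplus>\<^bsub>S\<^esub> integrate_against y (?f \<otimes>\<^bsub>S\<^esub> ?g')"
      proof -
        have "derS (?f \<otimes>\<^bsub>S\<^esub> ?g) = phi x \<otimes>\<^bsub>S\<^esub> (?f' \<otimes>\<^bsub>S\<^esub> ?g) \<oplus>\<^bsub>S\<^esub> phi y \<otimes>\<^bsub>S\<^esub> (?f \<otimes>\<^bsub>S\<^esub> ?g')"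
          using c px by (simp add: S.der_mult df dg S.m_assoc S.m_lcomm)
        then show ?thesis
          unfolding integrate_against_def using c px by (simp add: S.itg_add)
      qed
      also have "integrate_against x (?f' \<otimes>\<^bsub>S\<^esub> ?g) = J (cons x (w f' \<otimes>\<^bsub>T\<^esub> w g)) \<oplus>\<^bsub>S\<^esub>
          (\<Oplus>\<^bsub>S\<^esub>i\<in>{0..<?n}. \<Oplus>\<^bsub>S\<^esub>j\<in>{0..<length g}. X i j)"
      proof -
        have "?f' \<otimes>\<^bsub>S\<^esub> ?g = J (w f' \<otimes>\<^bsub>T\<^esub> w g) \<oplus>\<^bsub>S\<^esub>
          (\<Oplus>\<^bsub>S\<^esub>i\<in>{0..<length f'}. \<Oplus>\<^bsub>S\<^esub>j\<in>{0..<length g}.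
             pairing (drop i f') (drop j g) \<otimes>\<^bsub>S\<^esub> J (w (take i f') \<otimes>\<^bsub>T\<^esub> w (take j g)))"
          by (rule less.hyps[OF _ f' G]) (simp add: f)
        then show ?thesis
          unfolding X_def by (simp only:) (rule sum; intro x wc td pairing_constant f' G)
      qed
      also have "integrate_against y (?f \<otimes>\<^bsub>S\<^esub> ?g') = J (cons y (w f \<otimes>\<^bsub>T\<^esub> w g')) \<oplus>\<^bsub>S\<^esub>
          (\<Oplus>\<^bsub>S\<^esub>i\<in>{0..<length f}. \<Oplus>\<^bsub>S\<^esub>j\<in>{0..<?m}. Y i j)"
      proof -
        have "?f \<otimes>\<^bsub>S\<^esub> ?g' = J (w f \<otimes>\<^bsub>T\<^esub> w g') \<oplus>\<^bsub>S\<^esub>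
          (\<Oplus>\<^bsub>S\<^esub>i\<in>{0..<length f}. \<Oplus>\<^bsub>S\<^esub>j\<in>{0..<length g'}.
             pairing (drop i f) (drop j g') \<otimes>\<^bsub>S\<^esub> J (w (take i f) \<otimes>\<^bsub>T\<^esub> w (take j g')))"
          by (rule less.hyps[OF _ F g']) (simp add: g)
        then show ?thesis
          unfolding Y_def by (simp only:) (rule sum; intro y wc td pairing_constant g' F)
      qed
      finally have 1: "?f \<otimes>\<^bsub>S\<^esub> ?g = pairing f g \<oplus>\<^bsub>S\<^esub>
        ((J (cons x (w f' \<otimes>\<^bsub>T\<^esub> w g)) \<oplus>\<^bsub>S\<^esub> (\<Oplus>\<^bsub>S\<^esub>i\<in>{0..<?n}. \<Oplus>\<^bsub>S\<^esub>j\<in>{0..<length g}. X i j)) \<oplus>\<^bsub>S\<^esub>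
         (J (cons y (w f \<otimes>\<^bsub>T\<^esub> w g')) \<oplus>\<^bsub>S\<^esub> (\<Oplus>\<^bsub>S\<^esub>i\<in>{0..<length f}. \<Oplus>\<^bsub>S\<^esub>j\<in>{0..<?m}. Y i j)))" .
      note cx = linear_maps_closed[OF cons_linear[OF x]] and cy = linear_maps_closed[OF cons_linear[OF y]]
      have Xc: "X i j \<in> carrier S" and Yc: "Y i j \<in> carrier S" and Ac: "A i j \<in> carrier S" for i j
        unfolding X_def Y_def A_def
        by (intro S.m_closed pairing_closed J_closed cx cy wc td F G f' g')+
      have 2: "J (w f \<otimes>\<^bsub>T\<^esub> w g) = J (cons x (w f' \<otimes>\<^bsub>T\<^esub> w g)) \<oplus>\<^bsub>S\<^esub> J (cons y (w f \<otimes>\<^bsub>T\<^esub> w g'))"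
        using linear_maps_add[OF J_linear cx[OF wc[OF f' G]] cy[OF wc[OF F g']]]
        by (simp add: f g T_mult_words(3)[OF x f' y g'])
      have grid: "(\<Oplus>\<^bsub>S\<^esub>i\<in>{0..<Suc ?n}. \<Oplus>\<^bsub>S\<^esub>j\<in>{0..<Suc ?m}. A i j) = A 0 0 \<oplus>\<^bsub>S\<^esub>
          ((\<Oplus>\<^bsub>S\<^esub>i\<in>{0..<?n}. \<Oplus>\<^bsub>S\<^esub>j\<in>{0..<Suc ?m}. X i j) \<oplus>\<^bsub>S\<^esub> (\<Oplus>\<^bsub>S\<^esub>i\<in>{0..<Suc ?n}. \<Oplus>\<^bsub>S\<^esub>j\<in>{0..<?m}. Y i j))"
      proof (rule S.finsum_grid[OF Ac Xc Yc])
        fix i j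
        have tf: "take i f' \<in> RT_lists" and tg: "take j g' \<in> RT_lists" by (rule td f' g')+
        have dd: "pairing (drop i f') (drop j g') \<in> carrier S" by (intro pairing_closed td f' g')
        have "J (w (x # take i f') \<otimes>\<^bsub>T\<^esub> w (y # take j g')) =
            J (cons x (w (take i f') \<otimes>\<^bsub>T\<^esub> w (y # take j g'))) \<oplus>\<^bsub>S\<^esub>
            J (cons y (w (x # take i f') \<otimes>\<^bsub>T\<^esub> w (take j g')))"
          using linear_maps_add[OF J_linear cx[OF wc] cy[OF wc], of "take i f'" "y # take j g'" "x # take i f'" "take j g'"]
            x y tf tg by (simp add: T_mult_words(3))
        then show "A (Suc i) (Suc j) = X i (Suc j) \<oplus>\<^bsub>S\<^esub> Y (Suc i) j"
          unfolding A_def X_def Y_def f g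
          using x y tf tg dd by (simp add: S.r_distr J_closed cx cy wc)
        show "A (Suc i) 0 = X i 0"
          unfolding A_def X_def f using x tf by (simp add: T_mult_words(2) cons_w)
        show "A 0 (Suc j) = Y 0 j"
          unfolding A_def Y_def g using y tg by (simp add: T_mult_words(1) cons_w)
      qed
      have A00: "A 0 0 = pairing f g"
        unfolding A_def using pairing_closed[OF F G] by (simp add: T_mult_words(1) J_w)
      have "(\<Oplus>\<^bsub>S\<^esub>i\<in>{0..<?n}. \<Oplus>\<^bsub>S\<^esub>j\<in>{0..<Suc ?m}. X i j) \<in> carrier S"
        "(\<Oplus>\<^bsub>S\<^esub>i\<in>{0..<Suc ?n}. \<Oplus>\<^bsub>S\<^esub>j\<in>{0..<?m}. Y i j) \<in> carrier S"
        by (intro S.finsum_closed funcsetI Xc Yc)+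
      moreover have "length f = Suc ?n" "length g = Suc ?m" by (simp_all add: f g)
      ultimately show ?thesis
        unfolding A_def[symmetric] 1 2 using grid A00 pairing_closed[OF F G]
        by (simp add: S.a_ac J_closed cx cy wc F G f' g')
    qed
  qed
qed


lemma pairing_comm: "f \<in> RT_lists \<Longrightarrow> g \<in> RT_lists \<Longrightarrow> pairing f g = pairing g f"
  by (simp add: pairing_def nested_itg_closed S.m_comm)

lemma ev_nested_itg:
  assumes "f \<in> RT_lists" "f \<noteq> []"
  shows "S.ev (nested_itg f) = \<zero>\<^bsub>S\<^esub>"
  using assms by (cases f) (auto intro!: S.ev_itg S.m_closed phi_closed nested_itg_closed simp: RT_into_R)

text \<open>
  The product formula for \<open>f\<close> and \<open>g\<close> is multiplied by \<open>J h\<close> and evaluated.  The summand for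
  \<open>i = j = 0\<close> then contains \<open>ev (J h)\<close>, which vanishes because \<open>J h\<close> is an integral; hence the lower
  bound \<open>1 - j\<close> of the inner sum.
\<close>

lemma ev_nested_itg_product:
  assumes f: "f \<in> RT_lists" and g: "g \<in> RT_lists" and h: "h \<in> RT_lists" "h \<noteq> []"
  shows "S.ev ((nested_itg f \<otimes>\<^bsub>S\<^esub> nested_itg g) \<otimes>\<^bsub>S\<^esub> nested_itg h) =
    S.ev (J (w f \<otimes>\<^bsub>T\<^esub> w g) \<otimes>\<^bsub>S\<^esub> nested_itg h) \<oplus>\<^bsub>S\<^esub>
    (\<Oplus>\<^bsub>S\<^esub>j\<in>{0..<length g}. \<Oplus>\<^bsub>S\<^esub>i\<in>{1 - j..<length f}.
      pairing (drop i f) (drop j g) \<otimes>\<^bsub>S\<^esub> S.ev (J (w (take i f) \<otimes>\<^bsub>T\<^esub> w (take j g)) \<otimes>\<^bsub>S\<^esub> nested_itg h))"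
proof -
  note td = take_drop_RT_lists
  note hc = nested_itg_closed[OF h(1)]
  define E where "E s = S.ev (s \<otimes>\<^bsub>S\<^esub> nested_itg h)" for s
  have E: "E \<in> linear_maps C S_alg S_alg"
    unfolding E_def[abs_def]
    by (rule linear_maps_comp[OF ev_linear bilinear_maps_left[OF S_bilinear]]) (simp add: hc)
  have Ec: "E (c \<otimes>\<^bsub>S\<^esub> s) = c \<otimes>\<^bsub>S\<^esub> E s" if "c \<in> constants S derS" "s \<in> carrier S" for c s
    unfolding E_def using that hc by (simp add: S.m_assoc S.constantsD S.ev_const_mult)
  let ?s = "\<lambda>j i. J (w (take j g) \<otimes>\<^bsub>T\<^esub> w (take i f))" and ?c = "\<lambda>j i. pairing (drop j g) (drop i f)"
  have sc: "?s j i \<in> carrier S" for i j by (intro J_closed T_mult_closed td f g)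
  have cc: "?c j i \<in> constants S derS" for i j by (intro pairing_constant td f g)
  have Esc: "E (?s j i) \<in> carrier S" for i j
    using linear_maps_closed[OF E] sc by simp
  have "nested_itg g \<otimes>\<^bsub>S\<^esub> nested_itg f = J (w g \<otimes>\<^bsub>T\<^esub> w f) \<oplus>\<^bsub>S\<^esub>
      (\<Oplus>\<^bsub>S\<^esub>j\<in>{0..<length g}. \<Oplus>\<^bsub>S\<^esub>i\<in>{0..<length f}. ?c j i \<otimes>\<^bsub>S\<^esub> ?s j i)"
    by (rule nested_itg_product[OF g f])
  then have "E (nested_itg g \<otimes>\<^bsub>S\<^esub> nested_itg f) = E (J (w g \<otimes>\<^bsub>T\<^esub> w f)) \<oplus>\<^bsub>S\<^esub>
      (\<Oplus>\<^bsub>S\<^esub>j\<in>{0..<length g}. \<Oplus>\<^bsub>S\<^esub>i\<in>{0..<length f}. ?c j i \<otimes>\<^bsub>S\<^esub> E (?s j i))"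
    by (simp only:) (intro constant_linear_finsum E Ec J_closed T_mult_closed f g cc sc)
  also have "(\<Oplus>\<^bsub>S\<^esub>j\<in>{0..<length g}. \<Oplus>\<^bsub>S\<^esub>i\<in>{0..<length f}. ?c j i \<otimes>\<^bsub>S\<^esub> E (?s j i)) =
      (\<Oplus>\<^bsub>S\<^esub>j\<in>{0..<length g}. \<Oplus>\<^bsub>S\<^esub>i\<in>{1 - j..<length f}. ?c j i \<otimes>\<^bsub>S\<^esub> E (?s j i))"
  proof (rule S.finsum_cong')
    fix j
    show "(\<Oplus>\<^bsub>S\<^esub>i\<in>{0..<length f}. ?c j i \<otimes>\<^bsub>S\<^esub> E (?s j i)) = (\<Oplus>\<^bsub>S\<^esub>i\<in>{1 - j..<length f}. ?c j i \<otimes>\<^bsub>S\<^esub> E (?s j i))"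
    proof (rule S.add.finprod_mono_neutral_cong_left[folded finsum_def, symmetric])
      fix i assume "i \<in> {0..<length f} - {1 - j..<length f}"
      then have "i = 0" "j = 0" by auto
      then have "E (?s j i) = \<zero>\<^bsub>S\<^esub>"
        using ev_nested_itg[OF h] hc by (simp add: E_def T_mult_words(1) J_w)
      then show "?c j i \<otimes>\<^bsub>S\<^esub> E (?s j i) = \<zero>\<^bsub>S\<^esub>" using S.constantsD(1)[OF cc] by simp
    qed (auto intro!: S.m_closed S.constantsD(1)[OF cc] Esc)
  qed (auto intro!: S.finsum_closed S.m_closed S.constantsD(1)[OF cc] Esc)
  also have "(\<Oplus>\<^bsub>S\<^esub>j\<in>{0..<length g}. \<Oplus>\<^bsub>S\<^esub>i\<in>{1 - j..<length f}. ?c j i \<otimes>\<^bsub>S\<^esub> E (?s j i)) =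
      (\<Oplus>\<^bsub>S\<^esub>j\<in>{0..<length g}. \<Oplus>\<^bsub>S\<^esub>i\<in>{1 - j..<length f}.
        pairing (drop i f) (drop j g) \<otimes>\<^bsub>S\<^esub> E (J (w (take i f) \<otimes>\<^bsub>T\<^esub> w (take j g))))"
    by (simp only: pairing_comm[OF td(2)[OF g] td(2)[OF f]] T_mult_comm[OF td(1)[OF g] td(1)[OF f]])
  finally show ?thesis
    unfolding E_def
    by (simp only: S.m_comm[OF nested_itg_closed[OF g] nested_itg_closed[OF f]] T_mult_comm[OF g f])
qed

section \<open>The homomorphism out of the free ring\<close>

subsection \<open>Images of the constants\<close>

lemma constants_submodule: "submodule (constants S derS) C S_alg"
  by (rule module_submoduleI[OF S_module])
     (auto simp: S.constants_closed phi_constant S.constantsD)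

lemma sym_algebra_hom_constant:
  assumes M: "module C M" and h: "h \<in> linear_maps C (sym_algebra C M) S_alg" "h \<in> ring_hom (sym_algebra C M) S_alg"
    and gen: "\<And>x. x \<in> carrier M \<Longrightarrow> h (sym_gen C M x) \<in> constants S derS"
    and p: "p \<in> carrier (sym_algebra C M)"
  shows "h p \<in> constants S derS"
proof (rule sym_algebra_into_submodule[OF M h(1) S_module constants_submodule _ _ p])
  show "h \<one>\<^bsub>sym_algebra C M\<^esub> \<in> constants S derS"
    using ring_hom_one[OF h(2)] by (simp add: S.constants_closed)
  fix x q assume x: "x \<in> carrier M" and q: "q \<in> carrier (sym_algebra C M)" "h q \<in> constants S derS"
  then show "h (sym_gen C M x \<otimes>\<^bsub>sym_algebra C M\<^esub> q) \<in> constants S derS"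
    using ring_hom_mult[OF h(2) linear_maps_closed[OF sym_gen_linear[OF M] x] q(1)] gen[OF x]
    by (simp add: S.constants_closed)
qed

lemma J_linear_pos: "J \<in> linear_maps C T_pos S_alg"
  by (rule linear_maps_T_pos[OF J_linear])

text \<open>
  The value on \<open>\<epsilon>(q \<otimes> t)\<close> is the constant that integration by parts produces, see
  \<open>itgS_by_parts\<close>.
\<close>

lemma C1_hom:
  "\<exists>h\<in>linear_maps C C1 S_alg. h \<in> ring_hom C1 S_alg \<and>
    (\<forall>q\<in>carrier RJ. \<forall>t\<in>carrier T_pos. h (eps1 q t) = S.ev (phi q \<otimes>\<^bsub>S\<^esub> J t)) \<and>
    (\<forall>c\<in>carrier C1. h c \<in> constants S derS)"
proof -
  have phiJ: "phi \<in> linear_maps C RJ S_alg"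
    by (rule linear_mapsI) (auto simp: phi_closed phi_add phi_mult constantsD Q_closed)
  have B: "(\<lambda>q t. S.ev (phi q \<otimes>\<^bsub>S\<^esub> J t)) \<in> bilinear_maps C RJ T_pos S_alg"
    by (rule bilinear_maps_comp[OF bilinear_maps_precomp[OF S_bilinear phiJ J_linear_pos] ev_linear])
  from tensor_lift[OF RJ_module T_pos_module S_module B] obtain l where
    l: "l \<in> linear_maps C M1 S_alg"
    "\<And>q t. q \<in> carrier RJ \<Longrightarrow> t \<in> carrier T_pos \<Longrightarrow> l (tensor C RJ T_pos q t) = S.ev (phi q \<otimes>\<^bsub>S\<^esub> J t)"
    unfolding M1_def by blast
  have lc: "l m \<in> constants S derS" if m: "m \<in> carrier M1" for m
  proof (rule linear_maps_into_submodule[OF tensor_spans'[OF RJ_module T_pos_module, folded M1_def]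
        l(1) M1_module S_module constants_submodule _ m])
    fix u assume "u \<in> {tensor C RJ T_pos q t |q t. q \<in> carrier RJ \<and> t \<in> carrier T_pos}"
    then obtain q t where u: "u = tensor C RJ T_pos q t" "q \<in> carrier RJ" "t \<in> carrier T_pos" by blast
    moreover have "phi q \<in> carrier S" "J t \<in> carrier S"
      using u linear_maps_closed[OF phiJ] J_closed T_pos_subset by auto
    ultimately show "l u \<in> constants S derS" by (simp add: l(2) S.ev_constant)
  qed
  from sym_algebra_lift[OF M1_module S_algebra l(1)] obtain h where
    h: "h \<in> linear_maps C C1 S_alg" "h \<in> ring_hom C1 S_alg" "\<And>m. m \<in> carrier M1 \<Longrightarrow> h (sym_gen C M1 m) = l m"
    unfolding C1_def by blast
  have "h c \<in> constants S derS" if "c \<in> carrier C1" for c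
    by (rule sym_algebra_hom_constant[OF M1_module h(1,2)[unfolded C1_def] _ that[unfolded C1_def]])
       (simp add: h(3) lc)
  moreover have "h (eps1 q t) = S.ev (phi q \<otimes>\<^bsub>S\<^esub> J t)" if "q \<in> carrier RJ" "t \<in> carrier T_pos" for q t
    using that bilinear_maps_closed[OF tensor_bilinear[OF RJ_module T_pos_module, folded M1_def]]
    by (simp add: eps1_def h(3) l(2))
  ultimately show ?thesis using h by blast
qed

lemma Sym2_hom:
  "\<exists>h\<in>linear_maps C Sym2 S_alg. h \<in> ring_hom Sym2 S_alg \<and>
    (\<forall>s\<in>carrier T_pos. \<forall>t\<in>carrier T_pos. h (eps_sym2 s t) = S.ev (J s \<otimes>\<^bsub>S\<^esub> J t)) \<and>
    (\<forall>c\<in>carrier Sym2. h c \<in> constants S derS)"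
proof -
  have B: "(\<lambda>s t. S.ev (J s \<otimes>\<^bsub>S\<^esub> J t)) \<in> bilinear_maps C T_pos T_pos S_alg"
    by (rule bilinear_maps_comp[OF bilinear_maps_precomp[OF S_bilinear J_linear_pos J_linear_pos] ev_linear])
  have Jc: "J s \<in> carrier S" if "s \<in> carrier T_pos" for s
    using that J_closed T_pos_subset by blast
  have sym: "S.ev (J s \<otimes>\<^bsub>S\<^esub> J t) = S.ev (J t \<otimes>\<^bsub>S\<^esub> J s)" if "s \<in> carrier T_pos" "t \<in> carrier T_pos" for s t
    using that Jc by (simp add: S.m_comm)
  from sym_square_lift[OF T_pos_module S_module B sym] obtain l where
    l: "l \<in> linear_maps C M2 S_alg"
    "\<And>s t. s \<in> carrier T_pos \<Longrightarrow> t \<in> carrier T_pos \<Longrightarrow> l (sym_prod C T_pos s t) = S.ev (J s \<otimes>\<^bsub>S\<^esub> J t)"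
    unfolding M2_def by blast
  note pc = bilinear_maps_closed[OF sym_prod_bilinear[OF T_pos_module], folded M2_def]
  have lc: "l m \<in> constants S derS" if m: "m \<in> carrier M2" for m
  proof (rule linear_maps_into_submodule[OF sym_prod_spans[OF T_pos_module spans_carrier spans_carrier, folded M2_def]
        l(1) M2_module S_module constants_submodule _ m])
    fix u assume "u \<in> {sym_prod C T_pos s t |s t. s \<in> carrier T_pos \<and> t \<in> carrier T_pos}"
    then obtain s t where "u = sym_prod C T_pos s t" "s \<in> carrier T_pos" "t \<in> carrier T_pos" by blast
    then show "l u \<in> constants S derS" using Jc by (simp add: l(2) S.ev_constant)
  qed
  from sym_algebra_lift[OF M2_module S_algebra l(1)] obtain h where
    h: "h \<in> linear_maps C Sym2 S_alg" "h \<in> ring_hom Sym2 S_alg" "\<And>m. m \<in> carrier M2 \<Longrightarrow> h (sym_gen C M2 m) = l m"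
    unfolding Sym2_def by blast
  have "h c \<in> constants S derS" if "c \<in> carrier Sym2" for c
    by (rule sym_algebra_hom_constant[OF M2_module h(1,2)[unfolded Sym2_def] _ that[unfolded Sym2_def]])
       (simp add: h(3) lc)
  moreover have "h (eps_sym2 s t) = S.ev (J s \<otimes>\<^bsub>S\<^esub> J t)" if "s \<in> carrier T_pos" "t \<in> carrier T_pos" for s t
    using that pc by (simp add: eps_sym2_def h(3) l(2))
  ultimately show ?thesis using h by blast
qed

text \<open>
  Evaluating \<open>(J f \<cdot> J g) \<cdot> J h\<close> with the product formula for \<open>f, g\<close> and \<open>J f \<cdot> (J g \<cdot> J h)\<close> with the one
  for \<open>g, h\<close> gives the two halves of the relation.
\<close>

lemma Sym2_hom_J2_gen:
  assumes hl: "h \<in> linear_maps C Sym2 S_alg" and hr: "h \<in> ring_hom Sym2 S_alg"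
    and he: "\<And>s t. s \<in> carrier T_pos \<Longrightarrow> t \<in> carrier T_pos \<Longrightarrow> h (eps_sym2 s t) = S.ev (J s \<otimes>\<^bsub>S\<^esub> J t)"
    and f: "f \<in> RT_lists - {[]}" and g: "g \<in> RT_lists - {[]}" and k: "k \<in> RT_lists - {[]}"
  shows "h (J2_gen f g k) = \<zero>\<^bsub>S\<^esub>"
proof -
  interpret A: algebra C Sym2 by (rule Sym2_algebra)
  note td = take_drop_RT_lists
  have f': "f \<in> RT_lists" "f \<noteq> []" and g': "g \<in> RT_lists" "g \<noteq> []" and k': "k \<in> RT_lists" "k \<noteq> []"
    using f g k by auto
  note cl = bilinear_maps_closed[OF eps_sym2_bilinear]
  have pos: "w a \<in> carrier T_pos" if "a \<in> RT_lists" "a \<noteq> []" for a using that by (rule w_pos)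
  have dpos: "w (drop i a) \<in> carrier T_pos" if "a \<in> RT_lists" "i < length a" for i a
    by (rule w_pos[OF td(2)]) (use that in auto)
  have tpos: "w (take i a) \<otimes>\<^bsub>T\<^esub> w (take j b) \<in> carrier T_pos"
    if "a \<in> RT_lists" "b \<in> RT_lists" "i < length a" "j < length b" "1 \<le> i + j" for a b i j
    by (intro shuffle_pos td that) (use that in auto)
  define U where "U j = (\<Oplus>\<^bsub>Sym2\<^esub>i\<in>{1 - j..<length f}.
           eps_sym2 (w (drop i f)) (w (drop j g)) \<otimes>\<^bsub>Sym2\<^esub>
           eps_sym2 (w (take i f) \<otimes>\<^bsub>T\<^esub> w (take j g)) (w k))" for j
  define V where "V j = (\<Oplus>\<^bsub>Sym2\<^esub>i\<in>{1 - j..<length k}.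
           eps_sym2 (w f) (w (take j g) \<otimes>\<^bsub>T\<^esub> w (take i k)) \<otimes>\<^bsub>Sym2\<^esub>
           eps_sym2 (w (drop j g)) (w (drop i k)))" for j
  define a where "a = eps_sym2 (w f \<otimes>\<^bsub>T\<^esub> w g) (w k)"
  define b where "b = eps_sym2 (w f) (w g \<otimes>\<^bsub>T\<^esub> w k)"
  have Uc: "eps_sym2 (w (drop i f)) (w (drop j g)) \<in> carrier Sym2"
      "eps_sym2 (w (take i f) \<otimes>\<^bsub>T\<^esub> w (take j g)) (w k) \<in> carrier Sym2"
    if "j < length g" "i \<in> {1 - j..<length f}" for i j
    by (intro cl dpos tpos pos f' g' k'; use that in auto)+
  have Vc: "eps_sym2 (w f) (w (take j g) \<otimes>\<^bsub>T\<^esub> w (take i k)) \<in> carrier Sym2"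
      "eps_sym2 (w (drop j g)) (w (drop i k)) \<in> carrier Sym2"
    if "j < length g" "i \<in> {1 - j..<length k}" for i j
    by (intro cl dpos tpos pos f' g' k'; use that in auto)+
  have U: "U j \<in> carrier Sym2" and V: "V j \<in> carrier Sym2" if "j < length g" for j
    unfolding U_def V_def using that Uc Vc by (intro A.finsum_closed; auto)+
  have ab: "a \<in> carrier Sym2" "b \<in> carrier Sym2"
    unfolding a_def b_def using f' g' k' by (intro cl pos shuffle_pos; auto)+
  define X where "X = (\<Oplus>\<^bsub>Sym2\<^esub>j\<in>{0..<length g}. U j \<ominus>\<^bsub>Sym2\<^esub> V j)"
  define SU where "SU = (\<Oplus>\<^bsub>Sym2\<^esub>j\<in>{0..<length g}. U j)"
  define SV where "SV = (\<Oplus>\<^bsub>Sym2\<^esub>j\<in>{0..<length g}. V j)"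
  have XSc: "X \<in> carrier Sym2" "SU \<in> carrier Sym2" "SV \<in> carrier Sym2"
    unfolding X_def SU_def SV_def using U V by (intro A.finsum_closed; auto)+
  have "X \<oplus>\<^bsub>Sym2\<^esub> SV = (\<Oplus>\<^bsub>Sym2\<^esub>j\<in>{0..<length g}. (U j \<ominus>\<^bsub>Sym2\<^esub> V j) \<oplus>\<^bsub>Sym2\<^esub> V j)"
    unfolding X_def SV_def using U V by (intro A.finsum_addf[symmetric]) auto
  also have "\<dots> = SU"
    unfolding SU_def using U V by (intro A.finsum_cong') (auto simp: a_minus_def A.a_assoc A.l_neg)
  finally have XV: "X \<oplus>\<^bsub>Sym2\<^esub> SV = SU" .
  note Am = A.module_axioms
  note fin = linear_maps_finsum[OF hl Am S_module, simplified]
  note hm = ring_hom_mult[OF hr, simplified]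
  have hsum: "h (\<Oplus>\<^bsub>Sym2\<^esub>i\<in>I. p i \<otimes>\<^bsub>Sym2\<^esub> q i) = (\<Oplus>\<^bsub>S\<^esub>i\<in>I. r i)"
    if "\<And>i. i \<in> I \<Longrightarrow> p i \<in> carrier Sym2" "\<And>i. i \<in> I \<Longrightarrow> q i \<in> carrier Sym2"
      and "\<And>i. i \<in> I \<Longrightarrow> h (p i) \<otimes>\<^bsub>S\<^esub> h (q i) = r i" "\<And>i. r i \<in> carrier S" for p q r and I :: "nat set"
  proof -
    have "h (\<Oplus>\<^bsub>Sym2\<^esub>i\<in>I. p i \<otimes>\<^bsub>Sym2\<^esub> q i) = (\<Oplus>\<^bsub>S\<^esub>i\<in>I. h (p i \<otimes>\<^bsub>Sym2\<^esub> q i))"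
      by (rule fin) (use that(1,2) in auto)
    also have "\<dots> = (\<Oplus>\<^bsub>S\<^esub>i\<in>I. r i)"
      by (rule S.finsum_cong') (use that hm in auto)
    finally show ?thesis .
  qed
  have cS: "pairing (drop i a) (drop j b) \<otimes>\<^bsub>S\<^esub> S.ev (J (w (take i a) \<otimes>\<^bsub>T\<^esub> w (take j b)) \<otimes>\<^bsub>S\<^esub> nested_itg c) \<in> carrier S"
    if "a \<in> RT_lists" "b \<in> RT_lists" "c \<in> RT_lists" for a b c i j
    by (intro S.m_closed pairing_closed S.ev_closed J_closed T_mult_closed nested_itg_closed td that)
  have hU: "h (U j) = (\<Oplus>\<^bsub>S\<^esub>i\<in>{1 - j..<length f}. pairing (drop i f) (drop j g) \<otimes>\<^bsub>S\<^esub>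
      S.ev (J (w (take i f) \<otimes>\<^bsub>T\<^esub> w (take j g)) \<otimes>\<^bsub>S\<^esub> nested_itg k))" if j: "j < length g" for j
    unfolding U_def
  proof (rule hsum[OF Uc[OF j] _ cS[OF f'(1) g'(1) k'(1)]])
    fix i assume i: "i \<in> {1 - j..<length f}"
    have "w (drop i f) \<in> carrier T_pos" "w (drop j g) \<in> carrier T_pos" "w k \<in> carrier T_pos"
      "w (take i f) \<otimes>\<^bsub>T\<^esub> w (take j g) \<in> carrier T_pos"
      by (intro dpos tpos pos f' g' k'; use i j in auto)+
    then show "h (eps_sym2 (w (drop i f)) (w (drop j g))) \<otimes>\<^bsub>S\<^esub>
        h (eps_sym2 (w (take i f) \<otimes>\<^bsub>T\<^esub> w (take j g)) (w k)) = pairing (drop i f) (drop j g) \<otimes>\<^bsub>S\<^esub>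
        S.ev (J (w (take i f) \<otimes>\<^bsub>T\<^esub> w (take j g)) \<otimes>\<^bsub>S\<^esub> nested_itg k)"
      by (simp add: he pairing_def J_w td f' g' k')
  qed
  have hV: "h (V j) = (\<Oplus>\<^bsub>S\<^esub>i\<in>{1 - j..<length k}. pairing (drop i k) (drop j g) \<otimes>\<^bsub>S\<^esub>
      S.ev (J (w (take i k) \<otimes>\<^bsub>T\<^esub> w (take j g)) \<otimes>\<^bsub>S\<^esub> nested_itg f))" if j: "j < length g" for j
    unfolding V_def
  proof (rule hsum[OF Vc[OF j] _ cS[OF k'(1) g'(1) f'(1)]])
    fix i assume i: "i \<in> {1 - j..<length k}"
    have "w (drop i k) \<in> carrier T_pos" "w (drop j g) \<in> carrier T_pos" "w f \<in> carrier T_pos"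
      "w (take j g) \<otimes>\<^bsub>T\<^esub> w (take i k) \<in> carrier T_pos"
      by (intro dpos tpos pos f' g' k'; use i j in auto)+
    then have "h (eps_sym2 (w f) (w (take j g) \<otimes>\<^bsub>T\<^esub> w (take i k))) \<otimes>\<^bsub>S\<^esub>
         h (eps_sym2 (w (drop j g)) (w (drop i k))) =
       S.ev (nested_itg f \<otimes>\<^bsub>S\<^esub> J (w (take j g) \<otimes>\<^bsub>T\<^esub> w (take i k))) \<otimes>\<^bsub>S\<^esub> pairing (drop j g) (drop i k)"
      by (simp add: he pairing_def J_w td f' g' k')
    also have "\<dots> = pairing (drop i k) (drop j g) \<otimes>\<^bsub>S\<^esub>
        S.ev (J (w (take i k) \<otimes>\<^bsub>T\<^esub> w (take j g)) \<otimes>\<^bsub>S\<^esub> nested_itg f)"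
      unfolding T_mult_comm[OF td(1)[OF g'(1)] td(1)[OF k'(1)]] pairing_comm[OF td(2)[OF g'(1)] td(2)[OF k'(1)]]
        S.m_comm[OF nested_itg_closed[OF f'(1)] J_closed[OF T_mult_closed[OF td(1)[OF k'(1)] td(1)[OF g'(1)]]]]
      by (intro S.m_comm pairing_closed S.ev_closed S.m_closed J_closed T_mult_closed nested_itg_closed td f' g' k')
    finally show "h (eps_sym2 (w f) (w (take j g) \<otimes>\<^bsub>T\<^esub> w (take i k))) \<otimes>\<^bsub>S\<^esub>
         h (eps_sym2 (w (drop j g)) (w (drop i k))) = pairing (drop i k) (drop j g) \<otimes>\<^bsub>S\<^esub>
        S.ev (J (w (take i k) \<otimes>\<^bsub>T\<^esub> w (take j g)) \<otimes>\<^bsub>S\<^esub> nested_itg f)" .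
  qed
  have hc: "h x \<in> carrier S" if "x \<in> carrier Sym2" for x using linear_maps_closed[OF hl that] by simp
  have "h a \<oplus>\<^bsub>S\<^esub> h SU = S.ev ((nested_itg f \<otimes>\<^bsub>S\<^esub> nested_itg g) \<otimes>\<^bsub>S\<^esub> nested_itg k)"
  proof -
    have "h a = S.ev (J (w f \<otimes>\<^bsub>T\<^esub> w g) \<otimes>\<^bsub>S\<^esub> nested_itg k)"
      unfolding a_def using he[OF shuffle_pos pos] f' g' k' by (simp add: J_w)
    moreover have "h SU = (\<Oplus>\<^bsub>S\<^esub>j\<in>{0..<length g}. h (U j))"
      unfolding SU_def by (rule fin) (use U in auto)
    moreover have "\<dots> = (\<Oplus>\<^bsub>S\<^esub>j\<in>{0..<length g}. \<Oplus>\<^bsub>S\<^esub>i\<in>{1 - j..<length f}. pairing (drop i f) (drop j g) \<otimes>\<^bsub>S\<^esub>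
      S.ev (J (w (take i f) \<otimes>\<^bsub>T\<^esub> w (take j g)) \<otimes>\<^bsub>S\<^esub> nested_itg k))"
      by (rule S.finsum_cong') (use hU hc[OF U] in \<open>auto simp flip: hU\<close>)
    ultimately show ?thesis using ev_nested_itg_product[OF f'(1) g'(1) k'] by simp
  qed
  also have "\<dots> = S.ev ((nested_itg k \<otimes>\<^bsub>S\<^esub> nested_itg g) \<otimes>\<^bsub>S\<^esub> nested_itg f)"
    using nested_itg_closed[OF f'(1)] nested_itg_closed[OF g'(1)] nested_itg_closed[OF k'(1)]
    by (simp add: S.m_ac)
  also have "\<dots> = h b \<oplus>\<^bsub>S\<^esub> h SV"
  proof -
    have "h b = S.ev (nested_itg f \<otimes>\<^bsub>S\<^esub> J (w g \<otimes>\<^bsub>T\<^esub> w k))"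
      unfolding b_def using he[OF pos shuffle_pos] f' g' k' by (simp add: J_w)
    also have "\<dots> = S.ev (J (w k \<otimes>\<^bsub>T\<^esub> w g) \<otimes>\<^bsub>S\<^esub> nested_itg f)"
      unfolding T_mult_comm[OF g'(1) k'(1)]
      by (simp only: S.m_comm[OF nested_itg_closed[OF f'(1)] J_closed[OF T_mult_closed[OF k'(1) g'(1)]]])
    finally have "h b = S.ev (J (w k \<otimes>\<^bsub>T\<^esub> w g) \<otimes>\<^bsub>S\<^esub> nested_itg f)" .
    moreover have "h SV = (\<Oplus>\<^bsub>S\<^esub>j\<in>{0..<length g}. h (V j))"
      unfolding SV_def by (rule fin) (use V in auto)
    moreover have "\<dots> = (\<Oplus>\<^bsub>S\<^esub>j\<in>{0..<length g}. \<Oplus>\<^bsub>S\<^esub>i\<in>{1 - j..<length k}. pairing (drop i k) (drop j g) \<otimes>\<^bsub>S\<^esub>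
      S.ev (J (w (take i k) \<otimes>\<^bsub>T\<^esub> w (take j g)) \<otimes>\<^bsub>S\<^esub> nested_itg f))"
      by (rule S.finsum_cong') (use hV hc[OF V] in \<open>auto simp flip: hV\<close>)
    ultimately show ?thesis using ev_nested_itg_product[OF k'(1) g'(1) f'] by simp
  qed
  finally have main: "h a \<oplus>\<^bsub>S\<^esub> h SU = h b \<oplus>\<^bsub>S\<^esub> h SV" .
  note hadd = linear_maps_add[OF hl, simplified]
  have "h (a \<oplus>\<^bsub>Sym2\<^esub> X) \<oplus>\<^bsub>S\<^esub> h SV = h (b) \<oplus>\<^bsub>S\<^esub> h SV"
    using ab XSc XV main by (simp add: hadd[symmetric] A.a_assoc)
  then have 1: "h (a \<oplus>\<^bsub>Sym2\<^esub> X) = h b"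
    using ab XSc hc by (simp add: S.add.right_cancel)
  have "h (J2_gen f g k) = h ((a \<ominus>\<^bsub>Sym2\<^esub> b) \<oplus>\<^bsub>Sym2\<^esub> X)"
    by (simp add: J2_gen_def a_def b_def X_def U_def V_def)
  also have "(a \<ominus>\<^bsub>Sym2\<^esub> b) \<oplus>\<^bsub>Sym2\<^esub> X = (a \<oplus>\<^bsub>Sym2\<^esub> X) \<ominus>\<^bsub>Sym2\<^esub> b"
    using ab XSc by (simp add: a_minus_def A.a_ac)
  also have "h \<dots> = h (a \<oplus>\<^bsub>Sym2\<^esub> X) \<ominus>\<^bsub>S\<^esub> h b"
    using linear_maps_minus[OF hl Am S_module, of "a \<oplus>\<^bsub>Sym2\<^esub> X" b] ab XSc by simp
  also have "\<dots> = \<zero>\<^bsub>S\<^esub>" unfolding 1 using hc[OF ab(2)] by (simp add: a_minus_def S.r_neg)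
  finally show ?thesis .
qed


lemma C2_hom:
  "\<exists>h\<in>linear_maps C C2 S_alg. h \<in> ring_hom C2 S_alg \<and>
    (\<forall>s\<in>carrier T_pos. \<forall>t\<in>carrier T_pos. h (eps2 s t) = S.ev (J s \<otimes>\<^bsub>S\<^esub> J t)) \<and>
    (\<forall>c\<in>carrier C2. h c \<in> constants S derS)"
proof -
  interpret A: algebra C Sym2 by (rule Sym2_algebra)
  interpret B: algebra C S_alg by (rule S_algebra)
  from Sym2_hom obtain h where h: "h \<in> linear_maps C Sym2 S_alg" "h \<in> ring_hom Sym2 S_alg"
    "\<And>s t. s \<in> carrier T_pos \<Longrightarrow> t \<in> carrier T_pos \<Longrightarrow> h (eps_sym2 s t) = S.ev (J s \<otimes>\<^bsub>S\<^esub> J t)"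
    "\<And>c. c \<in> carrier Sym2 \<Longrightarrow> h c \<in> constants S derS" by blast
  have "ring_hom_ring Sym2 S_alg h"
    by (rule ring_hom_ringI2[OF A.ring_axioms B.ring_axioms h(2)])
  then have "ideal (a_kernel Sym2 S_alg h) Sym2" by (rule ring_hom_ring.kernel_is_ideal)
  then have "J2 \<subseteq> a_kernel Sym2 S_alg h"
    unfolding J2_def
    by (rule A.genideal_minimal)
       (auto simp: a_kernel_def' intro!: J2_gen_closed Sym2_hom_J2_gen[OF h(1-3)])
  then have kill: "h p = \<zero>\<^bsub>S_alg\<^esub>" if "p \<in> J2" for p
    using that by (auto simp: a_kernel_def')
  from quot_module_lift[OF A.module_axioms ideal_submodule[OF Sym2_algebra J2_ideal] S_module h(1) kill]
  obtain k where k: "k \<in> linear_maps C C2 S_alg" "\<And>p. p \<in> carrier Sym2 \<Longrightarrow> k (J2 +>\<^bsub>Sym2\<^esub> p) = h p"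
    unfolding C2_def by blast
  have surj: "\<exists>p\<in>carrier Sym2. c = J2 +>\<^bsub>Sym2\<^esub> p" if "c \<in> carrier C2" for c
    using that by (auto simp: C2_def quot_module_carrier)
  note mult = quot_algebra_mult[OF Sym2_algebra J2_ideal, folded C2_def]
  have "k \<in> ring_hom C2 S_alg"
  proof (rule ring_hom_memI)
    fix c d assume cd: "c \<in> carrier C2" "d \<in> carrier C2"
    show "k c \<in> carrier S_alg" by (rule linear_maps_closed[OF k(1) cd(1)])
    show "k (c \<oplus>\<^bsub>C2\<^esub> d) = k c \<oplus>\<^bsub>S_alg\<^esub> k d" by (rule linear_maps_add[OF k(1) cd])
    from surj[OF cd(1)] surj[OF cd(2)] obtain p q where "p \<in> carrier Sym2" "q \<in> carrier Sym2"
      "c = J2 +>\<^bsub>Sym2\<^esub> p" "d = J2 +>\<^bsub>Sym2\<^esub> q" by blast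
    then show "k (c \<otimes>\<^bsub>C2\<^esub> d) = k c \<otimes>\<^bsub>S_alg\<^esub> k d"
      using ring_hom_mult[OF h(2)] by (simp add: mult k(2))
  next
    have "\<one>\<^bsub>C2\<^esub> = J2 +>\<^bsub>Sym2\<^esub> \<one>\<^bsub>Sym2\<^esub>" by (simp add: C2_def quot_module_simps)
    then show "k \<one>\<^bsub>C2\<^esub> = \<one>\<^bsub>S_alg\<^esub>" using ring_hom_one[OF h(2)] by (simp add: k(2))
  qed
  moreover have "k (eps2 s t) = S.ev (J s \<otimes>\<^bsub>S\<^esub> J t)" if "s \<in> carrier T_pos" "t \<in> carrier T_pos" for s t
    using that bilinear_maps_closed[OF eps_sym2_bilinear] by (simp add: eps2_def k(2) h(3))
  moreover have "k c \<in> constants S derS" if "c \<in> carrier C2" for c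
    using surj[OF that] by (auto simp: k(2) h(4))
  ultimately show ?thesis using k(1) by blast
qed

text \<open>
  Multiplicativity on words is the product formula for nested integrals.
\<close>

lemma C2T_hom:
  assumes hl: "h \<in> linear_maps C C2 S_alg" and hr: "h \<in> ring_hom C2 S_alg"
    and he: "\<And>s t. s \<in> carrier T_pos \<Longrightarrow> t \<in> carrier T_pos \<Longrightarrow> h (eps2 s t) = S.ev (J s \<otimes>\<^bsub>S\<^esub> J t)"
    and hc: "\<And>c. c \<in> carrier C2 \<Longrightarrow> h c \<in> constants S derS"
  shows "\<exists>k\<in>linear_maps C C2T S_alg. k \<in> ring_hom C2T S_alg \<and>
    (\<forall>c\<in>carrier C2. \<forall>f\<in>RT_lists. k (t2 c (w f)) = h c \<otimes>\<^bsub>S\<^esub> nested_itg f)"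
proof -
  have "linear_maps C C2T S_alg = linear_maps C (tensor_module C C2 T) S_alg"
    by (rule linear_maps_record_cong) (simp_all add: C2T_simps)
  with tensor_lift[OF C2_module T_module S_module bilinear_maps_precomp[OF S_bilinear hl J_linear]]
  obtain k where k: "k \<in> linear_maps C C2T S_alg"
    "\<And>c t. c \<in> carrier C2 \<Longrightarrow> t \<in> carrier T \<Longrightarrow> k (t2 c t) = h c \<otimes>\<^bsub>S\<^esub> J t" by auto
  note td = take_drop_RT_lists
  note mc = bilinear_maps_closed[OF C2_bilinear] and tc = bilinear_maps_closed[OF t2_bilinear]
  note hS = S.constantsD(1)[OF hc]
  note fin = linear_maps_finsum[OF k(1) C2T_module S_module, simplified]
  have word: "k (word_product e f g) = h e \<otimes>\<^bsub>S\<^esub> (nested_itg f \<otimes>\<^bsub>S\<^esub> nested_itg g)"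
    if e: "e \<in> carrier C2" and f: "f \<in> RT_lists" and g: "g \<in> RT_lists" for e f g
  proof -
    interpret P: module C C2T by (rule C2T_module)
    define t where "t i j = t2 (e \<otimes>\<^bsub>C2\<^esub> eps2 (w (drop i f)) (w (drop j g))) (w (take i f) \<otimes>\<^bsub>T\<^esub> w (take j g))" for i j
    define s where "s i j = pairing (drop i f) (drop j g) \<otimes>\<^bsub>S\<^esub> (h e \<otimes>\<^bsub>S\<^esub> J (w (take i f) \<otimes>\<^bsub>T\<^esub> w (take j g)))" for i j
    have dpos: "w (drop i a) \<in> carrier T_pos" if "a \<in> RT_lists" "i < length a" for i a
      by (rule w_pos[OF td(2)]) (use that in auto)
    have ec: "eps2 (w (drop i f)) (w (drop j g)) \<in> carrier C2" if "i < length f" "j < length g" for i j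
      by (intro bilinear_maps_closed[OF eps2_bilinear] dpos f g that)
    have Jc: "J (w (take i f) \<otimes>\<^bsub>T\<^esub> w (take j g)) \<in> carrier S" for i j
      by (intro J_closed T_mult_closed td f g)
    have tcl: "t i j \<in> carrier C2T" if "i < length f" "j < length g" for i j
      unfolding t_def by (intro tc mc e ec T_mult_closed td f g that)
    have scl: "s i j \<in> carrier S" for i j
      unfolding s_def by (intro S.m_closed pairing_closed td f g hS e Jc)
    have ts: "k (t i j) = s i j" if "i < length f" "j < length g" for i j
    proof -
      have "h (eps2 (w (drop i f)) (w (drop j g))) = pairing (drop i f) (drop j g)"
        using that by (simp add: he dpos f g pairing_def J_w td)
      then show ?thesis
        unfolding t_def s_def using that ring_hom_mult[OF hr e ec[OF that]] ec[OF that] e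
        by (simp add: k(2) mc T_mult_closed td f g S.m_ac hS Jc pairing_closed)
    qed
    have "k (word_product e f g) = k (t2 e (w f \<otimes>\<^bsub>T\<^esub> w g)) \<oplus>\<^bsub>S\<^esub>
        k (\<Oplus>\<^bsub>C2T\<^esub>i\<in>{0..<length f}. \<Oplus>\<^bsub>C2T\<^esub>j\<in>{0..<length g}. t i j)"
      unfolding word_product_def t_def[symmetric]
      using linear_maps_add[OF k(1) tc[OF e T_mult_closed[OF f g]]
          P.M.finsum_closed[of "\<lambda>i. \<Oplus>\<^bsub>C2T\<^esub>j\<in>{0..<length g}. t i j" "{0..<length f}"]] tcl
      by (simp add: Pi_iff P.M.finsum_closed)
    also have "k (\<Oplus>\<^bsub>C2T\<^esub>i\<in>{0..<length f}. \<Oplus>\<^bsub>C2T\<^esub>j\<in>{0..<length g}. t i j) =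
        (\<Oplus>\<^bsub>S\<^esub>i\<in>{0..<length f}. k (\<Oplus>\<^bsub>C2T\<^esub>j\<in>{0..<length g}. t i j))"
      by (rule fin) (use tcl in \<open>auto intro!: P.M.finsum_closed\<close>)
    also have "\<dots> = (\<Oplus>\<^bsub>S\<^esub>i\<in>{0..<length f}. \<Oplus>\<^bsub>S\<^esub>j\<in>{0..<length g}. s i j)"
    proof (rule S.finsum_cong')
      fix i assume i: "i \<in> {0..<length f}"
      have "k (\<Oplus>\<^bsub>C2T\<^esub>j\<in>{0..<length g}. t i j) = (\<Oplus>\<^bsub>S\<^esub>j\<in>{0..<length g}. k (t i j))"
        by (rule fin) (use tcl i in auto)
      also have "\<dots> = (\<Oplus>\<^bsub>S\<^esub>j\<in>{0..<length g}. s i j)"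
        by (rule S.finsum_cong') (use scl ts i in auto)
      finally show "k (\<Oplus>\<^bsub>C2T\<^esub>j\<in>{0..<length g}. t i j) = (\<Oplus>\<^bsub>S\<^esub>j\<in>{0..<length g}. s i j)" .
    qed (auto intro!: S.finsum_closed scl)
    also have "k (t2 e (w f \<otimes>\<^bsub>T\<^esub> w g)) = h e \<otimes>\<^bsub>S\<^esub> J (w f \<otimes>\<^bsub>T\<^esub> w g)"
      by (rule k(2)[OF e T_mult_closed[OF f g]])
    also have "h e \<otimes>\<^bsub>S\<^esub> J (w f \<otimes>\<^bsub>T\<^esub> w g) \<oplus>\<^bsub>S\<^esub> (\<Oplus>\<^bsub>S\<^esub>i\<in>{0..<length f}. \<Oplus>\<^bsub>S\<^esub>j\<in>{0..<length g}. s i j) =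
        h e \<otimes>\<^bsub>S\<^esub> (nested_itg f \<otimes>\<^bsub>S\<^esub> nested_itg g)"
      unfolding s_def nested_itg_product[OF f g]
    proof (rule constant_linear_finsum[symmetric])
      show "(\<lambda>s. h e \<otimes>\<^bsub>S\<^esub> s) \<in> linear_maps C S_alg S_alg"
        by (rule bilinear_maps_right[OF S_bilinear]) (simp add: hS e)
      show "h e \<otimes>\<^bsub>S\<^esub> (c \<otimes>\<^bsub>S\<^esub> s) = c \<otimes>\<^bsub>S\<^esub> (h e \<otimes>\<^bsub>S\<^esub> s)"
        if "c \<in> constants S derS" "s \<in> carrier S" for c s
        using that S.constantsD(1) hS[OF e] by (simp add: S.m_lcomm)
    qed (intro J_closed T_mult_closed pairing_constant td f g)+
    finally show ?thesis .
  qed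
  have mult: "k (p \<otimes>\<^bsub>C2T\<^esub> q) = k p \<otimes>\<^bsub>S\<^esub> k q" if "p \<in> carrier C2T" "q \<in> carrier C2T" for p q
  proof (rule bilinear_maps_eq_on_spans[OF C2T_spans C2T_spans C2T_module C2T_module S_module
        bilinear_maps_comp[OF C2T_bilinear k(1)] bilinear_maps_precomp[OF S_bilinear k(1) k(1)] _ that])
    fix a b assume "a \<in> (\<lambda>(c, f). t2 c (w f)) ` (carrier C2 \<times> RT_lists)"
      "b \<in> (\<lambda>(c, f). t2 c (w f)) ` (carrier C2 \<times> RT_lists)"
    then obtain c f d g where "a = t2 c (w f)" "c \<in> carrier C2" "f \<in> RT_lists"
      and "b = t2 d (w g)" "d \<in> carrier C2" "g \<in> RT_lists"
      by (elim t2_familyE)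
    then show "k (a \<otimes>\<^bsub>C2T\<^esub> b) = k a \<otimes>\<^bsub>S\<^esub> k b"
      by (simp add: C2T_mult word mc k(2) J_w w_closed ring_hom_mult[OF hr] nested_itg_closed hS S.m_ac)
  qed
  have "k \<in> ring_hom C2T S_alg"
    by (rule ring_hom_memI)
       (use linear_maps_closed[OF k(1)] linear_maps_add[OF k(1)] mult
         ring_hom_one[OF hr] C2_one_closed w_closed[of "[]"]
        in \<open>auto simp: C2T_simps(5) k(2) J_w\<close>)
  then show ?thesis using k by (intro bexI[of _ k]) (auto simp: w_closed J_w)
qed

lemma IDR_hom:
  "\<exists>eta h1 h2. eta \<in> linear_maps C IDR S_alg \<and> eta \<in> ring_hom IDR S_alg \<and>
    (\<forall>c\<in>carrier C1. h1 c \<in> constants S derS) \<and> (\<forall>c\<in>carrier C2. h2 c \<in> constants S derS) \<and>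
    h1 \<in> ring_hom C1 S_alg \<and> h2 \<in> ring_hom C2 S_alg \<and>
    (\<forall>q\<in>carrier RJ. \<forall>t\<in>carrier T_pos. h1 (eps1 q t) = S.ev (phi q \<otimes>\<^bsub>S\<^esub> J t)) \<and>
    (\<forall>x\<in>carrier R. \<forall>c\<in>carrier C1. \<forall>c'\<in>carrier C2. \<forall>f\<in>RT_lists.
      eta (pure x c c' f) = phi x \<otimes>\<^bsub>S\<^esub> (h1 c \<otimes>\<^bsub>S\<^esub> (h2 c' \<otimes>\<^bsub>S\<^esub> nested_itg f)))"
proof -
  from C1_hom obtain h1 where h1: "h1 \<in> linear_maps C C1 S_alg" "h1 \<in> ring_hom C1 S_alg"
    "\<forall>q\<in>carrier RJ. \<forall>t\<in>carrier T_pos. h1 (eps1 q t) = S.ev (phi q \<otimes>\<^bsub>S\<^esub> J t)"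
    "\<forall>c\<in>carrier C1. h1 c \<in> constants S derS" by blast
  from C2_hom obtain h2 where h2: "h2 \<in> linear_maps C C2 S_alg" "h2 \<in> ring_hom C2 S_alg"
    "\<And>s t. s \<in> carrier T_pos \<Longrightarrow> t \<in> carrier T_pos \<Longrightarrow> h2 (eps2 s t) = S.ev (J s \<otimes>\<^bsub>S\<^esub> J t)"
    "\<And>c. c \<in> carrier C2 \<Longrightarrow> h2 c \<in> constants S derS" by blast
  from C2T_hom[OF h2] obtain k where k: "k \<in> linear_maps C C2T S_alg" "k \<in> ring_hom C2T S_alg"
    "\<And>c f. c \<in> carrier C2 \<Longrightarrow> f \<in> RT_lists \<Longrightarrow> k (t2 c (w f)) = h2 c \<otimes>\<^bsub>S\<^esub> nested_itg f" by blast
  from tensor_algebra_hom[OF C1_module C1_bilinear C1_one_closed C2T_module C2T_bilinear C2T_one_closed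
      S_algebra h1(1,2) k(1,2)]
  obtain l where l: "l \<in> linear_maps C CT S_alg" "l \<in> ring_hom CT S_alg"
    "\<And>c p. c \<in> carrier C1 \<Longrightarrow> p \<in> carrier C2T \<Longrightarrow> l (tC c p) = h1 c \<otimes>\<^bsub>S\<^esub> k p" by auto
  have phi: "phi \<in> ring_hom R_alg S_alg"
    by (rule ring_hom_memI) (auto simp: phi_closed phi_mult phi_add phi_one)
  have R1: "\<one>\<^bsub>R_alg\<^esub> \<in> carrier R_alg" by simp
  from tensor_algebra_hom[OF R_alg_module R_bilinear R1 CT_module CT_bilinear CT_one_closed
      S_algebra phi_linear phi l(1,2), folded IDR_def]
  obtain eta where eta: "eta \<in> linear_maps C IDR S_alg" "eta \<in> ring_hom IDR S_alg"
    "\<And>x p. x \<in> carrier R \<Longrightarrow> p \<in> carrier CT \<Longrightarrow> eta (tR x p) = phi x \<otimes>\<^bsub>S\<^esub> l p" by auto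
  have "eta (pure x c c' f) = phi x \<otimes>\<^bsub>S\<^esub> (h1 c \<otimes>\<^bsub>S\<^esub> (h2 c' \<otimes>\<^bsub>S\<^esub> nested_itg f))"
    if "x \<in> carrier R" "c \<in> carrier C1" "c' \<in> carrier C2" "f \<in> RT_lists" for x c c' f
    using that by (simp add: pure_eq eta(3) l(3) k(3) tC_closed t2_closed)
  then show ?thesis using eta(1,2) h1(2-4) h2(2,4) by blast
qed

subsection \<open>Compatibility with derivation and integral\<close>

lemma phi_split:
  assumes x: "x \<in> carrier R"
  shows "phi x = derS (phi (Q x)) \<oplus>\<^bsub>S\<^esub> phi (x \<ominus> der (Q x))"
proof -
  have c: "der (Q x) \<in> carrier R" by (intro der_closed Q_closed x)
  have "x = der (Q x) \<oplus> (x \<ominus> der (Q x))"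
    using x c by (simp add: a_minus_def a_lcomm r_neg)
  then have "phi x = phi (der (Q x)) \<oplus>\<^bsub>S\<^esub> phi (x \<ominus> der (Q x))"
    using phi_add[of "der (Q x)" "x \<ominus> der (Q x)"] x c by (metis minus_closed)
  then show ?thesis using x by (simp add: phi_der Q_closed)
qed

text \<open>
  This is where \<open>\<phi>(Q \<partial> f) = \<integral>\<partial>\<phi>(f)\<close> is used: with \<open>Q x\<close> for \<open>f\<close> it says that \<open>\<phi>(Q x)\<close> is the
  integral of its derivative.
\<close>

lemma itgS_phi:
  assumes x: "x \<in> carrier R"
  shows "itgS (phi x) = phi (Q x) \<oplus>\<^bsub>S\<^esub> nested_itg [x \<ominus> der (Q x)]"
proof -
  have c: "x \<ominus> der (Q x) \<in> carrier R" by (rule RT_into_R[OF transcendental_part[OF x]])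
  have q: "Q x \<in> carrier R" by (rule Q_closed[OF x])
  have "itgS (derS (phi (Q x))) = phi (Q x)"
    using phi_Q_der[OF q] Q_der_Q[OF x] by simp
  then show ?thesis
    using c q by (subst phi_split[OF x]) (simp add: S.itg_add S.der_closed phi_closed)
qed

text \<open>
  Split \<open>x\<close> into \<open>\<partial> (Q x)\<close> and its part in \<open>ker Q\<close>.  The latter becomes a new first letter; to the
  former, apply \<open>\<integral>\<partial> = id - ev\<close> and the Leibniz rule.
\<close>

lemma itgS_by_parts:
  assumes x: "x \<in> carrier R" and y: "y \<in> carrier RT" and f: "f \<in> RT_lists"
  shows "itgS (phi x \<otimes>\<^bsub>S\<^esub> nested_itg (y # f)) =
    phi (Q x) \<otimes>\<^bsub>S\<^esub> nested_itg (y # f) \<ominus>\<^bsub>S\<^esub> S.ev (phi (Q x) \<otimes>\<^bsub>S\<^esub> nested_itg (y # f))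
    \<ominus>\<^bsub>S\<^esub> itgS (phi (Q x \<otimes> y) \<otimes>\<^bsub>S\<^esub> nested_itg f)
    \<oplus>\<^bsub>S\<^esub> nested_itg ((x \<ominus> der (Q x)) # y # f)"
proof -
  let ?N = "nested_itg (y # f)" and ?M = "nested_itg f" and ?q = "phi (Q x)"
    and ?z = "phi (x \<ominus> der (Q x))"
  have yf: "y # f \<in> RT_lists" using y f by simp
  have N: "?N \<in> carrier S" by (rule nested_itg_closed[OF yf])
  have M: "?M \<in> carrier S" by (rule nested_itg_closed[OF f])
  have q: "?q \<in> carrier S" and z: "?z \<in> carrier S" and py: "phi y \<in> carrier S"
    using x y RT_into_R transcendental_part by (auto intro!: phi_closed Q_closed)
  have dN: "derS ?N = phi y \<otimes>\<^bsub>S\<^esub> ?M" using M py by (simp add: S.der_itg)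
  have qy: "phi (Q x \<otimes> y) = ?q \<otimes>\<^bsub>S\<^esub> phi y" using x y by (simp add: phi_mult Q_closed RT_into_R)
  let ?d = "itgS (derS ?q \<otimes>\<^bsub>S\<^esub> ?N)" and ?e = "itgS (phi (Q x \<otimes> y) \<otimes>\<^bsub>S\<^esub> ?M)"
  have dc: "?d \<in> carrier S" and ec: "?e \<in> carrier S"
    using q N M py by (auto simp: qy intro!: S.itg_closed S.m_closed S.der_closed)
  have "derS (?q \<otimes>\<^bsub>S\<^esub> ?N) = derS ?q \<otimes>\<^bsub>S\<^esub> ?N \<oplus>\<^bsub>S\<^esub> phi (Q x \<otimes> y) \<otimes>\<^bsub>S\<^esub> ?M"
    unfolding S.der_mult[OF q N] dN qy using q py M by (simp add: S.m_assoc)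
  then have "itgS (derS (?q \<otimes>\<^bsub>S\<^esub> ?N)) = ?d \<oplus>\<^bsub>S\<^esub> ?e"
    using q N M py by (simp add: S.itg_add S.der_closed qy del: nested_itg.simps)
  then have ev: "S.ev (?q \<otimes>\<^bsub>S\<^esub> ?N) = ?q \<otimes>\<^bsub>S\<^esub> ?N \<ominus>\<^bsub>S\<^esub> (?d \<oplus>\<^bsub>S\<^esub> ?e)"
    by (simp only: S.ev_def)
  have qN: "?q \<otimes>\<^bsub>S\<^esub> ?N \<in> carrier S" using q N by (rule S.m_closed)
  have cancel: "p \<ominus>\<^bsub>S\<^esub> (p \<ominus>\<^bsub>S\<^esub> (d \<oplus>\<^bsub>S\<^esub> e)) \<ominus>\<^bsub>S\<^esub> e = d"
    if "p \<in> carrier S" "d \<in> carrier S" "e \<in> carrier S" for p d e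
    using that by (simp add: a_minus_def S.minus_add S.a_ac S.r_neg S.r_neg1 S.r_neg2)
  have "itgS (phi x \<otimes>\<^bsub>S\<^esub> ?N) = ?d \<oplus>\<^bsub>S\<^esub> itgS (?z \<otimes>\<^bsub>S\<^esub> ?N)"
    unfolding phi_split[OF x] using q z N
    by (simp add: S.l_distr S.itg_add S.der_closed del: nested_itg.simps)
  also have "itgS (?z \<otimes>\<^bsub>S\<^esub> ?N) = nested_itg ((x \<ominus> der (Q x)) # y # f)" by simp
  finally show ?thesis unfolding ev cancel[OF qN dc ec] .
qed

text \<open>
  Derivation and integral are compared on pure tensors.  The factors from the two rings of
  constants have constant images in \<open>S\<close> and can be pulled out on both sides.
\<close>

lemma IDR_hom_exists:
  "\<exists>eta. eta \<in> integro_diff_ring_hom IDR IDR_der IDR_itg S derS itgS \<and> (\<forall>f\<in>carrier R. eta (iota f) = phi f)"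
proof -
  from IDR_hom obtain eta h1 h2 where eta: "eta \<in> linear_maps C IDR S_alg" "eta \<in> ring_hom IDR S_alg"
    and h1c: "\<And>c. c \<in> carrier C1 \<Longrightarrow> h1 c \<in> constants S derS"
    and h2c: "\<And>c. c \<in> carrier C2 \<Longrightarrow> h2 c \<in> constants S derS"
    and h1r: "h1 \<in> ring_hom C1 S_alg" and h2r: "h2 \<in> ring_hom C2 S_alg"
    and h1e: "\<And>q t. q \<in> carrier RJ \<Longrightarrow> t \<in> carrier T_pos \<Longrightarrow> h1 (eps1 q t) = S.ev (phi q \<otimes>\<^bsub>S\<^esub> J t)"
    and ep: "\<And>x c c' f. \<lbrakk>x \<in> carrier R; c \<in> carrier C1; c' \<in> carrier C2; f \<in> RT_lists\<rbrakk> \<Longrightarrow>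
      eta (pure x c c' f) = phi x \<otimes>\<^bsub>S\<^esub> (h1 c \<otimes>\<^bsub>S\<^esub> (h2 c' \<otimes>\<^bsub>S\<^esub> nested_itg f))" by blast
  interpret P: module C IDR by (rule IDR_module)
  have kc: "h1 c \<otimes>\<^bsub>S\<^esub> h2 c' \<in> constants S derS" if "c \<in> carrier C1" "c' \<in> carrier C2" for c c'
    using that h1c h2c by (simp add: S.constants_closed)
  have ep': "eta (pure x c c' f) = (h1 c \<otimes>\<^bsub>S\<^esub> h2 c') \<otimes>\<^bsub>S\<^esub> (phi x \<otimes>\<^bsub>S\<^esub> nested_itg f)"
    if "x \<in> carrier R" "c \<in> carrier C1" "c' \<in> carrier C2" "f \<in> RT_lists" for x c c' f
    using that S.constantsD(1)[OF h1c] S.constantsD(1)[OF h2c]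
    by (simp add: ep phi_closed nested_itg_closed S.m_ac)
  note eadd = linear_maps_add[OF eta(1), simplified]
  note ediff = linear_maps_minus[OF eta(1) IDR_module S_module, simplified]
  have der: "eta (IDR_der p) = derS (eta p)" if "p \<in> carrier IDR" for p
  proof (rule linear_maps_eq_on_spans[OF pure_spans IDR_module S_module
        linear_maps_comp[OF eta(1) IDR_der_linear] linear_maps_comp[OF derS_linear eta(1)] _ that])
    fix a assume "a \<in> (\<lambda>(x, c1, c2, f). pure x c1 c2 f) ` (carrier R \<times> carrier C1 \<times> carrier C2 \<times> RT_lists)"
    then obtain x c c' f where a: "a = pure x c c' f" and
      *: "x \<in> carrier R" "c \<in> carrier C1" "c' \<in> carrier C2" "f \<in> RT_lists"
      by (rule pure_familyE)
    note k = kc[OF *(2,3)] and kS = S.constantsD(1)[OF kc[OF *(2,3)]]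
    have px: "phi x \<in> carrier S" "derS (phi x) \<in> carrier S" using * by (auto intro!: S.der_closed phi_closed)
    show "eta (IDR_der a) = derS (eta a)"
    proof (cases f)
      case Nil
      then show ?thesis
        using * k px kS by (simp add: a IDR_der_pure ep' der_closed phi_der S.der_const_mult)
    next
      case (Cons y g)
      with * have y: "y \<in> carrier RT" "g \<in> RT_lists" by auto
      have N: "nested_itg (y # g) \<in> carrier S" "nested_itg g \<in> carrier S" "phi y \<in> carrier S"
        using y by (auto intro!: nested_itg_closed phi_closed RT_into_R simp del: nested_itg.simps)
      have dN: "derS (nested_itg (y # g)) = phi y \<otimes>\<^bsub>S\<^esub> nested_itg g" using N by (simp add: S.der_itg)
      have "eta (IDR_der a) = eta (pure (der x) c c' (y # g)) \<oplus>\<^bsub>S\<^esub> eta (pure (x \<otimes> y) c c' g)"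
        using * y by (simp add: a Cons IDR_der_pure eadd pure_closed der_closed RT_into_R)
      also have "\<dots> = (h1 c \<otimes>\<^bsub>S\<^esub> h2 c') \<otimes>\<^bsub>S\<^esub> (derS (phi x) \<otimes>\<^bsub>S\<^esub> nested_itg (y # g) \<oplus>\<^bsub>S\<^esub>
          phi x \<otimes>\<^bsub>S\<^esub> (phi y \<otimes>\<^bsub>S\<^esub> nested_itg g))"
        using * y N kS px
        by (simp add: ep' der_closed RT_into_R phi_der phi_mult S.r_distr S.m_assoc del: nested_itg.simps)
      also have "\<dots> = derS (eta a)"
        using * y N px k by (simp add: a Cons ep' S.der_const_mult S.der_mult dN del: nested_itg.simps)
      finally show ?thesis .
    qed
  qed
  have itg_pure: "eta (itg_pure x c c' f) = itgS (eta (pure x c c' f))"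
    if c: "c \<in> carrier C1" "c' \<in> carrier C2" and "x \<in> carrier R" "f \<in> RT_lists" for x c c' f
    using that(3,4)
  proof (induction f arbitrary: x)
    case Nil
    then have x: "x \<in> carrier R" by simp
    note z = transcendental_part[OF x] and k = kc[OF c] and kS = S.constantsD(1)[OF kc[OF c]]
    have zc: "nested_itg [x \<ominus> der (Q x)] \<in> carrier S" by (rule nested_itg_closed) (use z in simp)
    have "eta (itg_pure x c c' []) = eta (pure (Q x) c c' []) \<oplus>\<^bsub>S\<^esub> eta (pure \<one> c c' [x \<ominus> der (Q x)])"
      using x c z by (simp add: eadd pure_closed Q_closed)
    also have "\<dots> = (h1 c \<otimes>\<^bsub>S\<^esub> h2 c') \<otimes>\<^bsub>S\<^esub> itgS (phi x)"
      using x c z zc kS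
      by (simp add: ep' Q_closed itgS_phi phi_one phi_closed S.r_distr del: nested_itg.simps(2))
    also have "\<dots> = itgS (eta (pure x c c' []))"
      using x c k by (simp add: ep' phi_closed S.itg_const)
    finally show ?case .
  next
    case (Cons y g)
    then have x: "x \<in> carrier R" and y: "y \<in> carrier RT" and g: "g \<in> RT_lists" by auto
    have yg: "y # g \<in> RT_lists" using y g by simp
    note z = transcendental_part[OF x] and k = kc[OF c] and kS = S.constantsD(1)[OF kc[OF c]]
    let ?N = "nested_itg (y # g)" and ?k = "h1 c \<otimes>\<^bsub>S\<^esub> h2 c'"
    have N: "?N \<in> carrier S" "nested_itg g \<in> carrier S" by (rule nested_itg_closed[OF yg] nested_itg_closed[OF g])+
    have zN: "nested_itg ((x \<ominus> der (Q x)) # y # g) \<in> carrier S" by (rule nested_itg_closed) (use z y g in simp)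
    have Qx: "Q x \<in> carrier R" "Q x \<in> carrier RJ" "phi (Q x) \<in> carrier S"
      using x by (auto intro: Q_closed phi_closed)
    have Qxy: "Q x \<otimes> y \<in> carrier R" using Qx y by (simp add: RT_into_R)
    have e1: "eps1 (Q x) (w (y # g)) \<in> carrier C1" by (rule eps1_closed[OF x yg]) simp
    have ce: "c \<otimes>\<^bsub>C1\<^esub> eps1 (Q x) (w (y # g)) \<in> carrier C1"
      by (rule bilinear_maps_closed[OF C1_bilinear c(1) e1])
    have h1ce: "h1 (c \<otimes>\<^bsub>C1\<^esub> eps1 (Q x) (w (y # g))) = h1 c \<otimes>\<^bsub>S\<^esub> S.ev (phi (Q x) \<otimes>\<^bsub>S\<^esub> ?N)"
      using ring_hom_mult[OF h1r c(1) e1] h1e[OF Qx(2) w_pos[OF yg]] J_w[OF yg] by (simp del: nested_itg.simps)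
    have evc: "S.ev (phi (Q x) \<otimes>\<^bsub>S\<^esub> ?N) \<in> carrier S" using Qx N by (intro S.ev_closed S.m_closed)
    have itc: "itgS (phi (Q x \<otimes> y) \<otimes>\<^bsub>S\<^esub> nested_itg g) \<in> carrier S"
      using Qxy N by (intro S.itg_closed S.m_closed phi_closed)
    have cS: "h1 c \<in> carrier S" "h2 c' \<in> carrier S" using c S.constantsD(1) h1c h2c by auto
    have b: "eta (pure \<one> (c \<otimes>\<^bsub>C1\<^esub> eps1 (Q x) (w (y # g))) c' []) = ?k \<otimes>\<^bsub>S\<^esub> S.ev (phi (Q x) \<otimes>\<^bsub>S\<^esub> ?N)"
      using c evc cS by (simp add: ep ce h1ce phi_one S.m_ac del: nested_itg.simps(2))
    have d: "eta (itg_pure (Q x \<otimes> y) c c' g) = ?k \<otimes>\<^bsub>S\<^esub> itgS (phi (Q x \<otimes> y) \<otimes>\<^bsub>S\<^esub> nested_itg g)"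
      using Cons.IH[OF Qxy g] ep'[OF Qxy c g] k Qxy N
      by (simp add: S.itg_const phi_closed)
    have a: "eta (pure (Q x) c c' (y # g)) = ?k \<otimes>\<^bsub>S\<^esub> (phi (Q x) \<otimes>\<^bsub>S\<^esub> ?N)"
      by (rule ep'[OF Qx(1) c yg])
    have e: "eta (pure \<one> c c' ((x \<ominus> der (Q x)) # y # g)) = ?k \<otimes>\<^bsub>S\<^esub> nested_itg ((x \<ominus> der (Q x)) # y # g)"
      using ep'[OF one_closed c, of "(x \<ominus> der (Q x)) # y # g"] z y g zN by (simp add: phi_one del: nested_itg.simps)
    have cl: "pure (Q x) c c' (y # g) \<in> carrier IDR"
      "pure \<one> (c \<otimes>\<^bsub>C1\<^esub> eps1 (Q x) (w (y # g))) c' [] \<in> carrier IDR"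
      "itg_pure (Q x \<otimes> y) c c' g \<in> carrier IDR"
      "pure \<one> c c' ((x \<ominus> der (Q x)) # y # g) \<in> carrier IDR"
      using Qx c yg ce Qxy g z by (auto intro!: pure_closed itg_pure_closed)
    have "eta (itg_pure x c c' (y # g)) = ?k \<otimes>\<^bsub>S\<^esub> (phi (Q x) \<otimes>\<^bsub>S\<^esub> ?N) \<ominus>\<^bsub>S\<^esub>
        ?k \<otimes>\<^bsub>S\<^esub> S.ev (phi (Q x) \<otimes>\<^bsub>S\<^esub> ?N) \<ominus>\<^bsub>S\<^esub>
        ?k \<otimes>\<^bsub>S\<^esub> itgS (phi (Q x \<otimes> y) \<otimes>\<^bsub>S\<^esub> nested_itg g) \<oplus>\<^bsub>S\<^esub>
        ?k \<otimes>\<^bsub>S\<^esub> nested_itg ((x \<ominus> der (Q x)) # y # g)"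
      using cl by (simp add: eadd ediff a b d e del: nested_itg.simps)
    also have "\<dots> = ?k \<otimes>\<^bsub>S\<^esub> itgS (phi x \<otimes>\<^bsub>S\<^esub> ?N)"
      unfolding itgS_by_parts[OF x y g] using kS Qx N evc itc zN
      by (simp add: a_minus_def S.r_distr S.r_minus del: nested_itg.simps)
    also have "\<dots> = itgS (eta (pure x c c' (y # g)))"
      using ep'[OF x c yg] k x N by (simp add: S.itg_const phi_closed del: nested_itg.simps)
    finally show ?case .
  qed
  have itg: "eta (IDR_itg p) = itgS (eta p)" if "p \<in> carrier IDR" for p
  proof (rule linear_maps_eq_on_spans[OF pure_spans IDR_module S_module
        linear_maps_comp[OF eta(1) IDR_itg_linear] linear_maps_comp[OF itgS_linear eta(1)] _ that])
    fix a assume "a \<in> (\<lambda>(x, c1, c2, f). pure x c1 c2 f) ` (carrier R \<times> carrier C1 \<times> carrier C2 \<times> RT_lists)"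
    then obtain x c c' f where a: "a = pure x c c' f" and
      *: "x \<in> carrier R" "c \<in> carrier C1" "c' \<in> carrier C2" "f \<in> RT_lists"
      by (rule pure_familyE)
    then show "eta (IDR_itg a) = itgS (eta a)" by (simp add: IDR_itg_pure itg_pure)
  qed
  have "eta (iota x) = phi x" if "x \<in> carrier R" for x
    using that ring_hom_one[OF h1r] ring_hom_one[OF h2r]
    by (simp add: iota_def ep C1_one_closed C2_one_closed phi_closed)
  moreover have "eta \<in> ring_hom IDR S"
    using eta(2) by (simp add: ring_hom_def)
  ultimately show ?thesis
    using der itg by (auto simp: integro_diff_ring_hom_def diff_ring_hom_def)
qed

end

section \<open>Uniqueness\<close>

context quasi_integro_diff_cring
begin

lemma IDR_one: "\<one>\<^bsub>IDR\<^esub> = pure \<one> \<one>\<^bsub>C1\<^esub> \<one>\<^bsub>C2\<^esub> []"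
  by (simp add: IDR_simps(5) CT_simps(5) C2T_simps(5) pure_eq)

lemma iota_closed: "x \<in> carrier R \<Longrightarrow> iota x \<in> carrier IDR"
  unfolding iota_def by (intro pure_closed C1_one_closed C2_one_closed) simp_all

lemma iota_mult_pure:
  "\<lbrakk>x \<in> carrier R; y \<in> carrier R; c \<in> carrier C1; c' \<in> carrier C2; f \<in> RT_lists\<rbrakk> \<Longrightarrow>
    iota x \<otimes>\<^bsub>IDR\<^esub> pure y c c' f = pure (x \<otimes> y) c c' f"
  by (simp add: iota_def pure_mult_Nil C1_one_closed C2_one_closed C1_one_left C2_one_left)

text \<open>
  So a ring homomorphism that is known on \<open>\<iota>\<close> is also known on scalar multiples.
\<close>

lemma iota_mult_constant:
  assumes c: "c \<in> constants R der" and p: "p \<in> carrier IDR"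
  shows "iota c \<otimes>\<^bsub>IDR\<^esub> p = c \<odot>\<^bsub>IDR\<^esub> p"
proof (rule linear_maps_eq_on_spans[OF pure_spans IDR_module IDR_module
      bilinear_maps_right[OF IDR_bilinear iota_closed[OF constantsD(1)[OF c]]]
      linear_maps_scale[OF linear_maps_id _ IDR_module] _ p])
  show "c \<in> carrier C" using c by simp
  fix a assume "a \<in> (\<lambda>(x, c1, c2, f). pure x c1 c2 f) ` (carrier R \<times> carrier C1 \<times> carrier C2 \<times> RT_lists)"
  then obtain x d d' f where a: "a = pure x d d' f" and
    *: "x \<in> carrier R" "d \<in> carrier C1" "d' \<in> carrier C2" "f \<in> RT_lists" by (rule pure_familyE)
  then show "iota c \<otimes>\<^bsub>IDR\<^esub> a = c \<odot>\<^bsub>IDR\<^esub> a"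
    using c linear_maps_smult[OF pure_linear_R[OF *(2-4)], of c x]
    by (simp add: iota_mult_pure constantsD)
qed

lemma pure_zero:
  "\<lbrakk>c \<in> carrier C1; c' \<in> carrier C2; f \<in> RT_lists\<rbrakk> \<Longrightarrow> pure \<zero> c c' f = \<zero>\<^bsub>IDR\<^esub>"
  using linear_maps_zero[OF pure_linear_R R_alg_module IDR_module] by simp

text \<open>
  Since \<open>Q y = 0\<close>, only the last term of the integral survives.
\<close>

lemma itg_pure_RT:
  assumes y: "y \<in> carrier RT" and c: "c \<in> carrier C1" and c': "c' \<in> carrier C2" and f: "f \<in> RT_lists"
  shows "itg_pure y c c' f = pure \<one> c c' (y # f)"
proof -
  interpret P: module C IDR by (rule IDR_module)
  have Qy: "Q y = \<zero>" and yR: "y \<in> carrier R" using y by (simp_all add: RT_carrier)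
  have yz: "y \<ominus> der (Q y) = y" using yR by (simp add: Qy der_zero a_minus_def)
  have p: "pure \<one> c c' (y # f) \<in> carrier IDR" using assms by (intro pure_closed) auto
  show ?thesis
  proof (cases f)
    case Nil
    then show ?thesis using p c c' unfolding itg_pure.simps yz Nil by (simp add: Qy pure_zero)
  next
    case (Cons z g)
    with f have z: "z \<in> carrier RT" and g: "g \<in> RT_lists" and zg: "z # g \<in> RT_lists" by auto
    have "(\<lambda>x. eps1 x (w (z # g))) \<in> linear_maps C RJ C1"
      by (intro bilinear_maps_left[OF eps1_bilinear] w_pos zg) simp
    from linear_maps_zero[OF this RJ_module C1_module] have "eps1 \<zero> (w (z # g)) = \<zero>\<^bsub>C1\<^esub>" by simp
    moreover have "c \<otimes>\<^bsub>C1\<^esub> \<zero>\<^bsub>C1\<^esub> = \<zero>\<^bsub>C1\<^esub>"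
      by (rule linear_maps_zero[OF bilinear_maps_right[OF C1_bilinear c] C1_module C1_module])
    moreover have "pure \<one> \<zero>\<^bsub>C1\<^esub> c' [] = \<zero>\<^bsub>IDR\<^esub>"
      by (rule linear_maps_zero[OF pure_linear_C1 C1_module IDR_module]) (use c' in simp_all)
    moreover have "itg_pure (\<zero> \<otimes> z) c c' g = \<zero>\<^bsub>IDR\<^esub>"
      using linear_maps_zero[OF itg_pure_linear_R[OF c c' g] R_alg_module IDR_module] RT_into_R[OF z] by simp
    moreover have "\<zero>\<^bsub>IDR\<^esub> \<ominus>\<^bsub>IDR\<^esub> \<zero>\<^bsub>IDR\<^esub> = \<zero>\<^bsub>IDR\<^esub>"
      unfolding a_minus_def by (rule P.M.r_neg) simp
    ultimately show ?thesis
      using p zg c c' unfolding Cons itg_pure.simps yz unfolding Qy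
      by (simp add: pure_zero)
  qed
qed

definition C2T_embed where
  "C2T_embed p = tR \<one> (tC \<one>\<^bsub>C1\<^esub> p)"

lemma C2T_embed_linear: "C2T_embed \<in> linear_maps C C2T IDR"
  unfolding C2T_embed_def[abs_def]
  by (intro linear_maps_comp[OF bilinear_maps_right[OF tR_bilinear] bilinear_maps_right[OF tC_bilinear]] C1_one_closed)
     simp

lemma C2T_embed_t2: "C2T_embed (t2 c (w f)) = pure \<one> \<one>\<^bsub>C1\<^esub> c f"
  by (simp add: C2T_embed_def pure_eq)

lemma pure_mult_words:
  assumes f: "f \<in> RT_lists" and g: "g \<in> RT_lists"
  shows "pure \<one> \<one>\<^bsub>C1\<^esub> \<one>\<^bsub>C2\<^esub> f \<otimes>\<^bsub>IDR\<^esub> pure \<one> \<one>\<^bsub>C1\<^esub> \<one>\<^bsub>C2\<^esub> g = C2T_embed (word_product \<one>\<^bsub>C2\<^esub> f g)"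
proof -
  note o = C1_one_closed C2_one_closed
  have "pure \<one> \<one>\<^bsub>C1\<^esub> \<one>\<^bsub>C2\<^esub> f \<otimes>\<^bsub>IDR\<^esub> pure \<one> \<one>\<^bsub>C1\<^esub> \<one>\<^bsub>C2\<^esub> g =
      tR (\<one> \<otimes> \<one>) (tC (\<one>\<^bsub>C1\<^esub> \<otimes>\<^bsub>C1\<^esub> \<one>\<^bsub>C1\<^esub>) (word_product (\<one>\<^bsub>C2\<^esub> \<otimes>\<^bsub>C2\<^esub> \<one>\<^bsub>C2\<^esub>) f g))"
    using f g o by (simp only: pure_eq IDR_mult[simplified] CT_mult C2T_mult tC_closed t2_closed one_closed)
  then show ?thesis
    using o by (simp add: C2T_embed_def C1_one_left C2_one_left)
qed

end

context integro_diff_target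
begin

text \<open>
  The equalizer \<open>X\<close> of the two homomorphisms is closed under linear combinations, products and the
  integral.  It contains all words, since a word is the integral of its first letter times the
  rest.  It contains the generators \<open>\<epsilon>(q \<otimes> f)\<close>, since all other terms in the formula for the
  integral of \<open>x \<otimes> f\<close> with \<open>Q x = q\<close> do belong to \<open>X\<close>.  It contains the generators \<open>\<epsilon>(f \<odot> g)\<close>, by
  induction on the length of the words, since all other terms in the product of \<open>f\<close> and \<open>g\<close> belong
  to \<open>X\<close>.  Pure tensors are products of these elements and of elements \<open>\<iota>(x)\<close>.
\<close>

lemma IDR_hom_unique:
  assumes eta: "eta \<in> integro_diff_ring_hom IDR IDR_der IDR_itg S derS itgS"
    and theta: "theta \<in> integro_diff_ring_hom IDR IDR_der IDR_itg S derS itgS"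
    and iota: "\<And>x. x \<in> carrier R \<Longrightarrow> eta (iota x) = theta (iota x)"
    and p: "p \<in> carrier IDR"
  shows "eta p = theta p"
proof -
  interpret P: module C IDR by (rule IDR_module)
  note er = eta[unfolded integro_diff_ring_hom_def diff_ring_hom_def mem_Collect_eq, THEN conjunct1, THEN conjunct1]
    and ei = eta[unfolded integro_diff_ring_hom_def mem_Collect_eq, THEN conjunct2, rule_format]
    and tr = theta[unfolded integro_diff_ring_hom_def diff_ring_hom_def mem_Collect_eq, THEN conjunct1, THEN conjunct1]
    and ti = theta[unfolded integro_diff_ring_hom_def mem_Collect_eq, THEN conjunct2, rule_format]
  define X where "X = {p \<in> carrier IDR. eta p = theta p}"
  let ?e = "\<one>\<^bsub>C1\<^esub>" and ?e' = "\<one>\<^bsub>C2\<^esub>"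
  note o = C1_one_closed C2_one_closed
  have mult: "a \<otimes>\<^bsub>IDR\<^esub> b \<in> X" if "a \<in> X" "b \<in> X" for a b
    using that bilinear_maps_closed[OF IDR_bilinear] ring_hom_mult[OF er] ring_hom_mult[OF tr]
    by (simp add: X_def)
  have itg: "IDR_itg a \<in> X" if "a \<in> X" for a
    using that linear_maps_closed[OF IDR_itg_linear] ei ti by (simp add: X_def)
  have iX: "iota x \<in> X" if "x \<in> carrier R" for x
    using that iota iota_closed by (simp add: X_def)
  have zero: "h \<zero>\<^bsub>IDR\<^esub> = \<zero>\<^bsub>S\<^esub>" if h: "h \<in> ring_hom IDR S" for h
  proof -
    have "h \<zero>\<^bsub>IDR\<^esub> \<in> carrier S" by (rule ring_hom_closed[OF h]) simp
    moreover have "h \<zero>\<^bsub>IDR\<^esub> \<oplus>\<^bsub>S\<^esub> h \<zero>\<^bsub>IDR\<^esub> = \<zero>\<^bsub>S\<^esub> \<oplus>\<^bsub>S\<^esub> h \<zero>\<^bsub>IDR\<^esub>"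
      using ring_hom_add[OF h, of "\<zero>\<^bsub>IDR\<^esub>" "\<zero>\<^bsub>IDR\<^esub>"] calculation by simp
    ultimately show ?thesis by (simp only: S.add.right_cancel S.zero_closed)
  qed
  have X: "submodule X C IDR"
  proof (rule module_submoduleI[OF IDR_module])
    show "X \<subseteq> carrier IDR" "\<zero>\<^bsub>IDR\<^esub> \<in> X" by (auto simp: X_def zero[OF er] zero[OF tr])
    show "a \<oplus>\<^bsub>IDR\<^esub> b \<in> X" if "a \<in> X" "b \<in> X" for a b
      using that ring_hom_add[OF er] ring_hom_add[OF tr] by (simp add: X_def)
    show "c \<odot>\<^bsub>IDR\<^esub> a \<in> X" if "c \<in> carrier C" "a \<in> X" for c a
      using mult[OF iX that(2), of c] that iota_mult_constant[of c a] by (simp add: constantsD X_def)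
  qed
  note D = submoduleD[OF X IDR_module]
  have pure_words: "pure \<one> ?e ?e' f \<in> X" if "f \<in> RT_lists" for f
    using that
  proof (induction f rule: list.induct)
    case Nil
    show ?case using iX[of \<one>] by (simp add: iota_def)
  next
    case (Cons y f)
    then have y: "y \<in> carrier RT" and f: "f \<in> RT_lists" by auto
    have "iota y \<otimes>\<^bsub>IDR\<^esub> pure \<one> ?e ?e' f \<in> X" by (intro mult iX Cons.IH f RT_into_R y)
    then have "pure y ?e ?e' f \<in> X" using y f o by (simp add: iota_mult_pure RT_into_R)
    from itg[OF this] show ?case
      using y f o by (simp add: IDR_itg_pure RT_into_R itg_pure_RT)
  qed
  have pure_R: "pure x ?e ?e' f \<in> X" if x: "x \<in> carrier R" and f: "f \<in> RT_lists" for x f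
    using mult[OF iX[OF x] pure_words[OF f]] x f o by (simp add: iota_mult_pure)
  have gen1: "pure \<one> (eps1 (Q x) (w f)) ?e' [] \<in> X"
    if x: "x \<in> carrier R" and f: "f \<in> RT_lists" "f \<noteq> []" for x f
  proof -
    from f obtain y g where fy: "f = y # g" and y: "y \<in> carrier RT" and g: "g \<in> RT_lists" by (cases f) auto
    have Qxy: "Q x \<otimes> y \<in> carrier R" using x y by (simp add: Q_closed RT_into_R)
    let ?a = "pure (Q x) ?e ?e' f" and ?b = "pure \<one> (eps1 (Q x) (w f)) ?e' []"
      and ?d = "itg_pure (Q x \<otimes> y) ?e ?e' g" and ?z = "pure \<one> ?e ?e' ((x \<ominus> der (Q x)) # f)"
    have a: "?a \<in> X" by (intro pure_R Q_closed x f)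
    have d: "?d \<in> X" using itg[OF pure_R[OF Qxy g]] Qxy g o by (simp add: IDR_itg_pure)
    have z: "?z \<in> X" using transcendental_part[OF x] f by (intro pure_words) simp
    have i: "itg_pure x ?e ?e' f \<in> X" using itg[OF pure_R[OF x f(1)]] x f o by (simp add: IDR_itg_pure)
    have b: "?b \<in> carrier IDR" by (intro pure_closed eps1_closed o x f) simp_all
    have eq: "itg_pure x ?e ?e' f = ?a \<ominus>\<^bsub>IDR\<^esub> ?b \<ominus>\<^bsub>IDR\<^esub> ?d \<oplus>\<^bsub>IDR\<^esub> ?z"
      using eps1_closed[OF x f] by (simp add: fy C1_one_left)
    have solve: "a \<ominus>\<^bsub>IDR\<^esub> d \<oplus>\<^bsub>IDR\<^esub> z \<ominus>\<^bsub>IDR\<^esub> (a \<ominus>\<^bsub>IDR\<^esub> b \<ominus>\<^bsub>IDR\<^esub> d \<oplus>\<^bsub>IDR\<^esub> z) = b"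
      if "a \<in> carrier IDR" "b \<in> carrier IDR" "d \<in> carrier IDR" "z \<in> carrier IDR" for a b d z
    proof -
      have "a \<ominus>\<^bsub>IDR\<^esub> d \<oplus>\<^bsub>IDR\<^esub> z = b \<oplus>\<^bsub>IDR\<^esub> (a \<ominus>\<^bsub>IDR\<^esub> b \<ominus>\<^bsub>IDR\<^esub> d \<oplus>\<^bsub>IDR\<^esub> z)"
      proof -
        have "a \<ominus>\<^bsub>IDR\<^esub> b \<ominus>\<^bsub>IDR\<^esub> d \<oplus>\<^bsub>IDR\<^esub> z = \<ominus>\<^bsub>IDR\<^esub> b \<oplus>\<^bsub>IDR\<^esub> (a \<ominus>\<^bsub>IDR\<^esub> d \<oplus>\<^bsub>IDR\<^esub> z)"
          using that by (simp add: a_minus_def P.M.a_ac)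
        then show ?thesis using that P.M.r_neg2[of b "a \<ominus>\<^bsub>IDR\<^esub> d \<oplus>\<^bsub>IDR\<^esub> z"] by simp
      qed
      then show ?thesis using that by (simp add: a_minus_def P.M.a_assoc P.M.r_neg)
    qed
    have "?b = ?a \<ominus>\<^bsub>IDR\<^esub> ?d \<oplus>\<^bsub>IDR\<^esub> ?z \<ominus>\<^bsub>IDR\<^esub> itg_pure x ?e ?e' f"
      unfolding eq
      by (rule solve[symmetric, OF subsetD[OF D(1) a] b subsetD[OF D(1) d] subsetD[OF D(1) z]])
    moreover have "\<dots> \<in> X" by (intro D(3,5) a d z i)
    ultimately show ?thesis by (simp only:)
  qed
  have C1_part: "pure \<one> c ?e' [] \<in> X" if c: "c \<in> carrier C1" for c
  proof -
    have lin: "(\<lambda>c. pure \<one> c ?e' []) \<in> linear_maps C C1 IDR" by (intro pure_linear_C1 o) simp_all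
    have sg: "sym_gen C M1 \<in> linear_maps C M1 C1" unfolding C1_def by (rule sym_gen_linear[OF M1_module])
    have gen: "pure \<one> (sym_gen C M1 m) ?e' [] \<in> X" if m: "m \<in> carrier M1" for m
    proof (rule linear_maps_into_submodule[OF tensor_spans[OF RJ_module spans_carrier T_pos_module T_pos_spans, folded M1_def]
          linear_maps_comp[OF lin sg] M1_module IDR_module X _ m])
      fix u assume "u \<in> {tensor C RJ T_pos x y |x y. x \<in> carrier RJ \<and> y \<in> w ` (RT_lists - {[]})}"
      then obtain x f where u: "u = tensor C RJ T_pos (Q x) (w f)" and x: "x \<in> carrier R"
        and f: "f \<in> RT_lists" "f \<noteq> []" by auto
      show "pure \<one> (sym_gen C M1 u) ?e' [] \<in> X" using gen1[OF x f] by (simp add: u eps1_def)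
    qed
    show ?thesis
    proof (rule sym_algebra_into_submodule[OF M1_module lin[unfolded C1_def] IDR_module X _ _ c[unfolded C1_def]],
        unfold C1_def[symmetric])
      show "pure \<one> ?e ?e' [] \<in> X" by (rule pure_words) simp
      fix m d assume m: "m \<in> carrier M1" and d: "d \<in> carrier C1" "pure \<one> d ?e' [] \<in> X"
      have "pure \<one> (sym_gen C M1 m) ?e' [] \<otimes>\<^bsub>IDR\<^esub> pure \<one> d ?e' [] \<in> X" by (rule mult[OF gen[OF m] d(2)])
      then show "pure \<one> (sym_gen C M1 m \<otimes>\<^bsub>C1\<^esub> d) ?e' [] \<in> X"
        using linear_maps_closed[OF sg m] d o by (simp add: pure_mult_Nil C2_one_left)
    qed
  qed
  have embed: "C2T_embed (t2 c t) \<in> X" if c: "c \<in> carrier C2" and cX: "pure \<one> ?e c [] \<in> X" and t: "t \<in> carrier T" for c t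
  proof (rule linear_maps_into_submodule[OF T_spans linear_maps_comp[OF C2T_embed_linear
          bilinear_maps_right[OF t2_bilinear c]] T_module IDR_module X _ t])
    fix u assume "u \<in> w ` RT_lists"
    then obtain f where u: "u = w f" and f: "f \<in> RT_lists" by blast
    have "pure \<one> ?e c [] \<otimes>\<^bsub>IDR\<^esub> pure \<one> ?e ?e' f \<in> X" by (intro mult cX pure_words f)
    then show "C2T_embed (t2 c u) \<in> X"
      using c f o by (simp add: u C2T_embed_t2 pure_mult_Nil C1_one_left C2_one_right)
  qed
  have gen2: "pure \<one> ?e (eps2 (w f) (w g)) [] \<in> X"
    if "f \<in> RT_lists" "f \<noteq> []" "g \<in> RT_lists" "g \<noteq> []" for f g
    using that
  proof (induction "length f + length g" arbitrary: f g rule: less_induct)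
    case less
    note f = less.prems(1,2) and g = less.prems(3,4)
    note td = take_drop_RT_lists
    interpret T2: module C C2T by (rule C2T_module)
    define Y where "Y = {p \<in> carrier C2T. C2T_embed p \<in> X}"
    have Y: "submodule Y C C2T" unfolding Y_def by (rule submodule_vimage[OF C2T_embed_linear C2T_module IDR_module X])
    note DY = submoduleD[OF Y C2T_module]
    \<comment> \<open>The terms of the correction sum; the one with \<open>i = j = 0\<close> contains \<open>\<epsilon>(f \<odot> g)\<close>.\<close>
    define t where "t i j = t2 (?e' \<otimes>\<^bsub>C2\<^esub> eps2 (w (drop i f)) (w (drop j g))) (w (take i f) \<otimes>\<^bsub>T\<^esub> w (take j g))" for i j
    have ec: "eps2 (w (drop i f)) (w (drop j g)) \<in> carrier C2" if "i < length f" "j < length g" for i j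
      by (intro eps2_closed td f g) (use that in auto)
    have Tc: "w (take i f) \<otimes>\<^bsub>T\<^esub> w (take j g) \<in> carrier T" for i j by (intro T_mult_closed td f g)
    have tc: "t i j \<in> carrier C2T" if "i < length f" "j < length g" for i j
      unfolding t_def using that ec o by (intro bilinear_maps_closed[OF t2_bilinear] bilinear_maps_closed[OF C2_bilinear] Tc) auto
    have tY: "t i j \<in> Y" if ij: "i < length f" "j < length g" "0 < i + j" for i j
    proof -
      have "pure \<one> ?e (eps2 (w (drop i f)) (w (drop j g))) [] \<in> X"
        by (rule less.hyps) (use ij f g in \<open>auto intro: td dest: in_set_dropD\<close>)
      then have "C2T_embed (t i j) \<in> X"
        unfolding t_def using embed[OF ec[OF ij(1,2)] _ Tc] ec[OF ij(1,2)] by (simp add: C2_one_left)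
      then show ?thesis using tc[OF ij(1,2)] by (simp add: Y_def)
    qed
    obtain n m where n: "length f = Suc n" and m: "length g = Suc m"
      using f g by (metis length_Suc_conv list.exhaust)
    let ?a = "t2 ?e' (w f \<otimes>\<^bsub>T\<^esub> w g)"
    define S1 where "S1 = (\<Oplus>\<^bsub>C2T\<^esub>j\<in>{0..<m}. t 0 (Suc j))"
    define S2 where "S2 = (\<Oplus>\<^bsub>C2T\<^esub>i\<in>{0..<n}. \<Oplus>\<^bsub>C2T\<^esub>j\<in>{0..<Suc m}. t (Suc i) j)"
    have S1: "S1 \<in> Y" unfolding S1_def by (rule submodule_finsum[OF Y C2T_module], rule tY) (auto simp: n m)
    have S2: "S2 \<in> Y" unfolding S2_def
      by (intro submodule_finsum[OF Y C2T_module] tY) (auto simp: n m)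
    have a: "?a \<in> Y"
      using embed[OF o(2) _ T_mult_closed[OF f(1) g(1)]] pure_words[of "[]"]
        bilinear_maps_closed[OF t2_bilinear o(2) T_mult_closed[OF f(1) g(1)]] by (simp add: Y_def)
    have t00: "t 0 0 \<in> carrier C2T" by (rule tc) (simp_all add: n m)
    have cl: "(\<Oplus>\<^bsub>C2T\<^esub>j\<in>{0..<Suc m}. t i j) \<in> carrier C2T" if "i < Suc n" for i
      using that tc by (intro T2.M.finsum_closed) (auto simp: n m)
    have wp: "word_product ?e' f g = ?a \<oplus>\<^bsub>C2T\<^esub> ((t 0 0 \<oplus>\<^bsub>C2T\<^esub> S1) \<oplus>\<^bsub>C2T\<^esub> S2)"
    proof -
      have "(\<Oplus>\<^bsub>C2T\<^esub>i\<in>{0..<Suc n}. \<Oplus>\<^bsub>C2T\<^esub>j\<in>{0..<Suc m}. t i j) = (\<Oplus>\<^bsub>C2T\<^esub>j\<in>{0..<Suc m}. t 0 j) \<oplus>\<^bsub>C2T\<^esub> S2"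
        unfolding S2_def by (rule T2.M.finsum_Suc_shift) (use cl in auto)
      also have "(\<Oplus>\<^bsub>C2T\<^esub>j\<in>{0..<Suc m}. t 0 j) = t 0 0 \<oplus>\<^bsub>C2T\<^esub> S1"
        unfolding S1_def by (rule T2.M.finsum_Suc_shift) (use tc in \<open>auto simp: n m\<close>)
      finally show ?thesis unfolding word_product_def t_def[symmetric] n m by simp
    qed
    have "C2T_embed (word_product ?e' f g) \<in> X"
      using mult[OF pure_words[OF f(1)] pure_words[OF g(1)]] pure_mult_words[OF f(1) g(1)] by simp
    then have wpY: "word_product ?e' f g \<in> Y"
      using linear_maps_closed[OF word_product_linear[OF f(1) g(1)] o(2)] by (simp add: Y_def)
    have "u = (a \<oplus>\<^bsub>C2T\<^esub> ((u \<oplus>\<^bsub>C2T\<^esub> s) \<oplus>\<^bsub>C2T\<^esub> s')) \<ominus>\<^bsub>C2T\<^esub> (a \<oplus>\<^bsub>C2T\<^esub> (s \<oplus>\<^bsub>C2T\<^esub> s'))"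
      if "u \<in> carrier C2T" "a \<in> carrier C2T" "s \<in> carrier C2T" "s' \<in> carrier C2T" for u a s s'
    proof -
      have "a \<oplus>\<^bsub>C2T\<^esub> ((u \<oplus>\<^bsub>C2T\<^esub> s) \<oplus>\<^bsub>C2T\<^esub> s') = u \<oplus>\<^bsub>C2T\<^esub> (a \<oplus>\<^bsub>C2T\<^esub> (s \<oplus>\<^bsub>C2T\<^esub> s'))"
        using that by (simp add: T2.M.a_ac)
      then show ?thesis using that by (simp add: a_minus_def T2.M.a_assoc T2.M.r_neg)
    qed
    from this[OF t00] have "t 0 0 = word_product ?e' f g \<ominus>\<^bsub>C2T\<^esub> (?a \<oplus>\<^bsub>C2T\<^esub> (S1 \<oplus>\<^bsub>C2T\<^esub> S2))"
      unfolding wp using a S1 S2 DY(1) by blast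
    then have "t 0 0 \<in> Y" using wpY a S1 S2 by (simp add: DY(3,5))
    then have "C2T_embed (t 0 0) \<in> X" by (simp add: Y_def)
    then show ?case
      using eps2_closed[OF f g] by (simp add: t_def C2_one_left T_mult_words(1) C2T_embed_t2)
  qed
  have C2_part: "pure \<one> ?e c [] \<in> X" if c: "c \<in> carrier C2" for c
  proof -
    interpret A: algebra C Sym2 by (rule Sym2_algebra)
    let ?pr = "\<lambda>p. J2 +>\<^bsub>Sym2\<^esub> p"
    have lin: "(\<lambda>p. pure \<one> ?e (?pr p) []) \<in> linear_maps C Sym2 IDR"
      by (rule linear_maps_comp[OF pure_linear_C2 C2_proj_linear]) (use o in simp_all)
    have pc: "?pr p \<in> carrier C2" if "p \<in> carrier Sym2" for p by (rule linear_maps_closed[OF C2_proj_linear that])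
    have sg: "sym_gen C M2 \<in> linear_maps C M2 Sym2" unfolding Sym2_def by (rule sym_gen_linear[OF M2_module])
    have gen: "pure \<one> ?e (?pr (sym_gen C M2 m)) [] \<in> X" if m: "m \<in> carrier M2" for m
    proof (rule linear_maps_into_submodule[OF sym_prod_spans[OF T_pos_module T_pos_spans T_pos_spans, folded M2_def]
          linear_maps_comp[OF lin sg] M2_module IDR_module X _ m])
      fix u assume "u \<in> {sym_prod C T_pos x y |x y. x \<in> w ` (RT_lists - {[]}) \<and> y \<in> w ` (RT_lists - {[]})}"
      then obtain f g where u: "u = sym_prod C T_pos (w f) (w g)"
        and fg: "f \<in> RT_lists" "f \<noteq> []" "g \<in> RT_lists" "g \<noteq> []" by auto
      show "pure \<one> ?e (?pr (sym_gen C M2 u)) [] \<in> X"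
        using gen2[OF fg] by (simp add: u eps2_def eps_sym2_def)
    qed
    from c obtain p where p: "p \<in> carrier Sym2" "c = ?pr p"
      by (auto simp: C2_def quot_module_carrier)
    note qm = quot_algebra_mult[OF Sym2_algebra J2_ideal, folded C2_def]
    have lin': "(\<lambda>p. pure \<one> ?e (?pr p) []) \<in> linear_maps C (sym_algebra C M2) IDR"
      using lin by (simp only: Sym2_def)
    have "pure \<one> ?e (?pr p) [] \<in> X"
    proof (rule sym_algebra_into_submodule[OF M2_module lin' IDR_module X _ _ p(1)[unfolded Sym2_def]],
        unfold Sym2_def[symmetric])
      have "?pr \<one>\<^bsub>Sym2\<^esub> = ?e'" by (simp add: C2_def quot_module_simps)
      then show "pure \<one> ?e (?pr \<one>\<^bsub>Sym2\<^esub>) [] \<in> X" using pure_words[of "[]"] by simp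
      fix m d assume m: "m \<in> carrier M2" and d: "d \<in> carrier Sym2" "pure \<one> ?e (?pr d) [] \<in> X"
      have mc: "sym_gen C M2 m \<in> carrier Sym2" by (rule linear_maps_closed[OF sg m])
      have "pure \<one> ?e (?pr (sym_gen C M2 m)) [] \<otimes>\<^bsub>IDR\<^esub> pure \<one> ?e (?pr d) [] \<in> X" by (rule mult[OF gen[OF m] d(2)])
      then show "pure \<one> ?e (?pr (sym_gen C M2 m \<otimes>\<^bsub>Sym2\<^esub> d)) [] \<in> X"
        using mc d o pc by (simp add: pure_mult_Nil C1_one_left qm)
    qed
    then show ?thesis using p(2) by simp
  qed
  have "pure x c c' f \<in> X" if "x \<in> carrier R" "c \<in> carrier C1" "c' \<in> carrier C2" "f \<in> RT_lists" for x c c' f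
  proof -
    have "iota x \<otimes>\<^bsub>IDR\<^esub> (pure \<one> c ?e' [] \<otimes>\<^bsub>IDR\<^esub> (pure \<one> ?e c' [] \<otimes>\<^bsub>IDR\<^esub> pure \<one> ?e ?e' f)) \<in> X"
      by (intro mult iX C1_part C2_part pure_words that)
    then show ?thesis
      using that o by (simp add: pure_mult_Nil iota_mult_pure C1_one_left C1_one_right C2_one_left C2_one_right)
  qed
  then have "(\<lambda>(x, c1, c2, f). pure x c1 c2 f) ` (carrier R \<times> carrier C1 \<times> carrier C2 \<times> RT_lists) \<subseteq> X"
    by (intro subsetI, elim pure_familyE) simp
  from spans_submodule[OF pure_spans X this p] show ?thesis by (simp add: X_def)
qed

end

lemma integro_diff_ring_hom_restrict:
  assumes h: "h \<in> integro_diff_ring_hom A d i B d' i'"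
    and "\<And>x y. x \<in> carrier A \<Longrightarrow> y \<in> carrier A \<Longrightarrow> x \<oplus>\<^bsub>A\<^esub> y \<in> carrier A"
    and "\<And>x y. x \<in> carrier A \<Longrightarrow> y \<in> carrier A \<Longrightarrow> x \<otimes>\<^bsub>A\<^esub> y \<in> carrier A"
    and "\<one>\<^bsub>A\<^esub> \<in> carrier A"
    and "\<And>x. x \<in> carrier A \<Longrightarrow> d x \<in> carrier A" "\<And>x. x \<in> carrier A \<Longrightarrow> i x \<in> carrier A"
  shows "restrict h (carrier A) \<in> integro_diff_ring_hom A d i B d' i'"
  using assms by (simp add: integro_diff_ring_hom_def diff_ring_hom_def ring_hom_def Pi_iff)

theorem corollary46:
  fixes R :: "('a, 'm) ring_scheme" and derR Q :: "'a \<Rightarrow> 'a"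
    and S :: "('b, 'n) ring_scheme" and derS itgS :: "'b \<Rightarrow> 'b"
    and \<phi> :: "'a \<Rightarrow> 'b"
  assumes "quasi_integro_diff_cring R derR Q"
    and "integro_diff_cring S derS itgS"
    and "\<phi> \<in> diff_ring_hom R derR S derS"
    and "\<forall>f\<in>carrier R. \<phi> (Q (derR f)) = itgS (derS (\<phi> f))"
  shows "\<exists>!\<eta>. \<eta> \<in> extensional (carrier (quasi_integro_diff_cring.IDR R derR Q)) \<and>
    \<eta> \<in> integro_diff_ring_hom
          (quasi_integro_diff_cring.IDR R derR Q)
          (quasi_integro_diff_cring.IDR_der R derR Q)
          (quasi_integro_diff_cring.IDR_itg R derR Q)
          S derS itgS \<and>
    (\<forall>f\<in>carrier R. \<eta> (quasi_integro_diff_cring.iota R derR Q f) = \<phi> f)"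
proof -
  interpret integro_diff_target R derR Q S derS itgS \<phi>
    using assms by (intro integro_diff_target.intro integro_diff_target_axioms.intro) auto
  interpret P: module C IDR by (rule IDR_module)
  from IDR_hom_exists obtain eta where
    eta: "eta \<in> integro_diff_ring_hom IDR IDR_der IDR_itg S derS itgS" "\<forall>f\<in>carrier R. eta (iota f) = \<phi> f" by blast
  have one: "\<one>\<^bsub>IDR\<^esub> \<in> carrier IDR"
    unfolding IDR_one by (intro pure_closed C1_one_closed C2_one_closed) simp_all
  let ?eta = "restrict eta (carrier IDR)"
  have "?eta \<in> integro_diff_ring_hom IDR IDR_der IDR_itg S derS itgS"
    by (rule integro_diff_ring_hom_restrict[OF eta(1) P.M.a_closed bilinear_maps_closed[OF IDR_bilinear] one
          linear_maps_closed[OF IDR_der_linear] linear_maps_closed[OF IDR_itg_linear]])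
  moreover have "\<forall>f\<in>carrier R. ?eta (iota f) = \<phi> f"
    using eta(2) iota_closed by simp
  ultimately show ?thesis
  proof (intro ex1I[of _ ?eta] conjI restrict_extensional)
    fix theta assume theta: "theta \<in> extensional (carrier IDR) \<and>
      theta \<in> integro_diff_ring_hom IDR IDR_der IDR_itg S derS itgS \<and> (\<forall>f\<in>carrier R. theta (iota f) = \<phi> f)"
    show "theta = ?eta"
    proof (rule extensionalityI[of _ "carrier IDR"])
      fix p assume p: "p \<in> carrier IDR"
      have "theta p = eta p"
        by (rule IDR_hom_unique[OF _ eta(1) _ p]) (use theta eta(2) in auto)
      then show "theta p = ?eta p" using p by simp
    qed (use theta in auto)
  qed auto
qed

end
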